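(* Let $\mathbf{x}_0\in\mathbb{R}^2$ satisfy the assumptions on $\mathbf{x}_0$ listed in the context, let $\rho>0$, and let $F\in\mathbb{R}^2$ be the random vector $F=\int_{B_\rho(\mathbf 0)}\check{\mathbf y}\,f^{\mathrm{rec}}(\check{\mathbf y})\,d\check{\mathbf y}$ defined in the context (it is computed from the reconstruction in the neighborhood $\mathbf{x}_0+\epsilon B_\rho(\mathbf 0)$). Let $\hat C$ be the $2\times 2$ matrix with entries $$\hat C_{i,j}=\int_{B_\rho(\mathbf 0)}\int_{B_\rho(\mathbf 0)}\check x_i\,\check y_j\,C(\check{\mathbf x}-\check{\mathbf y})\,d\check{\mathbf x}\,d\check{\mathbf y},\quad i,j\in\{1,2\},$$ and let $H=\int_{B_\rho(\mathbf 0)}\check{\mathbf y}\,f_T(\vec\Theta_0\cdot\check{\mathbf y})\,d\check{\mathbf y}$. Consider the two hypotheses $$\mathsf H_0\ (\text{i.e. }\mathbf{x}_0\notin\mathcal S):\ F\sim\mathcal N(0,\hat C);\qquad \mathsf H_1\ (\text{i.e. }\mathbf{x}_0\in\mathcal S):\ F\sim\mathcal N(H,\hat C),\ H\neq0.$$ Let the test statistic be $Z:=F^T\hat C^{-1}F$, and let $\alpha\in(0,1)$. Then the likelihood ratio test (LRT) of size $\alpha$ for testing $\mathsf H_0$ against $\mathsf H_1$ rejects $\mathsf H_0$ if $Z>-2\ln\alpha$. The power of this test is $1-\Upsilon_1(-2\ln\alpha)$, where $\Upsilon_1$ is the cumulative distribution function of the non-central chi-squared distribution $\chi^2_2(\mu)$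 with $2$ degrees of freedom and non-centrality parameter $\mu=H^T\hat C^{-1}H$.
   Context: Setting. Fix $\kappa>0$, $P>0$. Write $\vec\alpha=(\cos\alpha,\sin\alpha)$. The function $\sigma\in C^1([-\pi,\pi]\times[-P,P])$ (noise standard deviation, angle taken modulo $2\pi$) is even: $\sigma(\alpha,p)=\sigma(\alpha+\pi,-p)$. The kernel $\varphi:\mathbb{R}\to\mathbb{R}$ is compactly supported, $\varphi^{(M+1)}\in L^\infty(\mathbb{R})$ for some $M\ge3$ with $M>\max(\nu+1,3)$ ($\nu$ as in (1) below), and $\sum_{k\in\mathbb Z}\varphi(t-k)k^j\equiv t^j$ for $j=0,1$ (hence $\int\varphi=1$). The function $f$ is supported in $\{|\mathbf x|<P\}$ and has the form $f=\sum_{k=1}^K f_k\chi_{D_k}$ with $f_k\in C^\infty(\mathbb{R}^2)$ and open sets $D_k$ with piecewise smooth boundary; $\mathcal S$ is the singular support of $f$. If $\mathbf x_0\in\mathcal S$, $\vec\Theta_0$ is a unit vector normal to $\mathcal S$ at $\mathbf x_0$, and the jump $\Delta f(\mathbf x_0)=\lim_{t\to0^+}(f(\mathbf x_0+t\vec\Theta_0)-f(\mathbf x_0-t\vec\Theta_0))$ is normalized to be $1$. Assumptions on $\mathbf x_0$: (1) $\kappa|\mathbf x_0|$ is irrational of some finite type $\nu$, where an irrational $s$ is of type $\nu$ if $\nu$ is the infimum of all $\nu_1$ for which there is $c>0$ with $m^{\nu_1}\,\mathrm{dist}(ms,\mathbb Z)\ge c$ for all $m\in\mathbb N$; (2) $\sigma^2(\alpha,\vec\alpha\cdot\mathbf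 x_0)\ne0$ for all $\alpha$ in some nonempty open set $\Omega\subset[0,2\pi]$; (3) $|\mathbf x_0|<P$; and, when $\mathbf x_0\in\mathcal S$: (4) the curvature of $\mathcal S$ at $\mathbf x_0$ is not zero; (5) $\kappa\,\mathbf x_0\cdot\vec\Theta_0^\perp$ is irrational; (6) the line $\{\mathbf x:(\mathbf x-\mathbf x_0)\cdot\vec\Theta_0=0\}$ is not tangent to $\mathcal S$ at any point where the curvature of $\mathcal S$ is zero. Noise model. $N^{\mathrm{rec}}(\check{\mathbf x})$ is a real Gaussian random field on $\mathbb{R}^2$ with zero mean, covariance $\mathrm{Cov}(\check{\mathbf x},\check{\mathbf y})=C(\check{\mathbf x}-\check{\mathbf y})$, and sample paths continuous with probability $1$, where $$C(\check{\mathbf x})=\Big(\frac{\kappa}{4\pi}\Big)^2\int_0^{2\pi}\sigma^2(\alpha,\vec\alpha\cdot\mathbf x_0)\,(\varphi'\star\varphi')(\vec\alpha\cdot\check{\mathbf x})\,d\alpha,\qquad (g\star h)(t)=\int_{\mathbb R}g(t+s)h(s)\,ds.$$ Edge response: $f_T(t)=\int_{-\infty}^t\varphi(s)\,ds-\tfrac12$. Local reconstruction. The image reconstructed from noisy data with sampling step $\epsilon\ll1$ is identified, near $\mathbf x_0$ and in rescaled coordinates $\check{\mathbf y}=(\mathbf x-\mathbf x_0)/\epsilon$, with its small-$\epsilon$ limit: $f^{\mathrm{rec}}(\check{\mathbf y})=c+f_T(\vec\Theta_0\cdot\check{\mathbf y})+N^{\mathrm{rec}}(\check{\mathbf y})$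 if $\mathbf x_0\in\mathcal S$, and $f^{\mathrm{rec}}(\check{\mathbf y})=c+N^{\mathrm{rec}}(\check{\mathbf y})$ if $\mathbf x_0\notin\mathcal S$, with $c$ a deterministic constant. $B_\rho(\mathbf 0)$ is the closed disk of radius $\rho$ centered at $\mathbf 0$ in $\mathbb{R}^2$. LRT. For the family $F\sim\mathcal N(\mu,\hat C)$, $\mu\in\mathbb{R}^2$, with known $\hat C$ and density $p(\cdot;\mu)$, the LRT of $\mu=0$ versus $\mu\ne0$ rejects for large values of $\log\big(\max_{\mu\in\mathbb{R}^2}p(F;\mu)/p(F;0)\big)$; it has size $\alpha$ if the probability of rejection under $\mathsf H_0$ equals $\alpha$. The power is the probability of rejection under $\mathsf H_1$ with mean $H$. *)

theory Defs
  imports "HOL-Probability.Probability"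
begin

section \<open>Smooth functions, curves, and singular support\<close>

text \<open>\<open>C\<^sup>k\<close> regularity.  The derivative is taken within \<open>S\<close>; the notion is used only for
  open sets and for closed intervals and rectangles with nonempty interior, where that derivative
  is unique.\<close>

primrec Ck_on ::
  "nat \<Rightarrow> 'a::euclidean_space set \<Rightarrow> ('a \<Rightarrow> 'b::real_normed_vector) \<Rightarrow> bool" where
  "Ck_on 0 S f \<longleftrightarrow> continuous_on S f"
| "Ck_on (Suc k) S f \<longleftrightarrow>
     (\<exists>f'. (\<forall>x\<in>S. (f has_derivative f' x) (at x within S)) \<and> (\<forall>v. Ck_on k S (\<lambda>x. f' x v)))"

definition smooth_on :: "'a::euclidean_space set \<Rightarrow> ('a \<Rightarrow> 'b::real_normed_vector) \<Rightarrow> bool" where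
  "smooth_on S f \<longleftrightarrow> (\<forall>k. Ck_on k S f)"

definition smooth_arc :: "(real \<Rightarrow> real^2) \<Rightarrow> bool" where
  "smooth_arc \<gamma> \<longleftrightarrow> arc \<gamma> \<and> smooth_on {0..1} \<gamma> \<and>
     (\<forall>t\<in>{0..1}. vector_derivative \<gamma> (at t within {0..1}) \<noteq> 0)"

text \<open>The boundary is a union of smooth regular arcs that meet only at endpoints.  The family is
  locally finite rather than finite, so that unbounded open sets are allowed.\<close>

definition piecewise_smooth_boundary :: "(real^2) set \<Rightarrow> bool" where
  "piecewise_smooth_boundary D \<longleftrightarrow> (\<exists>\<Gamma>.
     frontier D = (\<Union>\<gamma>\<in>\<Gamma>. path_image \<gamma>) \<and>
     (\<forall>\<gamma>\<in>\<Gamma>. smooth_arc \<gamma>) \<and>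
     (\<forall>r. finite {\<gamma>\<in>\<Gamma>. path_image \<gamma> \<inter> cball 0 r \<noteq> {}}) \<and>
     (\<forall>\<gamma>\<in>\<Gamma>. \<forall>\<delta>\<in>\<Gamma>. \<gamma> \<noteq> \<delta> \<longrightarrow>
        path_image \<gamma> \<inter> path_image \<delta> \<subseteq>
          {pathstart \<gamma>, pathfinish \<gamma>} \<inter> {pathstart \<delta>, pathfinish \<delta>}))"

text \<open>Singular support of \<open>f\<close> as a distribution, hence the equality almost everywhere.\<close>

definition singsupp :: "(real^2 \<Rightarrow> real) \<Rightarrow> (real^2) set" where
  "singsupp f = {x. \<not> (\<exists>U g. open U \<and> x \<in> U \<and> smooth_on U g \<and>
                        (AE y in lborel. y \<in> U \<longrightarrow> f y = g y))}"

text \<open>\<open>\<gamma>\<close> parametrizes \<open>S\<close> near \<open>x\<close> as an embedded regular \<open>C\<^sup>2\<close> curve, with \<open>\<gamma> 0 = x\<close>.  At a point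
  with no such \<open>\<gamma>\<close> (e.g. a corner), \<open>S\<close> has neither a normal nor a curvature.\<close>

definition local_curve :: "(real^2) set \<Rightarrow> real^2 \<Rightarrow> (real \<Rightarrow> real^2) \<Rightarrow> bool" where
  "local_curve S x \<gamma> \<longleftrightarrow> \<gamma> 0 = x \<and> Ck_on 2 {-1<..<1} \<gamma> \<and>
     (\<forall>t\<in>{-1<..<1}. vector_derivative \<gamma> (at t) \<noteq> 0) \<and>
     (\<exists>U \<delta>. open U \<and> x \<in> U \<and> homeomorphism {-1<..<1} (S \<inter> U) \<gamma> \<delta>)"

definition tangent_to :: "(real^2) set \<Rightarrow> real^2 \<Rightarrow> real^2 \<Rightarrow> bool" where
  "tangent_to S x v \<longleftrightarrow>
     (\<exists>\<gamma> r. local_curve S x \<gamma> \<and> v = r *\<^sub>R vector_derivative \<gamma> (at 0))"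

definition unit_normal :: "(real^2) set \<Rightarrow> real^2 \<Rightarrow> real^2 \<Rightarrow> bool" where
  "unit_normal S x n \<longleftrightarrow> norm n = 1 \<and>
     (\<exists>\<gamma>. local_curve S x \<gamma> \<and> n \<bullet> vector_derivative \<gamma> (at 0) = 0)"

text \<open>Absolute curvature \<open>\<bar>\<gamma>\<^sub>1' \<gamma>\<^sub>2'' - \<gamma>\<^sub>2' \<gamma>\<^sub>1''\<bar> / \<bar>\<gamma>'\<bar>\<^sup>3\<close>, which does not depend on \<open>\<gamma>\<close>.\<close>

definition has_curvature :: "(real^2) set \<Rightarrow> real^2 \<Rightarrow> real \<Rightarrow> bool" where
  "has_curvature S x k \<longleftrightarrow> (\<exists>\<gamma>. local_curve S x \<gamma> \<and>
     (let d1 = vector_derivative \<gamma> (at 0);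
          d2 = vector_derivative (\<lambda>t. vector_derivative \<gamma> (at t)) (at 0)
      in k = \<bar>d1 $ 1 * d2 $ 2 - d1 $ 2 * d2 $ 1\<bar> / norm d1 ^ 3))"

definition perp :: "real^2 \<Rightarrow> real^2" where
  "perp v = vector [- (v $ 2), v $ 1]"

definition dirvec :: "real \<Rightarrow> real^2" where
  "dirvec a = vector [cos a, sin a]"

section \<open>Type of an irrational number and interpolation kernels\<close>

definition type_exponents :: "real \<Rightarrow> real set" where
  "type_exponents s =
     {\<nu>1. \<exists>c>0. \<forall>m::nat. m \<ge> 1 \<longrightarrow> real m powr \<nu>1 * infdist (real m * s) \<int> \<ge> c}"

text \<open>Finite type means that \<open>type_exponents s\<close> is nonempty (\<open>Inf {}\<close> is a junk value for reals);
  for irrational \<open>s\<close> it is bounded below by Dirichlet's theorem.\<close>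

definition irrational_of_type :: "real \<Rightarrow> real \<Rightarrow> bool" where
  "irrational_of_type s \<nu> \<longleftrightarrow>
     s \<notin> \<rat> \<and> type_exponents s \<noteq> {} \<and> \<nu> = Inf (type_exponents s)"

text \<open>\<open>\<phi>\<^sup>(\<^sup>m\<^sup>+\<^sup>1\<^sup>) \<in> L\<^sup>\<infinity>\<close>: the first \<open>m\<close> derivatives exist classically and the \<open>m\<close>-th one is an
  indefinite integral of an essentially bounded function.\<close>

definition Suc_deriv_Linf :: "nat \<Rightarrow> (real \<Rightarrow> real) \<Rightarrow> bool" where
  "Suc_deriv_Linf m \<phi> \<longleftrightarrow>
     (\<forall>k<m. \<forall>t. (deriv ^^ k) \<phi> differentiable (at t)) \<and>
     (\<exists>g B. g \<in> borel_measurable lborel \<and> (AE t in lborel. \<bar>g t\<bar> \<le> B) \<and>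
        (\<forall>a b. a \<le> b \<longrightarrow> (deriv ^^ m) \<phi> b - (deriv ^^ m) \<phi> a = (LINT t:{a..b}|lborel. g t)))"

definition interpolation_kernel :: "nat \<Rightarrow> (real \<Rightarrow> real) \<Rightarrow> bool" where
  "interpolation_kernel m \<phi> \<longleftrightarrow>
     compact (closure {t. \<phi> t \<noteq> 0}) \<and> Suc_deriv_Linf m \<phi> \<and>
     (\<forall>j\<in>{0, 1::nat}. \<forall>t.
        ((\<lambda>k::int. \<phi> (t - of_int k) * of_int k ^ j) has_sum t ^ j) UNIV)"

section \<open>Noise covariance, edge response, and moments\<close>

definition crosscorr :: "(real \<Rightarrow> real) \<Rightarrow> (real \<Rightarrow> real) \<Rightarrow> real \<Rightarrow> real" where
  "crosscorr g h t = (LINT s|lborel. g (t + s) * h s)"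

definition noise_cov ::
  "real \<Rightarrow> (real \<Rightarrow> real \<Rightarrow> real) \<Rightarrow> (real \<Rightarrow> real) \<Rightarrow> real^2 \<Rightarrow> real^2 \<Rightarrow> real" where
  "noise_cov \<kappa> \<sigma> \<phi> x0 x = (\<kappa> / (4 * pi))\<^sup>2 *
     (LINT a:{0..2*pi}|lborel.
        (\<sigma> a (dirvec a \<bullet> x0))\<^sup>2 * crosscorr (deriv \<phi>) (deriv \<phi>) (dirvec a \<bullet> x))"

definition edge_response :: "(real \<Rightarrow> real) \<Rightarrow> real \<Rightarrow> real" where
  "edge_response \<phi> t = (LINT s:{..t}|lborel. \<phi> s) - 1/2"

definition moment_cov :: "(real^2 \<Rightarrow> real) \<Rightarrow> real \<Rightarrow> real^2^2" where
  "moment_cov C \<rho> = (\<chi> i j. LINT x:cball 0 \<rho>|lborel. LINT y:cball 0 \<rho>|lborel.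
                              x $ i * y $ j * C (x - y))"

definition first_moment :: "real \<Rightarrow> (real^2 \<Rightarrow> real) \<Rightarrow> real^2" where
  "first_moment \<rho> u = (LINT y:cball 0 \<rho>|lborel. u y *\<^sub>R y)"

section \<open>Gaussian random fields\<close>

text \<open>Normal law with mean \<open>m\<close> and variance \<open>v\<close>; \<open>v = 0\<close> (a constant) is allowed.\<close>

definition normal_rv :: "'w measure \<Rightarrow> ('w \<Rightarrow> real) \<Rightarrow> real \<Rightarrow> real \<Rightarrow> bool" where
  "normal_rv W X m v \<longleftrightarrow> X \<in> borel_measurable W \<and> v \<ge> 0 \<and>
     (if v = 0 then AE \<omega> in W. X \<omega> = m
      else distributed W lborel X (normal_density m (sqrt v)))"

definition gaussian_field :: "'w measure \<Rightarrow> ('w \<Rightarrow> real^2 \<Rightarrow> real) \<Rightarrow> bool" where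
  "gaussian_field W N \<longleftrightarrow>
     (\<forall>I a. finite I \<longrightarrow> (\<exists>m v. normal_rv W (\<lambda>\<omega>. \<Sum>x\<in>I. a x * N \<omega> x) m v))"

section \<open>Multivariate normal laws, likelihood ratio test, non-central chi-squared law\<close>

definition mvn_density :: "real^'n \<Rightarrow> real^'n^'n \<Rightarrow> real^'n \<Rightarrow> real" where
  "mvn_density \<mu> C v =
     exp (- ((v - \<mu>) \<bullet> (matrix_inv C *v (v - \<mu>))) / 2) / sqrt ((2 * pi) ^ CARD('n) * det C)"

definition mvn :: "real^'n \<Rightarrow> real^'n^'n \<Rightarrow> (real^'n) measure" where
  "mvn \<mu> C = density lborel (mvn_density \<mu> C)"

definition quad_stat :: "real^'n^'n \<Rightarrow> real^'n \<Rightarrow> real" where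
  "quad_stat C v = v \<bullet> (matrix_inv C *v v)"

text \<open>\<open>GREATEST q. \<exists>\<mu>. q = mvn_density \<mu> C v\<close> is the maximum of the likelihood over all means.\<close>

definition log_likelihood_ratio :: "real^'n^'n \<Rightarrow> real^'n \<Rightarrow> real" where
  "log_likelihood_ratio C v =
     ln ((GREATEST q. \<exists>\<mu>. q = mvn_density \<mu> C v) / mvn_density 0 C v)"

text \<open>\<open>R\<close> is the rejection region of an LRT of size \<open>\<alpha>\<close> of \<open>\<mu> = 0\<close> versus \<open>\<mu> \<noteq> 0\<close>.\<close>

definition lrt_rejection_region :: "real^'n^'n \<Rightarrow> real \<Rightarrow> (real^'n) set \<Rightarrow> bool" where
  "lrt_rejection_region C \<alpha> R \<longleftrightarrow>
     (\<exists>t. R = {v. log_likelihood_ratio C v > t}) \<and> measure (mvn 0 C) R = \<alpha>"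

text \<open>Law of \<open>\<Sum>i<k. X\<^sub>i\<^sup>2\<close> for independent unit-variance normal \<open>X\<^sub>i\<close> whose squared means sum to
  \<open>\<mu>\<close>.  It depends on the means only through \<open>\<mu>\<close>, so they are taken to be \<open>(\<surd>\<mu>, 0, \<dots>, 0)\<close>.\<close>

definition noncentral_chi2 :: "nat \<Rightarrow> real \<Rightarrow> real measure" where
  "noncentral_chi2 k \<mu> =
     distr (\<Pi>\<^sub>M i\<in>{..<k}. density lborel (normal_density (if i = 0 then sqrt \<mu> else 0) 1))
       borel (\<lambda>x. \<Sum>i<k. (x i)\<^sup>2)"

end

theory Submission
  imports Defs "HOL-Real_Asymp.Real_Asymp"
begin

text \<open>The covariance \<open>C (x - y)\<close> is the Gram kernel of \<open>(a, s) \<mapsto> \<sigma>(a) \<phi>'(dirvec a \<bullet> x + s)\<close>, so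
  \<open>v \<bullet> (Chat *v v)\<close> is, up to a constant, the squared \<open>L\<^sup>2\<close> norm of \<open>\<sigma>(a) \<integral> (v \<bullet> x) \<phi>'(dirvec a \<bullet> x + s) dx\<close>.
  Testing this function against \<open>s\<^sup>2\<close> for one direction \<open>a\<close> with \<open>\<sigma>(a) \<noteq> 0\<close> shows that it is not zero.
  The vector \<open>F\<close> is an almost sure limit of finite linear combinations of values of the field, which
  yields its characteristic function and, by Kac's theorem applied after whitening, its normal law.
  The log likelihood ratio is half of \<open>quad_stat\<close>; after a whitening that sends \<open>H\<close> to a multiple of
  the first basis vector, \<open>quad_stat\<close> is the squared norm of a normal vector with unit covariance.\<close>

section \<open>Gaussian measures\<close>

text \<open>\<open>gaussian_field\<close> speaks of finite linear combinations only, while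
  \<open>F\<close> integrates a whole sample path, and its law has to be known exactly, not just its
  first two moments. This is why the passage to the limit is made with characteristic functions:
  their integrands are bounded by 1 and converge along with the paths. The other obstacle is strict
  positivity of the covariance matrix, without which neither \<open>matrix_inv\<close> nor the
  normal densities carry their meaning. The weight s^2 is the lowest power of s that detects
  anything: the integrals of \<open>deriv \<phi> (w + s)\<close> against 1 and s are 0 and -1,
  independent of w, and a constant is annihilated by the odd weight \<open>v \<bullet> x\<close> on
  the disk; against s^2 the integral is 2 w plus a constant. The same oddness removes the background
  \<open>c\<close> from \<open>F\<close>. The threshold \<open>- 2 * ln \<alpha>\<close> has a
  closed form because in dimension 2 the squared norm of a standard normal vector exceeds t with
  probability exp (- t / 2).\<close>

lemma matrix_inv_invertible:
  fixes A :: "real^'n^'n"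
  assumes "invertible A"
  shows "A ** matrix_inv A = mat 1" "matrix_inv A ** A = mat 1"
  using someI_ex[of "\<lambda>B. A ** B = mat 1 \<and> B ** A = mat 1"] assms
  unfolding invertible_def matrix_inv_def by blast+

lemma matrix_inv_unique:
  fixes A B :: "real^'n^'n"
  assumes "A ** B = mat 1"
  shows "invertible A" "matrix_inv A = B"
proof -
  show inv: "invertible A"
    using assms matrix_left_right_inverse unfolding invertible_def by blast
  have "matrix_inv A = matrix_inv A ** (A ** B)"
    by (simp add: assms)
  also have "\<dots> = B"
    by (simp add: matrix_mul_assoc matrix_inv_invertible[OF inv])
  finally show "matrix_inv A = B" .
qed

lemma posdef_invertible:
  fixes C :: "real^'n^'n"
  assumes "\<And>v. v \<noteq> 0 \<Longrightarrow> v \<bullet> (C *v v) > 0"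
  shows "invertible C"
proof -
  have "v = 0" if "C *v v = 0" for v
    using assms[of v] that by force
  then obtain B where "B ** C = mat 1"
    using matrix_left_invertible_ker[of C] by auto
  then show ?thesis
    using matrix_left_right_inverse unfolding invertible_def by blast
qed

lemma vec2_inner: "(x::real^2) \<bullet> y = x $ 1 * y $ 1 + x $ 2 * y $ 2"
  by (simp add: inner_vec_def sum_2)

text \<open>Cancelling one-sided inverses in the congruence that takes \<open>C\<close> to the
  identity reveals the inverse of \<open>C\<close>. From here on a whitening matrix \<open>A\<close>
  replaces \<open>matrix_inv C\<close> in all computations, and \<open>quad_stat\<close> is a
  squared Euclidean norm.\<close>

lemma whitening_inverse:
  fixes A C :: "real^'n^'n"
  assumes "A ** C ** transpose A = mat 1"
  shows "invertible C" "matrix_inv C = transpose A ** A"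
    "quad_stat C v = (A *v v) \<bullet> (A *v v)"
proof -
  have "A ** (C ** transpose A) = mat 1"
    using assms by (simp add: matrix_mul_assoc)
  then have "C ** transpose A ** A = mat 1"
    using matrix_left_right_inverse by blast
  then have *: "C ** (transpose A ** A) = mat 1"
    by (simp add: matrix_mul_assoc)
  then show "invertible C" and inv: "matrix_inv C = transpose A ** A"
    using matrix_inv_unique by blast+
  show "quad_stat C v = (A *v v) \<bullet> (A *v v)"
    unfolding quad_stat_def inv matrix_vector_mul_assoc[symmetric] by (metis dot_lmul_matrix inner_commute vector_transpose_matrix)
qed

text \<open>The rows of \<open>A\<close> are a basis of the plane that is orthonormal for the form
  given by \<open>C\<close>. The first row is proportional to the inverse of \<open>C\<close>
  applied to \<open>h\<close>, the second is orthogonal to \<open>h\<close>; this makes the second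
  coordinate of \<open>A *v h\<close> vanish and avoids matrix square roots and
  eigenvectors.\<close>

lemma whitening_exists:
  fixes C :: "real^2^2" and h :: "real^2"
  assumes sym: "transpose C = C" and pos: "\<And>v. v \<noteq> 0 \<Longrightarrow> v \<bullet> (C *v v) > 0"
  obtains A :: "real^2^2" where "A ** C ** transpose A = mat 1" "A *v h = vector [sqrt (quad_stat C h), 0]"
proof -
  have symv: "v \<bullet> (C *v w) = w \<bullet> (C *v v)" for v w
    by (metis sym dot_lmul_matrix inner_commute vector_transpose_matrix)
  have inv: "invertible C"
    using pos by (rule posdef_invertible)
  \<comment> \<open>For \<open>h = 0\<close> every whitening will do, since both sides of the second
    claim vanish; any nonzero vector may then start the construction.\<close>
  define h' where "h' = (if h = 0 then axis 1 1 else h)"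
  have h': "h' \<noteq> 0"
    by (simp add: h'_def)
  define u where "u = matrix_inv C *v h'"
  have Cu: "C *v u = h'"
    by (simp add: u_def matrix_vector_mul_assoc matrix_inv_invertible[OF inv])
  with h' have "u \<noteq> 0" by auto
  then have u: "u \<bullet> (C *v u) > 0" by (rule pos)
  \<comment> \<open>Since \<open>C *v u = h'\<close>, Euclidean orthogonality of \<open>p\<close> to
    \<open>h'\<close> is orthogonality of \<open>p\<close> to \<open>u\<close> for the form of
    \<open>C\<close>.\<close>
  define p where "p = perp h'"
  have "p \<noteq> 0"
    using h' by (auto simp: p_def perp_def vec_eq_iff forall_2)
  then have p: "p \<bullet> (C *v p) > 0" by (rule pos)
  have ph: "p \<bullet> h' = 0"
    by (simp add: p_def perp_def vec2_inner)
  define w where "w i = (if i = 1 then u /\<^sub>R sqrt (u \<bullet> (C *v u)) else p /\<^sub>R sqrt (p \<bullet> (C *v p)))"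
    for i :: 2
  define A where "A = (\<chi> i. w i)"
  have q: "sqrt t * (sqrt t * inverse t) = 1" "inverse (sqrt t) * (inverse (sqrt t) * t) = 1" if "t > 0" for t :: real
    using that by (simp_all add: field_simps)
  have ww: "w i \<bullet> (C *v w j) = (if i = j then 1 else 0)" for i j
  proof -
    have "u \<bullet> (C *v p) = 0" "p \<bullet> (C *v u) = 0"
      using ph Cu symv[of u p] by (auto simp: inner_commute)
    then show ?thesis
      using exhaust_2[of i] exhaust_2[of j] u p
      by (auto simp: w_def matrix_vector_mult_scaleR q)
  qed
  have entry: "(A ** C ** transpose A) $ i $ j = w i \<bullet> (C *v w j)" for i j
    unfolding matrix_mul_assoc[symmetric]
    by (simp add: A_def matrix_matrix_mult_def transpose_def inner_vec_def matrix_vector_mult_def)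
  have 1: "A ** C ** transpose A = mat 1"
    by (simp add: vec_eq_iff entry ww mat_def)
  have Ah: "(A *v h) $ i = w i \<bullet> h" for i
    by (simp add: A_def matrix_vector_mult_def inner_vec_def)
  have "A *v h = vector [sqrt (quad_stat C h), 0]"
  proof (cases "h = 0")
    case True
    then show ?thesis
      by (simp add: quad_stat_def Ah vec_eq_iff[of _ "vector _"] forall_2)
  next
    case False
    then have hh: "h' = h" by (simp add: h'_def)
    have qs: "quad_stat C h = u \<bullet> (C *v u)"
      using Cu by (simp add: quad_stat_def hh u_def inner_commute)
    have "w 1 \<bullet> h = sqrt (quad_stat C h)"
      using Cu u real_div_sqrt[of "u \<bullet> h"] unfolding qs by (simp add: w_def hh field_simps)
    moreover have "w 2 \<bullet> h = 0"
      using ph by (simp add: w_def hh)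
    ultimately show ?thesis
      by (simp add: vec_eq_iff forall_2 Ah)
  qed
  then show thesis using 1 that by blast
qed

text \<open>Undoing the whitening: the inverse of \<open>A\<close> is also a factor of
  \<open>C\<close>, because symmetry of \<open>C\<close> turns \<open>transpose L\<close> into
  \<open>A ** C\<close>.\<close>

lemma whitening_factor:
  fixes A C :: "real^'n^'n"
  assumes "A ** C ** transpose A = mat 1" and sym: "transpose C = C"
  defines "L \<equiv> C ** transpose A"
  shows "A ** L = mat 1" "L ** A = mat 1" "C = L ** transpose L"
proof -
  show AL: "A ** L = mat 1"
    using assms(1) by (simp add: L_def matrix_mul_assoc)
  then show LA: "L ** A = mat 1"
    using matrix_left_right_inverse by blast
  have "L ** transpose L = L ** A ** C"
    by (simp add: L_def matrix_transpose_mul sym matrix_mul_assoc)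
  then show "C = L ** transpose L"
    by (simp add: LA)
qed

text \<open>Lebesgue measure is determined by its values on boxes. The preimage of a box under
  \<open>L\<close> is its image under the inverse \<open>A\<close>, of volume scaled by the absolute
  determinant of \<open>A\<close>, and the factor \<open>\<bar>det L\<bar>\<close> compensates for
  that.\<close>

lemma nn_integral_lborel_linear:
  fixes L :: "real^('n::{finite,wellorder})^('n::{finite,wellorder})"
  assumes [measurable]: "f \<in> borel_measurable borel" and L: "A ** L = mat 1"
  shows "(\<integral>\<^sup>+x. f x \<partial>lborel) = ennreal \<bar>det L\<bar> * (\<integral>\<^sup>+y. f (L *v y) \<partial>lborel)"
proof -
  have LA: "L ** A = mat 1"
    using L matrix_left_right_inverse by blast
  have linA: "linear ((*v) A)" and linL: "linear ((*v) L)"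
    using matrix_vector_mul_linear by blast+
  have [measurable]: "(*v) L \<in> borel_measurable borel"
    using linL by (intro borel_measurable_continuous_onI linear_continuous_on linear_conv_bounded_linear[THEN iffD1])
  have det: "det L * det A = 1"
    by (metis LA det_mul det_I)
  have "lborel = density (distr lborel borel ((*v) L)) (\<lambda>_. ennreal \<bar>det L\<bar>)"
  proof (rule lborel_eqI)
    fix l u :: "real^'n::{finite,wellorder}"
    assume lu: "\<And>b. b \<in> Basis \<Longrightarrow> l \<bullet> b \<le> u \<bullet> b"
    have vi: "(*v) L -` box l u = (*v) A ` box l u"
    proof (intro set_eqI iffI)
      fix x assume "x \<in> (*v) L -` box l u"
      then have "A *v (L *v x) \<in> (*v) A ` box l u" by blast
      then show "x \<in> (*v) A ` box l u"
        by (simp add: matrix_vector_mul_assoc L)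
    next
      fix y assume "y \<in> (*v) A ` box l u"
      then show "y \<in> (*v) L -` box l u"
        by (auto simp: matrix_vector_mul_assoc LA)
    qed
    have meas: "(*v) L -` box l u \<in> sets borel"
      using measurable_sets[of "(*v) L" borel borel "box l u"] by simp
    have fin: "(*v) A ` box l u \<in> lmeasurable"
      by (rule measurable_linear_image[OF linA]) simp
    \<comment> \<open>The set is Borel as a preimage, so its measure may be computed in the
      completion, where the determinant rule for linear images applies.\<close>
    have "emeasure lborel ((*v) L -` box l u) = emeasure lebesgue ((*v) A ` box l u)"
      using meas by (simp add: vi)
    also have "\<dots> = ennreal (\<bar>det A\<bar> * measure lebesgue (box l u))"
      using emeasure_eq_measure2[OF fin] measure_linear_image[OF linA, of "box l u"] by simp
    also have "measure lebesgue (box l u) = (\<Prod>b\<in>Basis. (u - l) \<bullet> b)"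
      using lu by (simp add: measure_lborel_box_eq)
    finally have e: "emeasure lborel ((*v) L -` box l u) = ennreal (\<bar>det A\<bar> * (\<Prod>b\<in>Basis. (u - l) \<bullet> b))" .
    have "emeasure (density (distr lborel borel ((*v) L)) (\<lambda>_. ennreal \<bar>det L\<bar>)) (box l u)
      = ennreal \<bar>det L\<bar> * emeasure lborel ((*v) L -` box l u)"
      by (simp add: emeasure_density nn_integral_cmult_indicator emeasure_distr)
    also have "\<dots> = ennreal (\<bar>det L\<bar> * (\<bar>det A\<bar> * (\<Prod>b\<in>Basis. (u - l) \<bullet> b)))"
      unfolding e by (simp add: ennreal_mult')
    also have "\<bar>det L\<bar> * (\<bar>det A\<bar> * (\<Prod>b\<in>Basis. (u - l) \<bullet> b)) = (\<Prod>b\<in>Basis. (u - l) \<bullet> b)"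
      using det by (simp add: mult.assoc[symmetric] abs_mult[symmetric])
    finally show "emeasure (density (distr lborel borel ((*v) L)) (\<lambda>_. ennreal \<bar>det L\<bar>)) (box l u)
      = (\<Prod>b\<in>Basis. (u - l) \<bullet> b)" .
  qed simp
  then have "(\<integral>\<^sup>+x. f x \<partial>lborel) = (\<integral>\<^sup>+x. f x \<partial>density (distr lborel borel ((*v) L)) (\<lambda>_. ennreal \<bar>det L\<bar>))"
    by simp
  also have "\<dots> = ennreal \<bar>det L\<bar> * (\<integral>\<^sup>+y. f (L *v y) \<partial>lborel)"
    by (simp add: nn_integral_density nn_integral_distr nn_integral_cmult)
  finally show ?thesis .
qed

lemma borel_measurable_matrix_vector_mult [measurable]:
  "(*v) (A::real^'n^'m) \<in> borel_measurable borel"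
  by (intro borel_measurable_continuous_onI linear_continuous_on linear_conv_bounded_linear[THEN iffD1]) simp

lemma borel_measurable_mvn_density [measurable]: "mvn_density \<mu> C \<in> borel_measurable borel"
  unfolding mvn_density_def by measurable

lemma sets_mvn [simp, measurable_cong]: "sets (mvn \<mu> C) = sets borel"
  by (simp add: mvn_def)

lemma space_mvn [simp]: "space (mvn \<mu> C) = UNIV"
  by (simp add: mvn_def)

text \<open>Reduces every normal law to the standard one. The Jacobian
  \<open>\<bar>det L\<bar>\<close> cancels the square root of \<open>det C\<close>, which equals the
  square of \<open>det L\<close>, and the inverse \<open>A\<close> of \<open>L\<close> whitens
  \<open>C\<close>, so the exponent becomes \<open>y \<bullet> y\<close>.\<close>

lemma mvn_affine:
  fixes A C L :: "real^('n::{finite,wellorder})^('n::{finite,wellorder})" and \<mu> :: "real^'n::{finite,wellorder}"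
  assumes AL: "A ** L = mat 1" and C: "C = L ** transpose L"
  shows "mvn \<mu> C = distr (mvn 0 (mat 1)) borel (\<lambda>y. \<mu> + L *v y)"
proof (rule measure_eqI)
  show "sets (mvn \<mu> C) = sets (distr (mvn 0 (mat 1)) borel (\<lambda>y. \<mu> + L *v y))" by simp
next
  fix S assume "S \<in> sets (mvn \<mu> C)"
  then have S [measurable]: "S \<in> sets borel" by simp
  have LA: "L ** A = mat 1"
    using AL matrix_left_right_inverse by blast
  have "A ** C ** transpose A = A ** L ** transpose (A ** L)"
    unfolding C by (simp add: matrix_transpose_mul matrix_mul_assoc)
  then have w: "A ** C ** transpose A = mat 1"
    by (simp add: AL)
  have "det L * det A = 1"
    by (metis LA det_mul det_I)
  then have detL: "\<bar>det L\<bar> > 0" by auto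
  have detC: "det C = (det L)\<^sup>2"
    by (simp add: C det_mul power2_eq_square)
  have w1: "mat 1 ** mat 1 ** transpose (mat 1) = (mat 1 :: real^('n::{finite,wellorder})^('n::{finite,wellorder}))"
    by simp
  have dens: "\<bar>det L\<bar> * mvn_density \<mu> C (\<mu> + L *v y) = mvn_density 0 (mat 1) y" for y
  proof -
    have "(L *v y) \<bullet> (matrix_inv C *v (L *v y)) = y \<bullet> y"
      using whitening_inverse(3)[OF w, of "L *v y"] AL
      by (simp add: quad_stat_def matrix_vector_mul_assoc)
    moreover have "y \<bullet> (matrix_inv (mat 1) *v y) = y \<bullet> y"
      using whitening_inverse(3)[OF w1, of y] by (simp add: quad_stat_def)
    moreover have "sqrt ((2 * pi) ^ CARD('n) * (det L)\<^sup>2) = sqrt ((2 * pi) ^ CARD('n)) * \<bar>det L\<bar>"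
      by (simp add: real_sqrt_mult)
    ultimately show ?thesis
      using detL by (simp add: mvn_density_def detC)
  qed
  have "emeasure (mvn \<mu> C) S = (\<integral>\<^sup>+x. ennreal (mvn_density \<mu> C x) * indicator S x \<partial>lborel)"
    by (simp add: mvn_def emeasure_density)
  also have "\<dots> = (\<integral>\<^sup>+x. ennreal (mvn_density \<mu> C (\<mu> + x)) * indicator S (\<mu> + x) \<partial>lborel)"
    by (subst lborel_distr_plus[of \<mu>, symmetric]) (simp add: nn_integral_distr)
  also have "\<dots> = \<bar>det L\<bar> * (\<integral>\<^sup>+y. ennreal (mvn_density \<mu> C (\<mu> + L *v y)) * indicator S (\<mu> + L *v y) \<partial>lborel)"
    by (subst nn_integral_lborel_linear[OF _ AL]) simp_all
  also have "\<dots> = (\<integral>\<^sup>+y. ennreal (mvn_density 0 (mat 1) y) * indicator S (\<mu> + L *v y) \<partial>lborel)"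
    by (subst nn_integral_cmult[symmetric])
      (auto simp: mult.assoc[symmetric] ennreal_mult'[symmetric] dens)
  also have "\<dots> = emeasure (distr (mvn 0 (mat 1)) borel (\<lambda>y. \<mu> + L *v y)) S"
    by (simp add: mvn_def emeasure_distr emeasure_density indicator_vimage[symmetric] vimage_def indicator_def)
  finally show "emeasure (mvn \<mu> C) S = emeasure (distr (mvn 0 (mat 1)) borel (\<lambda>y. \<mu> + L *v y)) S" .
qed

section \<open>The plane as a product of two lines\<close>

definition vec2 :: "real \<times> real \<Rightarrow> real^2" where
  "vec2 p = vector [fst p, snd p]"

lemma vec2_nth [simp]: "vec2 p $ 1 = fst p" "vec2 p $ 2 = snd p"
  by (simp_all add: vec2_def)

lemma borel_measurable_vec2 [measurable]: "vec2 \<in> borel_measurable borel"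
proof -
  have "vec2 p = fst p *\<^sub>R axis 1 1 + snd p *\<^sub>R axis 2 1" for p
    by (simp add: vec_eq_iff forall_2 axis_def)
  then have "continuous_on UNIV vec2"
    by (simp add: continuous_intros)
  then show ?thesis
    by (rule borel_measurable_continuous_onI)
qed

lemma borel_measurable_vec2_pair [measurable]: "vec2 \<in> borel \<Otimes>\<^sub>M borel \<rightarrow>\<^sub>M borel"
  unfolding borel_prod by measurable

lemma borel_measurable_vec_nth [measurable]: "(\<lambda>v::real^'n. v $ i) \<in> borel_measurable borel"
  by (intro borel_measurable_continuous_onI continuous_intros)

lemma Basis_vec2: "(Basis :: (real^2) set) = {axis 1 1, axis 2 1}"
  by (auto simp: Basis_vec_def UNIV_2)

lemma lborel_vec2: "lborel = distr (lborel :: (real \<times> real) measure) borel vec2"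
proof (rule lborel_eqI)
  fix l u :: "real^2"
  assume lu: "\<And>b. b \<in> Basis \<Longrightarrow> l \<bullet> b \<le> u \<bullet> b"
  have le: "l $ 1 \<le> u $ 1" "l $ 2 \<le> u $ 2"
    using lu[of "axis 1 1"] lu[of "axis 2 1"] by (simp_all add: Basis_vec2 inner_axis)
  have "vec2 -` box l u = {l $ 1<..<u $ 1} \<times> {l $ 2<..<u $ 2}"
    by (auto simp: mem_box Basis_vec2 inner_axis)
  then have "emeasure (distr (lborel :: (real \<times> real) measure) borel vec2) (box l u)
    = emeasure (lborel \<Otimes>\<^sub>M lborel) ({l $ 1<..<u $ 1} \<times> {l $ 2<..<u $ 2})"
    by (simp add: emeasure_distr lborel_prod)
  also have "\<dots> = ennreal (u $ 1 - l $ 1) * ennreal (u $ 2 - l $ 2)"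
    using le by (subst lborel.emeasure_pair_measure_Times) auto
  also have "\<dots> = (\<Prod>b\<in>Basis. (u - l) \<bullet> b)"
    using le by (simp add: Basis_vec2 axis_eq_axis inner_axis ennreal_mult'')
  finally show "emeasure (distr (lborel :: (real \<times> real) measure) borel vec2) (box l u)
    = (\<Prod>b\<in>Basis. (u - l) \<bullet> b)" .
qed simp

lemma mvn_density_mat_1:
  fixes \<mu> v :: "real^2"
  shows "mvn_density \<mu> (mat 1) v = normal_density (\<mu> $ 1) 1 (v $ 1) * normal_density (\<mu> $ 2) 1 (v $ 2)"
proof -
  have w: "mat 1 ** mat 1 ** transpose (mat 1) = (mat 1 :: real^2^2)"
    by simp
  have "(v - \<mu>) \<bullet> (matrix_inv (mat 1) *v (v - \<mu>)) = (v $ 1 - \<mu> $ 1)\<^sup>2 + (v $ 2 - \<mu> $ 2)\<^sup>2"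
    using whitening_inverse(3)[OF w, of "v - \<mu>"]
    by (simp add: quad_stat_def vec2_inner power2_eq_square)
  then have "mvn_density \<mu> (mat 1) v
    = exp (- ((v $ 1 - \<mu> $ 1)\<^sup>2 / 2) - (v $ 2 - \<mu> $ 2)\<^sup>2 / 2) / (2 * pi)"
    by (simp add: mvn_density_def diff_divide_distrib real_sqrt_mult)
  also have "\<dots> = normal_density (\<mu> $ 1) 1 (v $ 1) * normal_density (\<mu> $ 2) 1 (v $ 2)"
  proof -
    have e: "exp (- (p / 2) - q / 2) = exp (- (p / 2)) * exp (- (q / 2))" for p q :: real
      by (simp add: exp_add[symmetric])
    have s: "2 * pi = sqrt (2 * pi) * sqrt (2 * pi)"
      by simp
    show ?thesis
      unfolding e by (subst s) (simp add: normal_density_def del: real_sqrt_mult_self)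
  qed
  finally show ?thesis .
qed

lemma prob_space_normal: "prob_space (density lborel (normal_density m 1))"
  by (rule prob_space_normal_density) simp

lemma mvn_mat_1_eq_pair:
  fixes \<mu> :: "real^2"
  shows "mvn \<mu> (mat 1) = distr (density lborel (normal_density (\<mu> $ 1) 1) \<Otimes>\<^sub>M
    density lborel (normal_density (\<mu> $ 2) 1)) borel vec2"
proof -
  interpret N: prob_space "density lborel (normal_density (\<mu> $ 2) 1)"
    by (rule prob_space_normal)
  have "density lborel (normal_density (\<mu> $ 1) 1) \<Otimes>\<^sub>M density lborel (normal_density (\<mu> $ 2) 1)
     = density (lborel \<Otimes>\<^sub>M lborel)
        (\<lambda>(x, y). ennreal (normal_density (\<mu> $ 1) 1 x) * ennreal (normal_density (\<mu> $ 2) 1 y))"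
    by (rule pair_measure_density) (auto intro: sigma_finite_lborel N.sigma_finite_measure_axioms)
  also have "\<dots> = density lborel (\<lambda>p. ennreal (mvn_density \<mu> (mat 1) (vec2 p)))"
    unfolding lborel_prod
    by (rule arg_cong[where f="density _"]) (auto simp: mvn_density_mat_1 ennreal_mult)
  finally show ?thesis
    unfolding mvn_def by (subst lborel_vec2) (simp add: density_distr)
qed

lemma prob_space_mvn_mat_1: "prob_space (mvn (\<mu>::real^2) (mat 1))"
proof -
  interpret N1: prob_space "density lborel (normal_density (\<mu> $ 1) 1)"
    by (rule prob_space_normal)
  interpret N2: prob_space "density lborel (normal_density (\<mu> $ 2) 1)"
    by (rule prob_space_normal)
  interpret P: pair_prob_space "density lborel (normal_density (\<mu> $ 1) 1)" "density lborel (normal_density (\<mu> $ 2) 1)" ..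
  show ?thesis
    unfolding mvn_mat_1_eq_pair
    by (rule P.prob_space_distr) measurable
qed

text \<open>Identifies the product over \<open>{..<2}\<close> in \<open>noncentral_chi2\<close> with
  the binary product behind \<open>mvn_mat_1_eq_pair\<close>. The mean on the first axis is the one
  that \<open>whitening_exists\<close> arranges.\<close>

lemma noncentral_chi2_2:
  assumes "\<mu> \<ge> 0"
  shows "noncentral_chi2 2 \<mu> = distr (mvn (vector [sqrt \<mu>, 0]) (mat 1)) borel (\<lambda>v::real^2. v \<bullet> v)"
proof -
  define M where "M i = density lborel (normal_density (if i = 0 then sqrt \<mu> else 0) 1)" for i :: nat
  interpret M1: prob_space "M i" for i
    unfolding M_def by (rule prob_space_normal)
  interpret M: finite_product_prob_space M "{..<2}"
    by unfold_locales simp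
  interpret P: pair_prob_space "M 0" "M 1" ..
  have sM [measurable_cong, simp]: "sets (M i) = sets borel" for i
    by (simp add: M_def)
  have two: "{..<2} = {0, 1::nat}" by auto
  have pair: "M 0 \<Otimes>\<^sub>M M 1 = distr (Pi\<^sub>M {..<2} M) (borel \<Otimes>\<^sub>M borel) (\<lambda>x. (x 0, x 1))"
  proof (rule pair_measure_eqI)
    show "sigma_finite_measure (M 0)" "sigma_finite_measure (M 1)"
      by (simp_all add: M.sigma_finite_measures)
    show "sets (M 0 \<Otimes>\<^sub>M M 1) = sets (distr (Pi\<^sub>M {..<2} M) (borel \<Otimes>\<^sub>M borel) (\<lambda>x. (x 0, x 1)))"
      by (simp cong: sets_pair_measure_cong)
    fix A B assume "A \<in> sets (M 0)" "B \<in> sets (M 1)"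
    then have [measurable]: "A \<in> sets borel" "B \<in> sets borel" by simp_all
    have [measurable]: "(\<lambda>x. x 0) \<in> Pi\<^sub>M {..<2} M \<rightarrow>\<^sub>M borel" "(\<lambda>x. x 1) \<in> Pi\<^sub>M {..<2} M \<rightarrow>\<^sub>M borel"
      using measurable_component_singleton[of 0 "{..<2::nat}" M]
        measurable_component_singleton[of 1 "{..<2::nat}" M]
      by (simp_all cong: measurable_cong_sets)
    have m: "(\<lambda>x. (x 0, x 1)) \<in> Pi\<^sub>M {..<2} M \<rightarrow>\<^sub>M borel \<Otimes>\<^sub>M borel"
      by measurable
    have AB: "A \<times> B \<in> sets (borel \<Otimes>\<^sub>M borel)"
      by simp
    have "(\<lambda>x. (x 0, x 1)) -` (A \<times> B) \<inter> space (Pi\<^sub>M {..<2} M) = (\<Pi>\<^sub>E i\<in>{..<2}. if i = 0 then A else B)"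
      by (auto simp: space_PiM M_def PiE_def Pi_def two)
    then have "emeasure (distr (Pi\<^sub>M {..<2} M) (borel \<Otimes>\<^sub>M borel) (\<lambda>x. (x 0, x 1))) (A \<times> B)
      = emeasure (Pi\<^sub>M {..<2} M) (\<Pi>\<^sub>E i\<in>{..<2}. if i = 0 then A else B)"
      by (simp only: emeasure_distr[OF m AB])
    also have "\<dots> = (\<Prod>i\<in>{..<2}. emeasure (M i) (if i = 0 then A else B))"
      by (rule M.emeasure_PiM) auto
    also have "\<dots> = emeasure (M 0) A * emeasure (M 1) B"
      by (simp add: two)
    finally show "emeasure (M 0) A * emeasure (M 1) B
      = emeasure (distr (Pi\<^sub>M {..<2} M) (borel \<Otimes>\<^sub>M borel) (\<lambda>x. (x 0, x 1))) (A \<times> B)" ..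
  qed
  have [measurable]: "(\<lambda>x. x 0) \<in> Pi\<^sub>M {..<2} M \<rightarrow>\<^sub>M borel" "(\<lambda>x. x 1) \<in> Pi\<^sub>M {..<2} M \<rightarrow>\<^sub>M borel"
    using measurable_component_singleton[of 0 "{..<2::nat}" M]
      measurable_component_singleton[of 1 "{..<2::nat}" M]
    by (simp_all cong: measurable_cong_sets)
  have "mvn (vector [sqrt \<mu>, 0]) (mat 1) = distr (M 0 \<Otimes>\<^sub>M M 1) borel vec2"
    by (simp add: mvn_mat_1_eq_pair M_def)
  also have "distr \<dots> borel (\<lambda>v::real^2. v \<bullet> v) = distr (Pi\<^sub>M {..<2} M) borel (\<lambda>x. (x 0)\<^sup>2 + (x 1)\<^sup>2)"
    unfolding pair
    by (subst distr_distr, measurable, subst distr_distr, measurable)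
      (simp add: comp_def vec2_inner power2_eq_square)
  also have "\<dots> = noncentral_chi2 2 \<mu>"
    unfolding noncentral_chi2_def M_def by (simp add: two)
  finally show ?thesis ..
qed

text \<open>A layer-cake argument in place of polar coordinates. The density depends on
  \<open>v \<bullet> v\<close> only, so it is the integral of exp (- u / 2) / (4 pi) over u above
  \<open>v \<bullet> v\<close>. After exchanging the integrals, the inner one is the area pi (u - t)
  of an annulus, and a one-dimensional integral remains.\<close>

lemma measure_std_mvn_tail:
  assumes t: "t \<ge> 0"
  shows "measure (mvn (0::real^2) (mat 1)) {v. v \<bullet> v > t} = exp (- t / 2)"
proof -
  have dens: "ennreal (mvn_density (0::real^2) (mat 1) v)
    = (\<integral>\<^sup>+u. (if v \<bullet> v \<le> u then ennreal (exp (- u / 2) / (4 * pi)) else 0) \<partial>lborel)" for v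
  proof -
    have lim: "((\<lambda>u. - exp (- u / 2) / (2 * pi)) \<longlongrightarrow> 0) at_top"
      by real_asymp
    have "(\<integral>\<^sup>+u. ennreal (exp (- u / 2) / (4 * pi)) * indicator {v \<bullet> v..} u \<partial>lborel)
      = ennreal (0 - (- exp (- (v \<bullet> v) / 2) / (2 * pi)))"
      by (rule nn_integral_FTC_atLeast[OF _ _ _ lim])
        (auto intro!: derivative_eq_intros simp: field_simps)
    also have "0 - (- exp (- (v \<bullet> v) / 2) / (2 * pi)) = mvn_density (0::real^2) (mat 1) v"
      by (simp add: mvn_density_mat_1 normal_density_def vec2_inner power2_eq_square
          exp_add[symmetric] add_divide_distrib[symmetric] diff_divide_distrib)
    finally show ?thesis
      by (simp add: indicator_def of_bool_def if_distrib[of "(*) _"] cong: if_cong)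
  qed
  have area: "emeasure lborel {v::real^2. t < v \<bullet> v \<and> v \<bullet> v \<le> u} = ennreal (pi * (u - t))" if "u \<ge> t" for u
  proof -
    have "v \<in> cball 0 (sqrt r) \<longleftrightarrow> v \<bullet> v \<le> r" for v :: "real^2" and r
      by (simp add: norm_eq_sqrt_inner)
    then have "{v::real^2. t < v \<bullet> v \<and> v \<bullet> v \<le> u} = cball 0 (sqrt u) - cball 0 (sqrt t)"
      by (auto simp del: mem_cball)
    moreover have "emeasure lborel (cball (0::real^2) (sqrt u) - cball 0 (sqrt t))
      = emeasure lborel (cball (0::real^2) (sqrt u)) - emeasure lborel (cball (0::real^2) (sqrt t))"
      using that by (intro emeasure_Diff) (auto simp: subset_cball emeasure_cball t)
    ultimately show ?thesis
      using that t by (simp add: emeasure_cball unit_ball_vol_2 ennreal_minus right_diff_distrib)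
  qed
  have "emeasure (mvn (0::real^2) (mat 1)) {v. v \<bullet> v > t}
    = (\<integral>\<^sup>+v. (\<integral>\<^sup>+u. (if v \<bullet> v \<le> u then ennreal (exp (- u / 2) / (4 * pi)) else 0) \<partial>lborel) *
        indicator {v. v \<bullet> v > t} (v::real^2) \<partial>lborel)"
    unfolding mvn_def by (subst emeasure_density) (simp_all add: dens)
  also have "\<dots> = (\<integral>\<^sup>+(v::real^2). (\<integral>\<^sup>+u. ennreal (exp (- u / 2) / (4 * pi)) *
        indicator {v. t < v \<bullet> v \<and> v \<bullet> v \<le> u} v \<partial>lborel) \<partial>lborel)"
    by (intro nn_integral_cong, subst nn_integral_multc[symmetric], measurable)
      (auto intro!: nn_integral_cong split: split_indicator)
  also have "\<dots> = (\<integral>\<^sup>+u. (\<integral>\<^sup>+(v::real^2). ennreal (exp (- u / 2) / (4 * pi)) *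
        indicator {v. t < v \<bullet> v \<and> v \<bullet> v \<le> u} v \<partial>lborel) \<partial>lborel)"
    by (rule lborel_pair.Fubini') (unfold split_beta indicator_def, measurable)
  also have "\<dots> = (\<integral>\<^sup>+u. ennreal (exp (- u / 2) / (4 * pi)) *
      emeasure lborel {v::real^2. t < v \<bullet> v \<and> v \<bullet> v \<le> u} \<partial>lborel)"
    by (intro nn_integral_cong) (simp add: nn_integral_cmult_indicator)
  also have "\<dots> = (\<integral>\<^sup>+u. ennreal ((u - t) * exp (- u / 2) / 4) * indicator {t..} u \<partial>lborel)"
  proof (intro nn_integral_cong)
    fix u
    show "ennreal (exp (- u / 2) / (4 * pi)) * emeasure lborel {v::real^2. t < v \<bullet> v \<and> v \<bullet> v \<le> u}
      = ennreal ((u - t) * exp (- u / 2) / 4) * indicator {t..} u"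
    proof (cases "u \<ge> t")
      case True
      then show ?thesis
        by (simp add: area ennreal_mult''[symmetric] field_simps)
    next
      case False
      then have *: "{v::real^2. t < v \<bullet> v \<and> v \<bullet> v \<le> u} = {}" by auto
      show ?thesis using False unfolding * by simp
    qed
  qed
  \<comment> \<open>An antiderivative of (u - t) exp (- u / 2) / 4 is - (u - t + 2) exp (- u / 2) /
    2; the right-hand side is its limit 0 minus its value at u = t, left in the form that the
    fundamental theorem produces.\<close>
  also have "\<dots> = ennreal (0 - (- (t - t + 2) * exp (- t / 2) / 2))"
  proof -
    have lim: "((\<lambda>u. - (u - t + 2) * exp (- u / 2) / 2) \<longlongrightarrow> 0) at_top"
      by real_asymp
    show ?thesis
      by (rule nn_integral_FTC_atLeast[OF _ _ _ lim])
        (auto intro!: derivative_eq_intros simp: field_simps)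
  qed
  finally show ?thesis
    by (simp add: measure_def)
qed

section \<open>Characteristic functions determine the law\<close>

text \<open>The density \<open>w x / m\<close> defines a new probability measure under which
  \<open>Y\<close> has the characteristic function of \<nu>. Levy's theorem identifies the law of
  \<open>Y\<close> there, and expectations are then translated back.\<close>

lemma (in prob_space) weighted_law_eq:
  fixes Y w :: "'a \<Rightarrow> real"
  assumes [measurable]: "Y \<in> borel_measurable M" "w \<in> borel_measurable M"
    and w: "\<And>x. 0 \<le> w x" "\<And>x. w x \<le> K" and m: "m > 0" and \<nu>: "real_distribution \<nu>"
    and eq: "\<And>t. (CLINT x|M. of_real (w x) * iexp (t * Y x)) = of_real m * char \<nu> t"
    and [measurable]: "B \<in> sets borel"
  shows "expectation (\<lambda>x. w x * indicator B (Y x)) = m * measure \<nu> B"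
proof -
  interpret \<nu>: real_distribution \<nu> by fact
  define M' where "M' = density M (\<lambda>x. ennreal (w x / m))"
  have wm: "w x / m \<ge> 0" for x
    using w m by simp
  have int: "integrable M w"
    using w by (intro integrable_const_bound[of _ K]) auto
  \<comment> \<open>At t = 0 the hypothesis says that \<open>w\<close> has expectation
    \<open>m\<close>, which is the normalization of the new measure.\<close>
  have "of_real (expectation w) = (of_real m :: complex)"
    using eq[of 0] by (simp add: \<nu>.char_zero)
  then have Ew: "expectation w = m"
    by (simp only: of_real_eq_iff)
  have "emeasure M' (space M') = ennreal (expectation (\<lambda>x. w x / m))"
    unfolding M'_def using int wm
    by (simp add: emeasure_density nn_integral_eq_integral cong: nn_integral_cong)
  also have "\<dots> = 1"
    using Ew m by simp
  finally interpret M': prob_space M'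
    by (rule prob_spaceI)
  have Y' [measurable]: "Y \<in> borel_measurable M'"
    by (simp add: M'_def)
  have "char (distr M' borel Y) = char \<nu>"
  proof
    fix t
    have "char (distr M' borel Y) t = (CLINT x|M'. iexp (t * Y x))"
      by (simp add: char_def integral_distr)
    also have "\<dots> = (CLINT x|M. (w x / m) *\<^sub>R iexp (t * Y x))"
      unfolding M'_def by (rule integral_density) (use wm in simp_all)
    also have "\<dots> = (CLINT x|M. of_real (w x) * iexp (t * Y x) / of_real m)"
      by (simp add: scaleR_conv_of_real)
    also have "\<dots> = char \<nu> t"
      using m eq[of t] by simp
    finally show "char (distr M' borel Y) t = char \<nu> t" .
  qed
  then have "distr M' borel Y = \<nu>"
    by (rule Levy_uniqueness[OF M'.real_distribution_distr[OF Y'] \<nu>])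
  then have "measure \<nu> B = measure (distr M' borel Y) B" by simp
  also have "\<dots> = (\<integral>y. indicator B y \<partial>distr M' borel Y)"
    by simp
  also have "\<dots> = (\<integral>x. indicator B (Y x) \<partial>M')"
    by (rule integral_distr) simp_all
  also have "\<dots> = (\<integral>x. (w x / m) *\<^sub>R indicator B (Y x) \<partial>M)"
    unfolding M'_def by (rule integral_density) (use wm in simp_all)
  also have "\<dots> = expectation (\<lambda>x. w x * indicator B (Y x)) / m"
    by simp
  finally show ?thesis
    using m by (simp add: field_simps)
qed

text \<open>Kac's theorem.  Levy's uniqueness theorem in one dimension is applied first to the law of \<open>Y\<close>
  weighted with the positive function \<open>2 + Re (z * iexp (s * X))\<close>, and then to the law of \<open>X\<close>
  weighted with \<open>indicator B Y\<close>.\<close>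

lemma (in prob_space) joint_law_eq_pair_measure:
  fixes X Y :: "'a \<Rightarrow> real"
  assumes [measurable]: "X \<in> borel_measurable M" "Y \<in> borel_measurable M"
    and \<nu>1: "real_distribution \<nu>1" and \<nu>2: "real_distribution \<nu>2"
    and eq: "\<And>s t. (CLINT x|M. iexp (s * X x + t * Y x)) = char \<nu>1 s * char \<nu>2 t"
  shows "distr M (borel \<Otimes>\<^sub>M borel) (\<lambda>x. (X x, Y x)) = \<nu>1 \<Otimes>\<^sub>M \<nu>2"
proof -
  interpret \<nu>1: real_distribution \<nu>1 by fact
  interpret \<nu>2: real_distribution \<nu>2 by fact
  have int: "integrable M (\<lambda>x. iexp (s * X x + t * Y x))" for s t
    by (rule integrable_const_bound[of _ 1]) auto
  have cX: "(CLINT x|M. iexp (s * X x)) = char \<nu>1 s" for s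
    using eq[of s 0] by (simp add: \<nu>2.char_zero)
  \<comment> \<open>The real part in the weight below expands into an exponential and its conjugate;
    as \<open>X\<close> is real, the conjugate corresponds to - s.\<close>
  have cnj: "cnj (char \<nu>1 s) = char \<nu>1 (- s)" for s
    unfolding cX[symmetric] by (subst Bochner_Integration.integral_cnj[symmetric]) (simp add: exp_cnj)
  have step1: "expectation (\<lambda>x. Re (z * iexp (s * X x)) * indicator B (Y x))
      = Re (z * char \<nu>1 s) * measure \<nu>2 B"
    if z: "norm z = 1" and [measurable]: "B \<in> sets borel" for z s B
  proof -
    \<comment> \<open>The oscillating part lies between -1 and 1, so the shift by 2 makes the weight
      nonnegative and its mean positive. The contribution of the shift is subtracted at the end by
      means of the weight 1.\<close>
    define w where "w x = 2 + Re (z * iexp (s * X x))" for x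
    have [measurable]: "w \<in> borel_measurable M"
      unfolding w_def by measurable
    have b: "\<bar>Re (z * iexp (s * X x))\<bar> \<le> 1" for x
      using abs_Re_le_cmod[of "z * iexp (s * X x)"] z by (simp add: norm_mult)
    have w: "0 \<le> w x" "w x \<le> 3" for x
      using b[of x] by (auto simp: w_def)
    have c: "norm (char \<nu>1 s) \<le> 1"
      by (rule \<nu>1.cmod_char_le_1)
    have m: "2 + Re (z * char \<nu>1 s) > 0"
      using abs_Re_le_cmod[of "z * char \<nu>1 s"] z c by (simp add: norm_mult)
    have re: "of_real (Re u) = (u + cnj u) / 2" for u
      by (simp add: complex_eq_iff)
    have E: "(CLINT x|M. of_real (w x) * iexp (t * Y x)) = of_real (2 + Re (z * char \<nu>1 s)) * char \<nu>2 t" for t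
    proof -
      have "of_real (w x) * iexp (t * Y x) = 2 * iexp (0 * X x + t * Y x)
        + (z / 2) * iexp (s * X x + t * Y x) + (cnj z / 2) * iexp (- s * X x + t * Y x)" for x
        unfolding w_def of_real_add re
        by (simp add: exp_cnj exp_add[symmetric] algebra_simps add_divide_distrib)
      then have "(CLINT x|M. of_real (w x) * iexp (t * Y x)) = 2 * (char \<nu>1 0 * char \<nu>2 t)
        + (z / 2) * (char \<nu>1 s * char \<nu>2 t) + (cnj z / 2) * (char \<nu>1 (- s) * char \<nu>2 t)"
        unfolding eq[symmetric] using int by (simp only: Bochner_Integration.integral_add
          integral_mult_right_zero Bochner_Integration.integrable_add integrable_mult_right)
      also have "\<dots> = of_real (2 + Re (z * char \<nu>1 s)) * char \<nu>2 t"
        unfolding of_real_add re by (simp add: \<nu>1.char_zero cnj[symmetric] field_simps)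
      finally show ?thesis .
    qed
    have int_ind: "integrable M (\<lambda>x. indicator B (Y x) :: real)"
      by (rule integrable_const_bound[of _ 1]) (auto split: split_indicator)
    have int_re: "integrable M (\<lambda>x. Re (z * iexp (s * X x)) * indicator B (Y x))"
      using b by (intro integrable_const_bound[of _ 1]) (auto split: split_indicator)
    have 1: "expectation (\<lambda>x. w x * indicator B (Y x)) = (2 + Re (z * char \<nu>1 s)) * measure \<nu>2 B"
      by (rule weighted_law_eq[OF _ _ w m \<nu>2 E]) simp_all
    have 2: "expectation (\<lambda>x. 1 * indicator B (Y x)) = 1 * measure \<nu>2 B"
      by (rule weighted_law_eq[OF _ _ _ _ _ \<nu>2, of _ _ 1])
        (use eq[of 0] in \<open>simp_all add: \<nu>1.char_zero\<close>)
    have "expectation (\<lambda>x. w x * indicator B (Y x)) =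
      expectation (\<lambda>x. 2 * indicator B (Y x) + Re (z * iexp (s * X x)) * indicator B (Y x))"
      by (simp only: w_def distrib_right)
    also have "\<dots> = 2 * measure \<nu>2 B + expectation (\<lambda>x. Re (z * iexp (s * X x)) * indicator B (Y x))"
      using int_ind int_re 2 by simp
    finally show ?thesis
      using 1 by (simp add: distrib_right)
  qed
  \<comment> \<open>The real part of - \<i> u is the imaginary part of u, so \<open>step1\<close>
    with z = 1 and z = - \<i> recovers the complex integral.\<close>
  have step2: "(CLINT x|M. of_real (indicator B (Y x)) * iexp (s * X x)) = of_real (measure \<nu>2 B) * char \<nu>1 s"
    if [measurable]: "B \<in> sets borel" for s B
  proof -
    let ?f = "\<lambda>x. of_real (indicator B (Y x)) * iexp (s * X x)"
    have i: "integrable M ?f"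
      by (rule integrable_const_bound[of _ 1]) (auto simp: norm_mult split: split_indicator)
    have "Re (\<integral>x. ?f x \<partial>M) = (\<integral>x. Re (?f x) \<partial>M)"
      by (rule integral_Re[OF i, symmetric])
    also have "\<dots> = measure \<nu>2 B * Re (char \<nu>1 s)"
      using step1[of 1 B s] by (simp add: mult.commute)
    finally have 1: "Re (\<integral>x. ?f x \<partial>M) = Re (of_real (measure \<nu>2 B) * char \<nu>1 s)" by simp
    have "Im (\<integral>x. ?f x \<partial>M) = (\<integral>x. Im (?f x) \<partial>M)"
      by (rule integral_Im[OF i, symmetric])
    also have "\<dots> = measure \<nu>2 B * Im (char \<nu>1 s)"
      using step1[of "- \<i>" B s] by (simp add: mult.commute)
    finally have 2: "Im (\<integral>x. ?f x \<partial>M) = Im (of_real (measure \<nu>2 B) * char \<nu>1 s)" by simp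
    from 1 2 show ?thesis
      by (simp only: complex_eq_iff)
  qed
  have step3: "expectation (\<lambda>x. indicator B (Y x) * indicator A (X x)) = measure \<nu>2 B * measure \<nu>1 A"
    if [measurable]: "A \<in> sets borel" "B \<in> sets borel" for A B
  proof (cases "measure \<nu>2 B > 0")
    case True
    show ?thesis
      by (rule weighted_law_eq[where K=1, OF _ _ _ _ True \<nu>1 step2]) (auto split: split_indicator)
  next
    \<comment> \<open>A weight of mass zero cannot be normalized. Here \<open>Y\<close> avoids
      \<open>B\<close> almost surely, and both sides vanish.\<close>
    case False
    then have z: "measure \<nu>2 B = 0"
      by (simp add: zero_less_measure_iff)
    have ind: "integrable M (\<lambda>x. indicator B (Y x) :: real)"
      by (rule integrable_const_bound[of _ 1]) (auto split: split_indicator)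
    have "expectation (\<lambda>x. indicator B (Y x)) = (0::real)"
      using step1[of 1 B 0] z by simp
    then have "AE x in M. indicator B (Y x) = (0::real)"
      using integral_nonneg_eq_0_iff_AE[OF ind] by simp
    then have "expectation (\<lambda>x. indicator B (Y x) * indicator A (X x)) = expectation (\<lambda>x. 0::real)"
      by (intro integral_cong_AE) auto
    then show ?thesis by (simp add: z)
  qed
  show ?thesis
  proof (rule pair_measure_eqI[symmetric])
    show "sigma_finite_measure \<nu>1" "sigma_finite_measure \<nu>2" ..
    show "sets (\<nu>1 \<Otimes>\<^sub>M \<nu>2) = sets (distr M (borel \<Otimes>\<^sub>M borel) (\<lambda>x. (X x, Y x)))"
      by (simp cong: sets_pair_measure_cong)
    fix A B assume "A \<in> sets \<nu>1" "B \<in> sets \<nu>2"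
    then have AB [measurable]: "A \<in> sets borel" "B \<in> sets borel" by simp_all
    interpret D: prob_space "distr M (borel \<Otimes>\<^sub>M borel) (\<lambda>x. (X x, Y x))"
      by (rule prob_space_distr) measurable
    have "measure (distr M (borel \<Otimes>\<^sub>M borel) (\<lambda>x. (X x, Y x))) (A \<times> B)
      = (\<integral>p. indicator (A \<times> B) p \<partial>distr M (borel \<Otimes>\<^sub>M borel) (\<lambda>x. (X x, Y x)))"
      by simp
    also have "\<dots> = (\<integral>x. indicator (A \<times> B) (X x, Y x) \<partial>M)"
      by (rule integral_distr) measurable
    also have "\<dots> = expectation (\<lambda>x. indicator B (Y x) * indicator A (X x))"
      by (rule Bochner_Integration.integral_cong) (auto split: split_indicator)
    finally have "measure (distr M (borel \<Otimes>\<^sub>M borel) (\<lambda>x. (X x, Y x))) (A \<times> B) = measure \<nu>1 A * measure \<nu>2 B"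
      using step3[OF AB] by (simp add: mult.commute)
    then show "emeasure \<nu>1 A * emeasure \<nu>2 B = emeasure (distr M (borel \<Otimes>\<^sub>M borel) (\<lambda>x. (X x, Y x))) (A \<times> B)"
      by (simp only: D.emeasure_eq_measure \<nu>1.emeasure_eq_measure \<nu>2.emeasure_eq_measure ennreal_mult measure_nonneg)
  qed
qed

lemma (in prob_space) law_eq_std_mvn:
  fixes Y :: "'a \<Rightarrow> real^2"
  assumes [measurable]: "Y \<in> borel_measurable M"
    and eq: "\<And>v. (CLINT x|M. iexp (v \<bullet> Y x)) = of_real (exp (- (v \<bullet> v) / 2))"
  shows "distr M borel Y = mvn 0 (mat 1)"
proof -
  have "distr M (borel \<Otimes>\<^sub>M borel) (\<lambda>x. (Y x $ 1, Y x $ 2)) = std_normal_distribution \<Otimes>\<^sub>M std_normal_distribution"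
  proof (rule joint_law_eq_pair_measure)
    fix s t
    show "(CLINT x|M. iexp (s * Y x $ 1 + t * Y x $ 2)) = char std_normal_distribution s * char std_normal_distribution t"
      using eq[of "vec2 (s, t)"]
      by (simp add: vec2_inner char_std_normal_distribution of_real_mult[symmetric] exp_add[symmetric]
          power2_eq_square diff_divide_distrib del: of_real_mult)
  qed (auto intro: real_dist_normal_dist)
  then have "distr (distr M (borel \<Otimes>\<^sub>M borel) (\<lambda>x. (Y x $ 1, Y x $ 2))) borel vec2 = mvn 0 (mat 1)"
    by (simp add: mvn_mat_1_eq_pair)
  moreover have "vec2 \<circ> (\<lambda>x. (Y x $ 1, Y x $ 2)) = Y"
    by (simp add: fun_eq_iff vec_eq_iff forall_2)
  ultimately show ?thesis
    by (simp add: distr_distr)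
qed

text \<open>Whitening makes the characteristic function split into a factor for each coordinate, the
  form in which the joint law can be recognized as a product. On the dual side it replaces
  \<open>v\<close> by \<open>transpose A *v v\<close>; the law of \<open>F\<close> is recovered by
  the inverse affine map.\<close>

lemma (in prob_space) law_eq_mvn:
  fixes F :: "'a \<Rightarrow> real^2" and C :: "real^2^2"
  assumes [measurable]: "F \<in> borel_measurable M"
    and sym: "transpose C = C" and pos: "\<And>v. v \<noteq> 0 \<Longrightarrow> v \<bullet> (C *v v) > 0"
    and eq: "\<And>v. (CLINT x|M. iexp (v \<bullet> (F x - h))) = of_real (exp (- (v \<bullet> (C *v v)) / 2))"
  shows "distr M borel F = mvn h C"
proof -
  obtain A :: "real^2^2" where A: "A ** C ** transpose A = mat 1"
    using whitening_exists[OF sym pos, of 0] by metis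
  define L where "L = C ** transpose A"
  note L = whitening_factor[OF A sym, folded L_def]
  define Y where "Y x = A *v (F x - h)" for x
  have [measurable]: "Y \<in> borel_measurable M"
    unfolding Y_def by measurable
  have "distr M borel Y = mvn 0 (mat 1)"
  proof (rule law_eq_std_mvn)
    fix v :: "real^2"
    have e: "(transpose A *v v) \<bullet> w = v \<bullet> (A *v w)" for w
      by (simp add: transpose_matrix_vector dot_lmul_matrix)
    have "(transpose A *v v) \<bullet> (C *v (transpose A *v v)) = v \<bullet> v"
      by (simp only: e matrix_vector_mul_assoc matrix_mul_assoc A matrix_vector_mul_lid)
    moreover have "v \<bullet> Y x = (transpose A *v v) \<bullet> (F x - h)" for x
      by (simp only: Y_def e)
    ultimately show "(CLINT x|M. iexp (v \<bullet> Y x)) = of_real (exp (- (v \<bullet> v) / 2))"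
      using eq[of "transpose A *v v"] by simp
  qed simp
  then have "mvn h C = distr (distr M borel Y) borel (\<lambda>y. h + L *v y)"
    using mvn_affine[OF L(1,3)] by simp
  also have "\<dots> = distr M borel (\<lambda>x. h + L *v Y x)"
    by (simp add: distr_distr comp_def)
  also have "(\<lambda>x. h + L *v Y x) = F"
    by (simp add: Y_def matrix_vector_mul_assoc L(2) fun_eq_iff)
  finally show ?thesis ..
qed

lemma measure_mvn_quad_stat:
  fixes h :: "real^2" and A C :: "real^2^2"
  assumes A: "A ** C ** transpose A = mat 1" and sym: "transpose C = C"
  shows "measure (mvn h C) {v. quad_stat C v > t} = measure (mvn (A *v h) (mat 1)) {v. v \<bullet> v > t}"
proof -
  define L where "L = C ** transpose A"
  note L = whitening_factor[OF A sym, folded L_def]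
  have [measurable]: "quad_stat C \<in> borel_measurable borel"
    unfolding quad_stat_def by measurable
  have "measure (mvn h C) {v. quad_stat C v > t} = measure (mvn 0 (mat 1)) {y. quad_stat C (h + L *v y) > t}"
    unfolding mvn_affine[OF L(1,3)] by (subst measure_distr) (simp_all add: vimage_def)
  also have "\<dots> = measure (mvn 0 (mat 1)) {y. (A *v h + y) \<bullet> (A *v h + y) > t}"
    by (simp add: whitening_inverse(3)[OF A] matrix_vector_right_distrib matrix_vector_mul_assoc L(1))
  also have "\<dots> = measure (mvn (A *v h) (mat 1)) {v. v \<bullet> v > t}"
    \<comment> \<open>With unit factors \<open>mvn_affine\<close> is the translation by
      \<open>A *v h\<close>.\<close>
    by (subst (2) mvn_affine[of "mat 1" "mat 1"]) (simp_all, subst measure_distr, simp_all add: vimage_def)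
  finally show ?thesis .
qed

section \<open>The likelihood ratio\<close>

text \<open>The likelihood of the single observation \<open>v\<close> is largest at the mean
  \<open>v\<close>, where the exponent is zero. \<open>GREATEST\<close> needs a maximum that is
  attained, and this mean is the witness; the normalizing constant \<open>Z\<close> cancels in the
  ratio.\<close>

lemma log_likelihood_ratio_eq:
  fixes A C :: "real^'n^'n"
  assumes A: "A ** C ** transpose A = mat 1"
  shows "log_likelihood_ratio C v = quad_stat C v / 2"
proof -
  define Z where "Z = sqrt ((2 * pi) ^ CARD('n) * det C)"
  have "det A * det C * det A = 1"
    by (metis A det_I det_mul det_transpose)
  then have "(det A)\<^sup>2 * det C = 1"
    by (simp add: power2_eq_square mult_ac)
  then have "det C > 0"
    by (metis zero_less_mult_pos zero_le_power2 zero_less_one order_le_less mult_zero_left zero_neq_one)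
  then have Z: "Z > 0"
    by (simp add: Z_def)
  have dens: "mvn_density \<mu> C v = exp (- quad_stat C (v - \<mu>) / 2) / Z" for \<mu>
    by (simp add: mvn_density_def quad_stat_def Z_def)
  have "(GREATEST q. \<exists>\<mu>. q = mvn_density \<mu> C v) = 1 / Z"
  proof (rule Greatest_equality)
    show "\<exists>\<mu>. 1 / Z = mvn_density \<mu> C v"
      by (rule exI[of _ v]) (simp add: dens quad_stat_def)
  next
    fix q assume "\<exists>\<mu>. q = mvn_density \<mu> C v"
    then obtain \<mu> where "q = mvn_density \<mu> C v" by blast
    then show "q \<le> 1 / Z"
      using Z by (simp add: dens divide_right_mono whitening_inverse(3)[OF A])
  qed
  then show ?thesis
    using Z by (simp add: log_likelihood_ratio_def dens ln_div ln_inverse exp_minus field_simps flip: exp_minus)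
qed

text \<open>Negative \<open>t\<close> matters because \<open>lrt_rejection_region\<close> quantifies
  over all real thresholds; the region is then the whole plane, \<open>quad_stat\<close> being
  nonnegative.\<close>

lemma measure_mvn_0_quad_stat:
  fixes A C :: "real^2^2"
  assumes A: "A ** C ** transpose A = mat 1" and sym: "transpose C = C"
  shows "measure (mvn 0 C) {v. quad_stat C v > t} = (if t \<ge> 0 then exp (- t / 2) else 1)"
proof (cases "t \<ge> 0")
  case True
  then show ?thesis
    using measure_mvn_quad_stat[OF A sym, of 0 t] by (simp add: measure_std_mvn_tail)
next
  case False
  interpret P: prob_space "mvn (0::real^2) (mat 1)"
    by (rule prob_space_mvn_mat_1)
  from False have "{v :: real^2. v \<bullet> v > t} = UNIV"
    using inner_ge_zero by (auto intro: less_le_trans simp: not_le)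
  then show ?thesis
    using measure_mvn_quad_stat[OF A sym, of 0 t] False P.prob_space by simp
qed

text \<open>The size fixes the threshold. A threshold t on the log likelihood ratio is 2 t on
  \<open>quad_stat\<close>; its size is exp (- t) for t \<ge> 0, which is injective, and 1 for t <
  0, which \<open>\<alpha> < 1\<close> excludes.\<close>

lemma lrt_rejection_region_iff:
  fixes A C :: "real^2^2"
  assumes A: "A ** C ** transpose A = mat 1" and sym: "transpose C = C" and \<alpha>: "0 < \<alpha>" "\<alpha> < 1"
  shows "lrt_rejection_region C \<alpha> R \<longleftrightarrow> R = {v. quad_stat C v > - 2 * ln \<alpha>}"
proof -
  have set: "{v. log_likelihood_ratio C v > t} = {v. quad_stat C v > 2 * t}" for t
    by (auto simp: log_likelihood_ratio_eq[OF A])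
  have "measure (mvn 0 C) {v. quad_stat C v > 2 * t} = \<alpha> \<longleftrightarrow> t = - ln \<alpha>" for t
  proof -
    have "exp (- t) = \<alpha> \<longleftrightarrow> t = - ln \<alpha>"
      using \<alpha> by (metis exp_ln ln_exp minus_minus)
    moreover have "- ln \<alpha> > 0"
      using \<alpha> by simp
    ultimately show ?thesis
      using \<alpha> by (auto simp: measure_mvn_0_quad_stat[OF A sym])
  qed
  then show ?thesis
    unfolding lrt_rejection_region_def set by (metis minus_mult_commute)
qed

section \<open>Interpolation kernels\<close>

lemma interpolation_kernel_deriv:
  assumes "interpolation_kernel M \<phi>" "M \<ge> 2"
  shows "(\<phi> has_real_derivative deriv \<phi> t) (at t)" "continuous_on UNIV (deriv \<phi>)"
proof -
  have d: "(deriv ^^ k) \<phi> differentiable (at t)" if "k < M" for k t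
    using assms(1) that by (simp add: interpolation_kernel_def Suc_deriv_Linf_def)
  show "(\<phi> has_real_derivative deriv \<phi> t) (at t)"
    using d[of 0 t] assms(2) by (simp add: DERIV_deriv_iff_real_differentiable)
  show "continuous_on UNIV (deriv \<phi>)"
    using d[of 1] assms(2)
    by (auto intro!: continuous_at_imp_continuous_on differentiable_imp_continuous_within)
qed

lemma interpolation_kernel_support:
  assumes "interpolation_kernel M \<phi>"
  obtains T where "T > 0" "\<And>t. \<bar>t\<bar> \<ge> T \<Longrightarrow> \<phi> t = 0" "\<And>t. \<bar>t\<bar> \<ge> T \<Longrightarrow> deriv \<phi> t = 0"
proof -
  have "bounded {t. \<phi> t \<noteq> 0}"
    using assms compact_imp_bounded bounded_subset closure_subset
    unfolding interpolation_kernel_def by metis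
  then obtain B where B: "\<And>t. \<phi> t \<noteq> 0 \<Longrightarrow> \<bar>t\<bar> \<le> B"
    unfolding bounded_iff by auto
  \<comment> \<open>The margin 1 makes \<open>\<phi>\<close> vanish in a neighbourhood of every t
    with \<open>\<bar>t\<bar> \<ge> T\<close>, so that the derivative vanishes there too, the
    endpoints included.\<close>
  define T where "T = max B 0 + 1"
  show ?thesis
  proof
    show "T > 0" by (simp add: T_def)
    show "\<phi> t = 0" if "\<bar>t\<bar> \<ge> T" for t
      using B[of t] that by (force simp: T_def)
    show "deriv \<phi> t = 0" if t: "\<bar>t\<bar> \<ge> T" for t
    proof -
      have "open {t :: real. max B 0 < \<bar>t\<bar>}"
        by (intro open_Collect_less continuous_intros)
      then have "\<forall>\<^sub>F x in nhds t. max B 0 < \<bar>x\<bar>"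
        using t eventually_nhds_in_open[of "{t :: real. max B 0 < \<bar>t\<bar>}" t]
        by (simp add: T_def del: max_less_iff_conj)
      then have "\<forall>\<^sub>F x in nhds t. \<phi> x = (\<lambda>_. 0) x"
        by eventually_elim (use B in \<open>force simp del: max_less_iff_conj\<close>)
      then have "deriv \<phi> t = deriv (\<lambda>_. 0) t"
        by (rule deriv_cong_ev) simp
      then show ?thesis by simp
    qed
  qed
qed

lemma sum_symmetric_telescope:
  fixes \<Phi> :: "real \<Rightarrow> real"
  shows "(\<Sum>k = - int n..int n. \<Phi> (1 - of_int k) - \<Phi> (0 - of_int k)) = \<Phi> (1 + real n) - \<Phi> (- real n)"
proof (induction n)
  case (Suc n)
  have "{- int (Suc n)..int (Suc n)} = insert (- int (Suc n)) (insert (int (Suc n)) {- int n..int n})"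
    by auto
  then show ?case
    using Suc by (simp add: add.commute)
qed simp

text \<open>Integrating the partition of unity, the exactness condition with j = 0, over the unit
  interval unfolds into the integral of \<open>\<phi>\<close> over the line. In terms of an
  antiderivative \<open>\<Phi>\<close>: the sum \<open>G\<close> of its integer translates has slope
  1 on the unit interval, and \<open>G 1 - G 0\<close> telescopes.\<close>

lemma interpolation_kernel_integral:
  assumes ker: "interpolation_kernel M \<phi>" and cont: "continuous_on UNIV \<phi>"
  shows "integrable lborel \<phi>" "(\<integral>t. \<phi> t \<partial>lborel) = 1"
proof -
  obtain T where T: "T > 0" "\<And>t. \<bar>t\<bar> \<ge> T \<Longrightarrow> \<phi> t = 0"
    using interpolation_kernel_support[OF ker] by metis
  obtain n :: nat where n: "real n > T"
    using reals_Archimedean2 by blast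
  \<comment> \<open>For t in [0, 1] and \<bar>k\<bar> \<le> n the points t - k lie in [- n, n + 1],
    strictly inside (- N, N), where \<open>\<Phi>\<close> has a two-sided derivative.\<close>
  define N where "N = real n + 2"
  have ind: "\<phi> = (\<lambda>t. indicator {- N..N} t *\<^sub>R \<phi> t)"
    using T n by (force simp: N_def indicator_def)
  obtain \<Phi> where \<Phi>: "\<And>x. x \<in> {- N..N} \<Longrightarrow> (\<Phi> has_vector_derivative \<phi> x) (at x within {- N..N})"
    using antiderivative_continuous[OF continuous_on_subset[OF cont subset_UNIV]] by metis
  have "has_bochner_integral lborel (\<lambda>t. indicator {- N..N} t *\<^sub>R \<phi> t) (\<Phi> N - \<Phi> (- N))"
    using n T(1) by (intro has_bochner_integral_FTC_Icc \<Phi> continuous_on_subset[OF cont]) (auto simp: N_def)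
  then have hbi: "has_bochner_integral lborel \<phi> (\<Phi> N - \<Phi> (- N))"
    using ind by simp
  then show "integrable lborel \<phi>"
    by (rule integrable.intros)
  have \<Phi>': "(\<Phi> has_real_derivative \<phi> x) (at x)" if "x \<in> {- N<..<N}" for x
    using \<Phi>[of x] that at_within_Icc_at[of "- N" x N]
    by (auto simp: has_real_derivative_iff_has_vector_derivative)
  \<comment> \<open>Off the support of \<open>\<phi>\<close> the antiderivative is constant, which
    moves the telescoped values at 1 + n and - n to the endpoints of the interval of
    integration.\<close>
  have const: "\<Phi> x = \<Phi> y" if "x \<le> y" "\<And>z. z \<in> {x..y} \<Longrightarrow> \<bar>z\<bar> \<ge> T" "- N \<le> x" "y \<le> N" for x y
  proof -
    have "(\<Phi> has_vector_derivative 0) (at z within {x..y})" if "z \<in> {x..y}" for z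
      using has_vector_derivative_within_subset[OF \<Phi>, of z "{x..y}"] that T(2)[of z] \<open>\<And>z. z \<in> {x..y} \<Longrightarrow> \<bar>z\<bar> \<ge> T\<close> \<open>- N \<le> x\<close> \<open>y \<le> N\<close>
      by auto
    then show ?thesis
      using has_vector_derivative_zero_constant[of "{x..y}" \<Phi>] \<open>x \<le> y\<close>
      by (metis atLeastAtMost_iff convex_real_interval(5) order_refl)
  qed
  define G where "G t = (\<Sum>k = - int n..int n. \<Phi> (t - of_int k))" for t
  have one: "(\<Sum>k = - int n..int n. \<phi> (t - of_int k)) = 1" if t: "t \<in> {0..1}" for t
  proof -
    have "((\<lambda>k::int. \<phi> (t - of_int k)) has_sum 1) UNIV"
      using ker unfolding interpolation_kernel_def by (auto dest: bspec[of _ _ 0])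
    moreover have "\<phi> (t - of_int k) = 0" if "k \<notin> {- int n..int n}" for k
    proof -
      have "k \<ge> int n + 1 \<or> k \<le> - int n - 1"
        using that by auto
      then have "real_of_int k \<ge> real n + 1 \<or> real_of_int k \<le> - real n - 1"
        by linarith
      then show ?thesis
        using t n by (intro T) auto
    qed
    ultimately have "((\<lambda>k::int. \<phi> (t - of_int k)) has_sum 1) {- int n..int n}"
      by (subst has_sum_cong_neutral[where S=UNIV and g="\<lambda>k. \<phi> (t - of_int k)", symmetric]) auto
    then show ?thesis
      using has_sum_unique has_sum_finite by blast
  qed
  have "(G has_real_derivative (\<Sum>k = - int n..int n. \<phi> (t - of_int k))) (at t)" if t: "t \<in> {0..1}" for t
  proof -
    have "((\<lambda>t. \<Phi> (t - of_int k)) has_real_derivative \<phi> (t - of_int k)) (at t)"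
      if "k \<in> {- int n..int n}" for k
    proof -
      have "- real n \<le> of_int k" "of_int k \<le> real n"
        using that by auto
      then have "t - of_int k \<in> {- N<..<N}"
        using t by (auto simp: N_def)
      moreover have "((\<lambda>t. t - of_int k) has_real_derivative 1) (at t)"
        by (auto intro!: derivative_eq_intros)
      ultimately show ?thesis
        using DERIV_chain2[where f=\<Phi> and g="\<lambda>t. t - of_int k" and Db=1] \<Phi>' by fastforce
    qed
    then show ?thesis
      unfolding G_def by (intro DERIV_sum)
  qed
  then have G': "(G has_real_derivative 1) (at t)" if "t \<in> {0..1}" for t
    using that by (simp add: one)
  have "1 = G 1 - G 0"
    using MVT2[of 0 1 G "\<lambda>_. 1"] G' by auto
  also have "\<dots> = \<Phi> (1 + real n) - \<Phi> (- real n)"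
    unfolding G_def sum_subtractf[symmetric] by (rule sum_symmetric_telescope)
  also have "\<Phi> (1 + real n) = \<Phi> N"
    using n by (intro const) (auto simp: N_def)
  also have "\<Phi> (- real n) = \<Phi> (- N)"
    using n by (intro const[symmetric]) (auto simp: N_def)
  finally show "(\<integral>t. \<phi> t \<partial>lborel) = 1"
    using hbi by (simp add: has_bochner_integral_integral_eq)
qed

section \<open>Continuous functions of compact support and their autocorrelation\<close>

lemma compact_support_bounded:
  fixes \<psi> :: "real \<Rightarrow> real"
  assumes cont: "continuous_on UNIV \<psi>" and T: "\<And>t. \<bar>t\<bar> \<ge> T \<Longrightarrow> \<psi> t = 0"
  obtains B where "B > 0" "\<And>t. \<bar>\<psi> t\<bar> \<le> B"
proof -
  have "bounded (\<psi> ` {- T..T})"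
    by (intro compact_imp_bounded compact_continuous_image continuous_on_subset[OF cont]) auto
  then obtain B where B: "B > 0" "\<And>t. t \<in> {- T..T} \<Longrightarrow> \<bar>\<psi> t\<bar> \<le> B"
    unfolding bounded_pos by auto
  have "\<bar>\<psi> t\<bar> \<le> B" for t
  proof (cases "\<bar>t\<bar> \<ge> T")
    case False
    then have "t \<in> {- T..T}" by auto
    then show ?thesis by (rule B(2))
  qed (use B(1) T in simp)
  with B(1) show ?thesis by (rule that)
qed

lemma compact_support_integrable:
  fixes \<psi> :: "real \<Rightarrow> real"
  assumes cont: "continuous_on UNIV \<psi>" and T: "\<And>t. \<bar>t\<bar> \<ge> T \<Longrightarrow> \<psi> t = 0"
  shows "integrable lborel \<psi>"
proof -
  have "integrable lborel (\<lambda>t. indicator {- T..T} t *\<^sub>R \<psi> t)"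
    by (rule borel_integrable_compact) (auto intro: continuous_on_subset[OF cont])
  also have "(\<lambda>t. indicator {- T..T} t *\<^sub>R \<psi> t) = \<psi>"
    using T by (force simp: indicator_def)
  finally show ?thesis .
qed

lemma crosscorr_continuous:
  assumes cont: "continuous_on UNIV \<psi>" and T: "\<And>t. \<bar>t\<bar> \<ge> T \<Longrightarrow> \<psi> t = 0"
  shows "continuous_on UNIV (crosscorr \<psi> \<psi>)"
proof -
  obtain B where B: "B > 0" "\<And>t. \<bar>\<psi> t\<bar> \<le> B"
    using compact_support_bounded[OF assms] by blast
  have [measurable]: "\<psi> \<in> borel_measurable borel"
    using cont by (rule borel_measurable_continuous_onI)
  have "(\<lambda>i. crosscorr \<psi> \<psi> (x i)) \<longlonglongrightarrow> crosscorr \<psi> \<psi> a" if x: "x \<longlonglongrightarrow> a" for x a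
    unfolding crosscorr_def
  proof (rule integral_dominated_convergence[where w="\<lambda>s. B * \<bar>\<psi> s\<bar>"])
    show "integrable lborel (\<lambda>s. B * \<bar>\<psi> s\<bar>)"
      using compact_support_integrable[OF assms] by simp
    have "(\<lambda>i. \<psi> (x i + s)) \<longlonglongrightarrow> \<psi> (a + s)" for s
      using cont x by (intro isCont_tendsto_compose[of _ \<psi>] tendsto_intros)
        (auto simp: continuous_on_eq_continuous_at)
    then show "AE s in lborel. (\<lambda>i. \<psi> (x i + s) * \<psi> s) \<longlonglongrightarrow> \<psi> (a + s) * \<psi> s"
      by (auto intro!: tendsto_mult)
    show "AE s in lborel. norm (\<psi> (x i + s) * \<psi> s) \<le> B * \<bar>\<psi> s\<bar>" for i
      using B by (auto simp: abs_mult intro!: mult_right_mono)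
  qed simp_all
  then show ?thesis
    by (simp add: continuous_on_sequentially comp_def)
qed

section \<open>Integrals of a Gaussian field\<close>

text \<open>A density on the whole space instead of a restricted space: Borel functions stay
  measurable without side conditions, and for compact \<open>A\<close> the measure is finite, as
  dominated convergence and Fubini require below.\<close>

definition lborel_on :: "'a::euclidean_space set \<Rightarrow> 'a measure" where
  "lborel_on A = density lborel (\<lambda>x. ennreal (indicator A x))"

lemma sets_lborel_on [simp, measurable_cong]: "sets (lborel_on A) = sets borel"
  by (simp add: lborel_on_def)

lemma integral_lborel_on:
  fixes f :: "'a::euclidean_space \<Rightarrow> 'b::{banach, second_countable_topology}"
  assumes [measurable]: "f \<in> borel_measurable borel" "A \<in> sets borel"
  shows "(\<integral>x. f x \<partial>lborel_on A) = (LINT x:A|lborel. f x)"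
  unfolding lborel_on_def set_lebesgue_integral_def by (rule integral_density) simp_all

lemma AE_lborel_on:
  assumes [measurable]: "A \<in> sets borel"
  shows "AE x in lborel_on A. x \<in> A"
  unfolding lborel_on_def by (subst AE_density) (auto split: split_indicator)

lemma finite_measure_lborel_on:
  fixes A :: "'a::euclidean_space set"
  assumes "compact A"
  shows "finite_measure (lborel_on A)"
proof
  have [measurable]: "A \<in> sets borel"
    using assms by (simp add: borel_compact)
  have "emeasure (lborel_on A) (space (lborel_on A)) = emeasure lborel A"
    unfolding lborel_on_def by (simp add: emeasure_density ennreal_indicator)
  also have "\<dots> < \<infinity>"
    using emeasure_compact_finite[OF assms] by simp
  finally show "emeasure (lborel_on A) (space (lborel_on A)) \<noteq> \<infinity>"
    by simp
qed

lemma integrable_lborel_on: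
  fixes f :: "'a::euclidean_space \<Rightarrow> 'b::{banach, second_countable_topology}"
  assumes "compact A" "f \<in> borel_measurable borel" "\<And>x. x \<in> A \<Longrightarrow> norm (f x) \<le> B"
  shows "integrable (lborel_on A) f"
proof -
  interpret finite_measure "lborel_on A"
    using assms(1) by (rule finite_measure_lborel_on)
  show ?thesis
    using AE_lborel_on[of A] assms by (intro integrable_const_bound[of _ B]) (auto simp: borel_compact)
qed

text \<open>The degenerate case cannot be skipped, since a linear combination of field values may be
  constant. Otherwise everything follows from the standard normal law of
  \<open>(X x - m) / s\<close>.\<close>

lemma normal_rv_moments:
  assumes "prob_space M" "normal_rv M X m v"
  shows "integrable M X" "integrable M (\<lambda>x. (X x)\<^sup>2)" "(LINT x|M. X x) = m"
    "(LINT x|M. (X x)\<^sup>2) = v + m\<^sup>2" "(CLINT x|M. iexp (X x)) = iexp m * exp (- v / 2)"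
proof -
  interpret prob_space M by fact
  have [measurable]: "X \<in> borel_measurable M" and v: "v \<ge> 0"
    using assms by (auto simp: normal_rv_def)
  have "integrable M X \<and> integrable M (\<lambda>x. (X x)\<^sup>2) \<and> expectation X = m \<and>
      expectation (\<lambda>x. (X x)\<^sup>2) = v + m\<^sup>2 \<and> (CLINT x|M. iexp (X x)) = iexp m * exp (- v / 2)"
  proof (cases "v = 0")
    case True
    then have ae: "AE x in M. X x = m"
      using assms by (simp add: normal_rv_def)
    have "integrable M X = integrable M (\<lambda>_. m)" "integrable M (\<lambda>x. (X x)\<^sup>2) = integrable M (\<lambda>_. m\<^sup>2)"
      by (rule integrable_cong_AE; use ae in auto)+
    moreover have "expectation X = expectation (\<lambda>_. m)" "expectation (\<lambda>x. (X x)\<^sup>2) = expectation (\<lambda>_. m\<^sup>2)"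
        "(CLINT x|M. iexp (X x)) = (CLINT x|M. iexp m)"
      by (rule integral_cong_AE; use ae in auto)+
    ultimately show ?thesis
      by (simp add: True prob_space)
  next
    case False
    define s where "s = sqrt v"
    have s: "s > 0" "v = s\<^sup>2"
      using False v by (auto simp: s_def)
    have d: "distributed M lborel X (normal_density m s)"
      using assms False by (simp add: normal_rv_def s_def)
    then have dZ: "distributed M lborel (\<lambda>x. (X x - m) / s) std_normal_density"
      using normal_standard_normal_convert[OF s(1)] by simp
    have [measurable]: "(\<lambda>x. (X x - m) / s) \<in> borel_measurable M"
      by simp
    have Z: "distr M borel (\<lambda>x. (X x - m) / s) = std_normal_distribution"
      using distributed_distr_eq_density[OF dZ] by (simp cong: distr_cong)
    have Z1: "integrable M (\<lambda>x. ((X x - m) / s) ^ k)" for k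
      using integrable_std_normal_moment[of k] distributed_integrable[OF dZ, of "\<lambda>x. x ^ k"] by simp
    have iX: "integrable M X"
    proof -
      have "integrable M (\<lambda>x. m + s * ((X x - m) / s) ^ 1)"
        by (intro Bochner_Integration.integrable_add integrable_mult_right Z1) simp
      also have "(\<lambda>x. m + s * ((X x - m) / s) ^ 1) = X"
        using s by auto
      finally show ?thesis .
    qed
    have "integrable M (\<lambda>x. m\<^sup>2 + 2 * m * s * ((X x - m) / s) ^ 1 + s\<^sup>2 * ((X x - m) / s)\<^sup>2)"
      by (intro Bochner_Integration.integrable_add integrable_mult_right Z1) simp
    also have "(\<lambda>x. m\<^sup>2 + 2 * m * s * ((X x - m) / s) ^ 1 + s\<^sup>2 * ((X x - m) / s)\<^sup>2) = (\<lambda>x. (X x)\<^sup>2)"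
      using s by (auto simp: power2_eq_square field_simps)
    finally have iX2: "integrable M (\<lambda>x. (X x)\<^sup>2)" .
    have E: "expectation X = m"
      using normal_distributed_expectation[OF s(1) d] .
    have "expectation (\<lambda>x. (X x)\<^sup>2) - m\<^sup>2 = s\<^sup>2"
      using normal_distributed_variance[OF s(1) d] variance_eq[OF iX iX2] E by simp
    then have V: "expectation (\<lambda>x. (X x)\<^sup>2) = v + m\<^sup>2"
      using s by simp
    have "iexp (X x) = iexp m * iexp (s * ((X x - m) / s))" for x
    proof -
      have "s * ((X x - m) / s) = X x - m"
        using s by simp
      then show ?thesis
        by (simp only: exp_add[symmetric]) (simp add: algebra_simps)
    qed
    then have "(CLINT x|M. iexp (X x)) = (CLINT x|M. iexp m * iexp (s * ((X x - m) / s)))"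
      by (simp only:)
    also have "\<dots> = iexp m * (CLINT x|M. iexp (s * ((X x - m) / s)))"
      by simp
    also have "(CLINT x|M. iexp (s * ((X x - m) / s))) = char (distr M borel (\<lambda>x. (X x - m) / s)) s"
      unfolding char_def by (subst integral_distr) simp_all
    also have "\<dots> = exp (- v / 2)"
      unfolding Z char_std_normal_distribution by (simp add: s(2))
    finally show ?thesis
      using iX iX2 E V by simp
  qed
  then show "integrable M X" "integrable M (\<lambda>x. (X x)\<^sup>2)" "expectation X = m"
    "expectation (\<lambda>x. (X x)\<^sup>2) = v + m\<^sup>2" "(CLINT x|M. iexp (X x)) = iexp m * exp (- v / 2)"
    by auto
qed

text \<open>\<open>gaussian_field\<close> only asserts that some mean and variance exist; they are
  identified by computing the first two moments of the sum. Singleton sums show that each value of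
  the field is square integrable, which makes the products integrable.\<close>

lemma gaussian_field_sum_char:
  assumes M: "prob_space M" and N: "gaussian_field M N"
    and mean: "\<And>x. (LINT w|M. N w x) = 0"
    and cov: "\<And>x y. (LINT w|M. N w x * N w y) = C (x - y)"
    and I: "finite I"
  shows "(\<lambda>w. \<Sum>x\<in>I. a x * N w x) \<in> borel_measurable M"
    "(CLINT w|M. iexp (\<Sum>x\<in>I. a x * N w x)) = exp (- (\<Sum>x\<in>I. \<Sum>y\<in>I. a x * a y * C (x - y)) / 2)"
proof -
  interpret prob_space M by fact
  obtain m v where n: "normal_rv M (\<lambda>w. \<Sum>x\<in>I. a x * N w x) m v"
    using N I unfolding gaussian_field_def by blast
  then show [measurable]: "(\<lambda>w. \<Sum>x\<in>I. a x * N w x) \<in> borel_measurable M"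
    by (simp add: normal_rv_def)
  note mom = normal_rv_moments[OF M n]
  have N1: "\<exists>m v. normal_rv M (\<lambda>w. N w x) m v" for x
    using N[unfolded gaussian_field_def, rule_format, of "{x}" "\<lambda>_. 1"] by simp
  have i1: "integrable M (\<lambda>w. N w x)" and i2: "integrable M (\<lambda>w. (N w x)\<^sup>2)" for x
    using N1[of x] normal_rv_moments(1,2)[OF M] by blast+
  have i: "integrable M (\<lambda>w. N w x * N w y)" for x y
  proof (rule Bochner_Integration.integrable_bound)
    show "integrable M (\<lambda>w. (N w x)\<^sup>2 + (N w y)\<^sup>2)"
      using i2 by simp
    show "(\<lambda>w. N w x * N w y) \<in> borel_measurable M"
      using i1 by (auto intro: borel_measurable_times borel_measurable_integrable)
    have "\<bar>a * b\<bar> \<le> \<bar>a\<^sup>2 + b\<^sup>2\<bar>" for a b :: real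
      using sum_squares_bound[of "\<bar>a\<bar>" "\<bar>b\<bar>"] abs_ge_zero[of "a * b"] unfolding abs_mult power2_abs by linarith
    then show "AE w in M. norm (N w x * N w y) \<le> norm ((N w x)\<^sup>2 + (N w y)\<^sup>2)"
      by simp
  qed
  have m: "m = 0"
    using mom(3) i1 by (simp add: mean)
  have "(\<Sum>x\<in>I. a x * N w x)\<^sup>2 = (\<Sum>x\<in>I. \<Sum>y\<in>I. a x * a y * (N w x * N w y))" for w
    unfolding power2_eq_square sum_product by (simp add: mult_ac)
  then have "expectation (\<lambda>w. (\<Sum>x\<in>I. a x * N w x)\<^sup>2) = (\<Sum>x\<in>I. \<Sum>y\<in>I. a x * a y * C (x - y))"
    using i by (simp add: cov)
  then have "v = (\<Sum>x\<in>I. \<Sum>y\<in>I. a x * a y * C (x - y))"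
    using mom(4) m by simp
  then show "(CLINT w|M. iexp (\<Sum>x\<in>I. a x * N w x)) = exp (- (\<Sum>x\<in>I. \<Sum>y\<in>I. a x * a y * C (x - y)) / 2)"
    using mom(5) m by simp
qed

text \<open>Rounding to the grid of mesh \<open>1 / (n + 1)\<close> turns integrals over a bounded set into finite sums.\<close>

definition grid_round :: "nat \<Rightarrow> real^'n \<Rightarrow> real^'n" where
  "grid_round n x = (\<chi> i. of_int \<lfloor>x $ i * real (Suc n)\<rfloor> / real (Suc n))"

lemma borel_measurable_grid_round [measurable]: "grid_round n \<in> borel_measurable borel"
proof -
  have "(\<lambda>x::real^'n. grid_round n x \<bullet> b) \<in> borel_measurable borel" if b: "b \<in> Basis" for b
  proof -
    obtain i where "b = axis i 1"
      using b by (auto simp: Basis_vec_def)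
    then have "(\<lambda>x::real^'n. grid_round n x \<bullet> b) = (\<lambda>x. of_int \<lfloor>x $ i * real (Suc n)\<rfloor> / real (Suc n))"
      by (simp add: inner_axis grid_round_def)
    then show ?thesis by simp
  qed
  then show ?thesis
    using borel_measurable_euclidean_space by blast
qed

lemma grid_round_diff: "\<bar>grid_round n x $ i - x $ i\<bar> \<le> 1 / real (Suc n)"
proof -
  have "real_of_int \<lfloor>x $ i * real (Suc n)\<rfloor> / real (Suc n) - x $ i
      = (real_of_int \<lfloor>x $ i * real (Suc n)\<rfloor> - x $ i * real (Suc n)) / real (Suc n)"
    by (simp add: field_simps)
  moreover have "\<bar>real_of_int \<lfloor>x $ i * real (Suc n)\<rfloor> - x $ i * real (Suc n)\<bar> \<le> 1"
    by linarith
  ultimately show ?thesis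
    by (simp add: grid_round_def divide_right_mono)
qed

lemma grid_round_tendsto: "(\<lambda>n. grid_round n x) \<longlonglongrightarrow> x"
proof (rule vec_tendstoI)
  fix i
  have "(\<lambda>n. grid_round n x $ i - x $ i) \<longlonglongrightarrow> 0"
    by (rule Lim_null_comparison[OF always_eventually LIMSEQ_inverse_real_of_nat])
      (simp add: inverse_eq_divide grid_round_diff del: of_nat_Suc)
  then show "(\<lambda>n. grid_round n x $ i) \<longlonglongrightarrow> x $ i"
    by (simp add: LIM_zero_iff)
qed

lemma grid_round_norm: "norm (grid_round n (x::real^2)) \<le> norm x + 2"
proof -
  have *: "\<bar>grid_round n x $ i - x $ i\<bar> \<le> 1" for i
    using grid_round_diff[of n x i] by (rule order_trans) simp
  have "norm (grid_round n x - x) \<le> 1 + 1"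
    using norm_le_l1_cart[of "grid_round n x - x"] *[of 1] *[of 2]
    by (simp add: sum_2)
  then show ?thesis
    using norm_triangle_ineq2[of "grid_round n x" x] by simp
qed

lemma finite_grid_round_image:
  fixes A :: "(real^'n) set"
  assumes "bounded A"
  shows "finite (grid_round n ` A)"
proof -
  obtain B where B: "\<And>x. x \<in> A \<Longrightarrow> norm x \<le> B"
    using assms unfolding bounded_iff by blast
  define J where "J = {- \<lceil>B * real (Suc n)\<rceil> - 1..\<lceil>B * real (Suc n)\<rceil> + 1}"
  have "grid_round n ` A \<subseteq> (\<lambda>z. \<chi> i. real_of_int (z $ i) / real (Suc n)) ` {z. \<forall>i. z $ i \<in> J}"
  proof
    fix p assume "p \<in> grid_round n ` A"
    then obtain x where x: "x \<in> A" "p = grid_round n x" by blast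
    define z where "z = (\<chi> i. \<lfloor>x $ i * real (Suc n)\<rfloor>)"
    have "z $ i \<in> J" for i
    proof -
      have "\<bar>x $ i\<bar> \<le> B"
        using B[OF x(1)] component_le_norm_cart[of x i] by linarith
      then have "\<bar>x $ i * real (Suc n)\<bar> \<le> B * real (Suc n)"
        by (simp add: abs_mult mult_right_mono)
      then show ?thesis
        unfolding z_def J_def by simp linarith
    qed
    then show "p \<in> (\<lambda>z. \<chi> i. real_of_int (z $ i) / real (Suc n)) ` {z. \<forall>i. z $ i \<in> J}"
      by (intro image_eqI[of _ _ z]) (simp_all add: x(2) grid_round_def z_def)
  qed
  moreover have "finite {z::int^'n. \<forall>i. z $ i \<in> J}"
  proof (rule finite_subset)
    show "{z::int^'n. \<forall>i. z $ i \<in> J} \<subseteq> (\<lambda>f. \<chi> i. f i) ` (UNIV \<rightarrow>\<^sub>E J)"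
    proof
      fix z :: "int^'n" assume "z \<in> {z. \<forall>i. z $ i \<in> J}"
      then show "z \<in> (\<lambda>f. \<chi> i. f i) ` (UNIV \<rightarrow>\<^sub>E J)"
        by (intro image_eqI[of _ _ "vec_nth z"]) auto
    qed
    show "finite ((\<lambda>f. (\<chi> i. f i) :: int^'n) ` (UNIV \<rightarrow>\<^sub>E J))"
      by (intro finite_imageI finite_PiE) (simp_all add: J_def)
  qed
  ultimately show ?thesis
    by (rule finite_subset[OF _ finite_imageI])
qed

text \<open>Only \<open>g\<close> is sampled on the grid, while \<open>u\<close> is integrated
  exactly over each cell. Hence this is an identity, and the later limit asks for continuity of
  \<open>g\<close> alone.\<close>

lemma integral_grid_round:
  fixes A :: "(real^'n) set" and u g :: "real^'n \<Rightarrow> real"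
  assumes A: "compact A" and [measurable]: "u \<in> borel_measurable borel" "g \<in> borel_measurable borel"
    and u: "\<And>x. x \<in> A \<Longrightarrow> \<bar>u x\<bar> \<le> K"
  shows "(\<integral>x. u x * g (grid_round n x) \<partial>lborel_on A) =
    (\<Sum>p\<in>grid_round n ` A. (\<integral>x. u x * indicator {p} (grid_round n x) \<partial>lborel_on A) * g p)"
proof -
  have fin: "finite (grid_round n ` A)"
    using A by (intro finite_grid_round_image compact_imp_bounded)
  have [measurable]: "A \<in> sets borel"
    using A by (simp add: borel_compact)
  have int: "integrable (lborel_on A) (\<lambda>x. u x * indicator {p} (grid_round n x) * g p)" for p
    using A u by (intro integrable_mult_left integrable_lborel_on[of _ _ K])
      (auto split: split_indicator intro: order_trans[OF abs_ge_zero])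
  have eq: "u x * g (grid_round n x) = (\<Sum>p\<in>grid_round n ` A. u x * indicator {p} (grid_round n x) * g p)"
    if x: "x \<in> A" for x
  proof -
    have "(\<Sum>p\<in>grid_round n ` A. u x * indicator {p} (grid_round n x) * g p)
        = (\<Sum>p\<in>grid_round n ` A. if p = grid_round n x then u x * g p else 0)"
      by (intro sum.cong) (auto simp: indicator_def)
    then show ?thesis
      using fin x by (simp add: sum.delta)
  qed
  have "(\<integral>x. u x * g (grid_round n x) \<partial>lborel_on A)
      = (\<integral>x. (\<Sum>p\<in>grid_round n ` A. u x * indicator {p} (grid_round n x) * g p) \<partial>lborel_on A)"
    using AE_lborel_on[of A] eq by (intro integral_cong_AE) auto
  also have "\<dots> = (\<Sum>p\<in>grid_round n ` A. (\<integral>x. u x * indicator {p} (grid_round n x) \<partial>lborel_on A) * g p)"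
    using int by simp
  finally show ?thesis .
qed

text \<open>Rounded points may leave \<open>A\<close>, but they stay within distance 2 of it. The
  bound is therefore taken over the ball of radius 2 (R + 2), which contains their differences as
  well; this is why \<open>g\<close> is continuous on the whole plane.\<close>

lemma grid_round_bounded:
  fixes g :: "real^2 \<Rightarrow> real"
  assumes A: "compact A" and g: "continuous_on UNIV g"
  obtains B where "B > 0" "\<And>n x. x \<in> A \<Longrightarrow> \<bar>g (grid_round n x)\<bar> \<le> B"
    "\<And>n x y. x \<in> A \<Longrightarrow> y \<in> A \<Longrightarrow> \<bar>g (grid_round n x - grid_round n y)\<bar> \<le> B"
proof -
  obtain R where R: "\<And>x. x \<in> A \<Longrightarrow> norm x \<le> R" "R > 0"
    using compact_imp_bounded[OF A] unfolding bounded_pos by blast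
  have "bounded (g ` cball 0 (2 * (R + 2)))"
    by (intro compact_imp_bounded compact_continuous_image continuous_on_subset[OF g]) auto
  then obtain B where B: "B > 0" "\<And>x. norm x \<le> 2 * (R + 2) \<Longrightarrow> \<bar>g x\<bar> \<le> B"
    unfolding bounded_pos by auto
  have n: "norm (grid_round n x) \<le> R + 2" if "x \<in> A" for x n
    using grid_round_norm[of n x] R(1)[OF that] by simp
  show ?thesis
  proof
    show "B > 0" by fact
    show "\<bar>g (grid_round n x)\<bar> \<le> B" if "x \<in> A" for n x
      using n[OF that, of n] R(2) by (intro B) simp
    show "\<bar>g (grid_round n x - grid_round n y)\<bar> \<le> B" if "x \<in> A" "y \<in> A" for n x y
      using n[OF that(1), of n] n[OF that(2), of n] norm_triangle_ineq4[of "grid_round n x" "grid_round n y"]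
      by (intro B) simp
  qed
qed

lemma grid_round_integral_tendsto:
  fixes g u :: "real^2 \<Rightarrow> real"
  assumes A: "compact A" and g: "continuous_on UNIV g" and [measurable]: "u \<in> borel_measurable borel"
    and u: "\<And>x. x \<in> A \<Longrightarrow> \<bar>u x\<bar> \<le> K"
  shows "(\<lambda>n. \<integral>x. u x * g (grid_round n x) \<partial>lborel_on A) \<longlonglongrightarrow> (\<integral>x. u x * g x \<partial>lborel_on A)"
proof -
  have [measurable]: "A \<in> sets borel" "g \<in> borel_measurable borel"
    using A g by (simp_all add: borel_compact borel_measurable_continuous_onI)
  obtain B where B: "B > 0" "\<And>n x. x \<in> A \<Longrightarrow> \<bar>g (grid_round n x)\<bar> \<le> B"
    using grid_round_bounded[OF A g] by metis
  show ?thesis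
  proof (rule integral_dominated_convergence[where w="\<lambda>_. \<bar>K\<bar> * B"])
    show "integrable (lborel_on A) (\<lambda>_. \<bar>K\<bar> * B)"
      by (rule integrable_lborel_on[OF A]) auto
    have "(\<lambda>n. g (grid_round n x)) \<longlonglongrightarrow> g x" for x
      using g by (intro isCont_tendsto_compose[OF _ grid_round_tendsto]) (auto simp: continuous_on_eq_continuous_at)
    then show "AE x in lborel_on A. (\<lambda>n. u x * g (grid_round n x)) \<longlonglongrightarrow> u x * g x"
      by (intro AE_I2 tendsto_mult_left)
    have "\<bar>u x\<bar> * \<bar>g (grid_round n x)\<bar> \<le> \<bar>K\<bar> * B" if "x \<in> A" for n x
      using u[OF that] B(2)[OF that] by (intro mult_mono) auto
    then show "AE x in lborel_on A. norm (u x * g (grid_round n x)) \<le> \<bar>K\<bar> * B" for n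
      using AE_lborel_on[of A] by (auto simp: abs_mult)
  qed simp_all
qed

lemma grid_round_double_integral_tendsto:
  fixes C u :: "real^2 \<Rightarrow> real"
  assumes A: "compact A" and C: "continuous_on UNIV C" and [measurable]: "u \<in> borel_measurable borel"
    and u: "\<And>x. x \<in> A \<Longrightarrow> \<bar>u x\<bar> \<le> K"
  shows "(\<lambda>n. \<integral>x. u x * (\<integral>y. u y * C (grid_round n x - grid_round n y) \<partial>lborel_on A) \<partial>lborel_on A)
    \<longlonglongrightarrow> (\<integral>x. u x * (\<integral>y. u y * C (x - y) \<partial>lborel_on A) \<partial>lborel_on A)"
proof -
  have [measurable]: "A \<in> sets borel" "C \<in> borel_measurable borel"
    using A C by (simp_all add: borel_compact borel_measurable_continuous_onI)
  interpret L: finite_measure "lborel_on A"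
    using A by (rule finite_measure_lborel_on)
  obtain B where B: "B > 0" "\<And>n x y. x \<in> A \<Longrightarrow> y \<in> A \<Longrightarrow> \<bar>C (grid_round n x - grid_round n y)\<bar> \<le> B"
    using grid_round_bounded[OF A C] by metis
  define J where "J n x = (\<integral>y. u y * C (grid_round n x - grid_round n y) \<partial>lborel_on A)" for n x
  have [measurable]: "J n \<in> borel_measurable borel" for n
    unfolding J_def by measurable
  have bound: "\<bar>u y * C (grid_round n x - grid_round n y)\<bar> \<le> \<bar>K\<bar> * B" if "x \<in> A" "y \<in> A" for n x y
    using u[OF that(2)] B(2)[OF that] unfolding abs_mult by (intro mult_mono) auto
  have Jb: "\<bar>J n x\<bar> \<le> \<bar>K\<bar> * B * measure (lborel_on A) UNIV" if x: "x \<in> A" for n x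
  proof -
    have "norm (J n x) \<le> (\<integral>y. \<bar>u y * C (grid_round n x - grid_round n y)\<bar> \<partial>lborel_on A)"
      unfolding J_def using integral_norm_bound[of "lborel_on A"] by simp
    also have "\<dots> \<le> (\<integral>y. \<bar>K\<bar> * B \<partial>lborel_on A)"
    proof (rule integral_mono_AE)
      show "integrable (lborel_on A) (\<lambda>y. \<bar>u y * C (grid_round n x - grid_round n y)\<bar>)"
        using bound[OF x] by (intro integrable_lborel_on[OF A]) auto
    qed (use bound[OF x] AE_lborel_on[of A] in auto)
    also have "\<dots> = \<bar>K\<bar> * B * measure (lborel_on A) UNIV"
      by (simp add: lborel_on_def)
    finally show ?thesis by simp
  qed
  have inner: "(\<lambda>n. J n x) \<longlonglongrightarrow> (\<integral>y. u y * C (x - y) \<partial>lborel_on A)" if x: "x \<in> A" for x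
    unfolding J_def
  proof (rule integral_dominated_convergence[where w="\<lambda>_. \<bar>K\<bar> * B"])
    have "(\<lambda>n. C (grid_round n x - grid_round n y)) \<longlonglongrightarrow> C (x - y)" for y
      using C by (intro isCont_tendsto_compose[of _ C] tendsto_diff grid_round_tendsto)
        (auto simp: continuous_on_eq_continuous_at)
    then show "AE y in lborel_on A. (\<lambda>n. u y * C (grid_round n x - grid_round n y)) \<longlonglongrightarrow> u y * C (x - y)"
      by (intro AE_I2 tendsto_mult_left)
    show "AE y in lborel_on A. norm (u y * C (grid_round n x - grid_round n y)) \<le> \<bar>K\<bar> * B" for n
      using bound[OF x] AE_lborel_on[of A] by auto
  qed simp_all
  have "(\<lambda>n. \<integral>x. u x * J n x \<partial>lborel_on A) \<longlonglongrightarrow> (\<integral>x. u x * (\<integral>y. u y * C (x - y) \<partial>lborel_on A) \<partial>lborel_on A)"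
  proof (rule integral_dominated_convergence[where w="\<lambda>_. \<bar>K\<bar> * (\<bar>K\<bar> * B * measure (lborel_on A) UNIV)"])
    show "AE x in lborel_on A. (\<lambda>n. u x * J n x) \<longlonglongrightarrow> u x * (\<integral>y. u y * C (x - y) \<partial>lborel_on A)"
    proof -
      have "AE x in lborel_on A. x \<in> A"
        by (rule AE_lborel_on) simp
      then show ?thesis
        by eventually_elim (intro tendsto_mult_left inner)
    qed
    have "\<bar>u x * J n x\<bar> \<le> \<bar>K\<bar> * (\<bar>K\<bar> * B * measure (lborel_on A) UNIV)" if "x \<in> A" for n x
      using u[OF that] Jb[OF that] unfolding abs_mult by (intro mult_mono) auto
    then show "AE x in lborel_on A. norm (u x * J n x) \<le> \<bar>K\<bar> * (\<bar>K\<bar> * B * measure (lborel_on A) UNIV)" for n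
      using AE_lborel_on[of A] by auto
  qed simp_all
  then show ?thesis
    by (simp add: J_def)
qed

text \<open>The same cell weights \<open>a n\<close> occur in the sum \<open>X n\<close> and in its
  variance \<open>V n\<close>, so \<open>V n\<close> is exactly the double integral with both
  arguments of \<open>C\<close> rounded. Path by path \<open>X n\<close> tends to \<open>G\<close>,
  and dominated convergence with the bound 1 on the exponential carries this to the expectations
  without any moment estimate for \<open>G\<close>.\<close>

lemma gaussian_field_integral_char:
  fixes u C :: "real^2 \<Rightarrow> real"
  assumes M: "prob_space M" and N: "gaussian_field M N"
    and mean: "\<And>x. (LINT w|M. N w x) = 0"
    and cov: "\<And>x y. (LINT w|M. N w x * N w y) = C (x - y)"
    and paths: "AE w in M. continuous_on UNIV (N w)"
    and A: "compact A" and C: "continuous_on UNIV C"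
    and um [measurable]: "u \<in> borel_measurable borel" and [measurable]: "G \<in> borel_measurable M"
    and u: "\<And>x. x \<in> A \<Longrightarrow> \<bar>u x\<bar> \<le> K"
    and G: "AE w in M. G w = (\<integral>x. u x * N w x \<partial>lborel_on A)"
  shows "(CLINT w|M. iexp (G w)) =
    exp (- (\<integral>x. u x * (\<integral>y. u y * C (x - y) \<partial>lborel_on A) \<partial>lborel_on A) / 2)"
proof -
  interpret prob_space M by fact
  interpret L: finite_measure "lborel_on A"
    using A by (rule finite_measure_lborel_on)
  define I where "I n = grid_round n ` A" for n
  have I: "finite (I n)" for n
    unfolding I_def using A by (intro finite_grid_round_image compact_imp_bounded)
  define a where "a n p = (\<integral>x. u x * indicator {p} (grid_round n x) \<partial>lborel_on A)" for n p
  define X where "X n w = (\<Sum>p\<in>I n. a n p * N w p)" for n w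
  define V where "V n = (\<Sum>p\<in>I n. \<Sum>q\<in>I n. a n p * a n q * C (p - q))" for n
  have sum_eq: "(\<integral>x. u x * g (grid_round n x) \<partial>lborel_on A) = (\<Sum>p\<in>I n. a n p * g p)"
    if "g \<in> borel_measurable borel" for g n
    unfolding a_def I_def by (rule integral_grid_round[OF A um that u])
  have [measurable]: "C \<in> borel_measurable borel"
    using C by (simp add: borel_measurable_continuous_onI)
  have [measurable]: "X n \<in> borel_measurable M" for n
    unfolding X_def by (rule gaussian_field_sum_char(1)[OF M N mean cov I])
  have char: "(CLINT w|M. iexp (X n w)) = exp (- V n / 2)" for n
    unfolding X_def V_def by (rule gaussian_field_sum_char(2)[OF M N mean cov I])
  have "V = (\<lambda>n. \<integral>x. u x * (\<integral>y. u y * C (grid_round n x - grid_round n y) \<partial>lborel_on A) \<partial>lborel_on A)"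
  proof
    fix n
    \<comment> \<open>\<open>sum_eq\<close> is applied twice: to the sections of \<open>C\<close> in
      the inner variable, then to the inner integral as a function of the outer grid point.\<close>
    have "(\<integral>y. u y * C (p - grid_round n y) \<partial>lborel_on A) = (\<Sum>q\<in>I n. a n q * C (p - q))" for p
      by (rule sum_eq[of "\<lambda>q. C (p - q)" n]) measurable
    moreover have "(\<integral>x. u x * (\<lambda>p. \<integral>y. u y * C (p - grid_round n y) \<partial>lborel_on A) (grid_round n x) \<partial>lborel_on A)
      = (\<Sum>p\<in>I n. a n p * (\<integral>y. u y * C (p - grid_round n y) \<partial>lborel_on A))"
      by (rule sum_eq) measurable
    ultimately show "V n = (\<integral>x. u x * (\<integral>y. u y * C (grid_round n x - grid_round n y) \<partial>lborel_on A) \<partial>lborel_on A)"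
      by (simp add: V_def sum_distrib_left mult.assoc)
  qed
  then have V: "V \<longlonglongrightarrow> (\<integral>x. u x * (\<integral>y. u y * C (x - y) \<partial>lborel_on A) \<partial>lborel_on A)"
    using grid_round_double_integral_tendsto[of A C u K] A C u by simp
  have "AE w in M. (\<lambda>n. X n w) \<longlonglongrightarrow> G w"
    using paths G
  proof eventually_elim
    case (elim w)
    then have "X n w = (\<integral>x. u x * N w (grid_round n x) \<partial>lborel_on A)" for n
      unfolding X_def by (intro sum_eq[symmetric]) (simp_all add: borel_measurable_continuous_onI)
    then show ?case
      using grid_round_integral_tendsto[of A "N w" u K] A u elim by simp
  qed
  then have "(\<lambda>n. CLINT w|M. iexp (X n w)) \<longlonglongrightarrow> (CLINT w|M. iexp (G w))"
    by (intro integral_dominated_convergence[where w="\<lambda>_. 1"]) (auto intro!: tendsto_intros elim: eventually_mono)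
  moreover have "(\<lambda>n. CLINT w|M. iexp (X n w)) \<longlonglongrightarrow>
      of_real (exp (- (\<integral>x. u x * (\<integral>y. u y * C (x - y) \<partial>lborel_on A) \<partial>lborel_on A) / 2))"
    unfolding char using V by (intro tendsto_intros) simp_all
  ultimately show ?thesis
    by (rule LIMSEQ_unique)
qed

section \<open>The noise covariance as a Gram kernel\<close>

text \<open>A bounded kernel reduces integrability on the product to that of
  \<open>u x * w q\<close>. The version with one weight on each side serves the two exchanges in the
  Gram identity and the later test against s^2.\<close>

lemma Fubini_weighted_kernel:
  fixes k :: "'a \<Rightarrow> 'b \<Rightarrow> real"
  assumes M: "finite_measure M" and Q: "finite_measure Q"
    and u: "integrable M u" and w: "integrable Q w"
    and [measurable]: "case_prod k \<in> borel_measurable (M \<Otimes>\<^sub>M Q)" and k: "\<And>x q. \<bar>k x q\<bar> \<le> B"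
  shows "(\<integral>q. w q * (\<integral>x. u x * k x q \<partial>M) \<partial>Q) = (\<integral>x. u x * (\<integral>q. w q * k x q \<partial>Q) \<partial>M)"
proof -
  interpret M: finite_measure M by fact
  interpret Q: finite_measure Q by fact
  interpret pair_sigma_finite M Q ..
  have [measurable]: "u \<in> borel_measurable M" "w \<in> borel_measurable Q"
    using u w by auto
  have uw: "integrable (M \<Otimes>\<^sub>M Q) (\<lambda>(x, q). u x * w q)"
  proof (rule Fubini_integrable)
    show "integrable M (\<lambda>x. \<integral>q. norm (case (x, q) of (x, q) \<Rightarrow> u x * w q) \<partial>Q)"
      using u by (simp add: abs_mult)
    show "AE x in M. integrable Q (\<lambda>q. case (x, q) of (x, q) \<Rightarrow> u x * w q)"
      using w by simp
  qed measurable
  have "integrable (M \<Otimes>\<^sub>M Q) (\<lambda>(x, q). w q * (u x * k x q))"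
  proof (rule Bochner_Integration.integrable_bound)
    show "integrable (M \<Otimes>\<^sub>M Q) (\<lambda>p. B * (case p of (x, q) \<Rightarrow> u x * w q))"
      using uw by (rule integrable_mult_right)
    have "\<bar>w q * (u x * k x q)\<bar> \<le> \<bar>B * (u x * w q)\<bar>" for x q
    proof -
      have "\<bar>u x * w q\<bar> * \<bar>k x q\<bar> \<le> \<bar>u x * w q\<bar> * \<bar>B\<bar>"
        using k[of x q] by (intro mult_left_mono) auto
      then show ?thesis by (simp add: abs_mult mult_ac)
    qed
    then show "AE p in M \<Otimes>\<^sub>M Q. norm (case p of (x, q) \<Rightarrow> w q * (u x * k x q)) \<le> norm (B * (case p of (x, q) \<Rightarrow> u x * w q))"
      by auto
  qed measurable
  from Fubini_integral[OF this]
  have "(\<integral>q. (\<integral>x. w q * (u x * k x q) \<partial>M) \<partial>Q) = (\<integral>x. (\<integral>q. w q * (u x * k x q) \<partial>Q) \<partial>M)" .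
  also have "(\<integral>x. (\<integral>q. w q * (u x * k x q) \<partial>Q) \<partial>M) = (\<integral>x. u x * (\<integral>q. w q * k x q \<partial>Q) \<partial>M)"
    by (simp add: mult.left_commute[of "w _"])
  finally show ?thesis by simp
qed

lemma kernel_integral_bounded:
  fixes k :: "'a \<Rightarrow> 'b \<Rightarrow> real"
  assumes u: "integrable M u" and k: "\<And>x q. \<bar>k x q\<bar> \<le> B"
    and [measurable]: "(\<lambda>x. k x q) \<in> borel_measurable M"
  shows "\<bar>\<integral>x. u x * k x q \<partial>M\<bar> \<le> B * (\<integral>x. \<bar>u x\<bar> \<partial>M)"
proof -
  have [measurable]: "u \<in> borel_measurable M"
    using u by auto
  have b: "\<bar>u x * k x q\<bar> \<le> B * \<bar>u x\<bar>" for x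
    using mult_left_mono[OF k[of x q], of "\<bar>u x\<bar>"] by (simp add: abs_mult mult.commute)
  have "\<bar>\<integral>x. u x * k x q \<partial>M\<bar> \<le> (\<integral>x. \<bar>u x * k x q\<bar> \<partial>M)"
    using integral_norm_bound[of M "\<lambda>x. u x * k x q"] by simp
  also have "\<dots> \<le> (\<integral>x. B * \<bar>u x\<bar> \<partial>M)"
  proof (rule integral_mono)
    show "integrable M (\<lambda>x. \<bar>u x * k x q\<bar>)"
    proof (rule Bochner_Integration.integrable_bound)
      show "integrable M (\<lambda>x. B * \<bar>u x\<bar>)"
        using u by simp
      have "norm \<bar>u x * k x q\<bar> \<le> norm (B * \<bar>u x\<bar>)" for x
        unfolding real_norm_def abs_abs using b[of x] abs_ge_self[of "B * \<bar>u x\<bar>"] by linarith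
      then show "AE x in M. norm \<bar>u x * k x q\<bar> \<le> norm (B * \<bar>u x\<bar>)"
        by (rule AE_I2)
    qed measurable
  qed (use u b in simp_all)
  finally show ?thesis by simp
qed

text \<open>Two exchanges of integrals. In the first the weight on \<open>Q\<close> is the transform
  of \<open>u'\<close>, which is bounded and hence integrable; in the second it is the section of
  the kernel at a fixed \<open>x\<close>.\<close>

lemma gram_integral:
  fixes k :: "'a \<Rightarrow> 'b \<Rightarrow> real"
  assumes M: "finite_measure M" and Q: "finite_measure Q"
    and u: "integrable M u" and u': "integrable M u'"
    and km [measurable]: "case_prod k \<in> borel_measurable (M \<Otimes>\<^sub>M Q)" and k: "\<And>x q. \<bar>k x q\<bar> \<le> B"
  shows "(\<integral>x. u x * (\<integral>y. u' y * (\<integral>q. k x q * k y q \<partial>Q) \<partial>M) \<partial>M) =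
    (\<integral>q. (\<integral>x. u x * k x q \<partial>M) * (\<integral>x. u' x * k x q \<partial>M) \<partial>Q)"
proof -
  interpret M: finite_measure M by fact
  interpret Q: finite_measure Q by fact
  interpret pair_sigma_finite M Q ..
  have [measurable]: "u \<in> borel_measurable M" "u' \<in> borel_measurable M"
    using u u' by auto
  have sec [measurable]: "(\<lambda>q. k x q) \<in> borel_measurable Q" if "x \<in> space M" for x
    using that by measurable
  have sec' [measurable]: "(\<lambda>x. k x q) \<in> borel_measurable M" if "q \<in> space Q" for q
    using that by measurable
  have J [measurable]: "(\<lambda>q. \<integral>x. u' x * k x q \<partial>M) \<in> borel_measurable Q"
    by measurable
  have "\<bar>\<integral>x. u' x * k x q \<partial>M\<bar> \<le> B * (\<integral>x. \<bar>u' x\<bar> \<partial>M)" if "q \<in> space Q" for q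
    by (rule kernel_integral_bounded[OF u']) (use k sec' that in auto)
  then have Jint: "integrable Q (\<lambda>q. \<integral>x. u' x * k x q \<partial>M)"
    by (intro Q.integrable_const_bound[of _ "B * (\<integral>x. \<bar>u' x\<bar> \<partial>M)"]) auto
  have kint: "integrable Q (\<lambda>q. k x q)" if "x \<in> space M" for x
    using k that by (intro Q.integrable_const_bound[of _ B]) auto
  have "(\<integral>q. (\<integral>x. u x * k x q \<partial>M) * (\<integral>x. u' x * k x q \<partial>M) \<partial>Q)
      = (\<integral>q. (\<integral>x. u' x * k x q \<partial>M) * (\<integral>x. u x * k x q \<partial>M) \<partial>Q)"
    by (simp add: mult.commute)
  also have "\<dots> = (\<integral>x. u x * (\<integral>q. (\<integral>y. u' y * k y q \<partial>M) * k x q \<partial>Q) \<partial>M)"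
    by (rule Fubini_weighted_kernel[OF M Q u Jint km k])
  also have "\<dots> = (\<integral>x. u x * (\<integral>y. u' y * (\<integral>q. k x q * k y q \<partial>Q) \<partial>M) \<partial>M)"
  proof (rule Bochner_Integration.integral_cong)
    fix x assume x: "x \<in> space M"
    have "(\<integral>q. (\<integral>y. u' y * k y q \<partial>M) * k x q \<partial>Q) = (\<integral>q. k x q * (\<integral>y. u' y * k y q \<partial>M) \<partial>Q)"
      by (simp add: mult.commute)
    also have "\<dots> = (\<integral>y. u' y * (\<integral>q. k x q * k y q \<partial>Q) \<partial>M)"
      by (rule Fubini_weighted_kernel[OF M Q u' kint[OF x] km k])
    finally show "u x * (\<integral>q. (\<integral>y. u' y * k y q \<partial>M) * k x q \<partial>Q) = u x * (\<integral>y. u' y * (\<integral>q. k x q * k y q \<partial>Q) \<partial>M)"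
      by simp
  qed simp
  finally show ?thesis ..
qed

section \<open>Directions, the noise amplitude, and continuity of the covariance\<close>

lemma dirvec_inner: "dirvec a \<bullet> x = cos a * x $ 1 + sin a * x $ 2"
  by (simp add: dirvec_def vec2_inner)

lemma norm_dirvec: "norm (dirvec a) = 1"
  by (simp add: norm_eq_sqrt_inner dirvec_inner) (simp add: dirvec_def power2_eq_square[symmetric])

lemma abs_dirvec_inner_le: "\<bar>dirvec a \<bullet> x\<bar> \<le> norm x"
  using Cauchy_Schwarz_ineq2[of "dirvec a" x] by (simp add: norm_dirvec)

lemma dirvec_inner_continuous [continuous_intros]:
  fixes S :: "'a::t2_space set"
  shows "continuous_on S f \<Longrightarrow> continuous_on S g \<Longrightarrow> continuous_on S (\<lambda>z. dirvec (f z) \<bullet> g z)"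
  unfolding dirvec_inner by (intro continuous_intros)

lemma dirvec_inner_measurable [measurable (raw)]:
  assumes [measurable]: "f \<in> borel_measurable M" and g: "g \<in> borel_measurable M"
  shows "(\<lambda>z. dirvec (f z) \<bullet> g z) \<in> borel_measurable M"
proof -
  have [measurable]: "(\<lambda>z. g z $ i) \<in> borel_measurable M" for i
    by (rule measurable_compose[OF g borel_measurable_vec_nth])
  show ?thesis
    unfolding dirvec_inner by measurable
qed

text \<open>Regularity of \<open>\<sigma>\<close> is given for angles in [- pi, pi], while the
  covariance integrates over [0, 2 pi]. On the second half evenness shifts the angle back by pi and
  flips the offset; both pieces agree at pi. The bound on \<open>x0\<close> keeps the offset within
  [- P, P].\<close>

lemma noise_amplitude_continuous:
  assumes C1: "Ck_on 1 ({-pi..pi} \<times> {-P..P}) (\<lambda>(a, p). \<sigma> a p)"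
    and even: "\<And>a p. p \<in> {-P..P} \<Longrightarrow> \<sigma> a p = \<sigma> (a + pi) (- p)"
    and x0: "norm x0 < P"
  shows "continuous_on {0..2*pi} (\<lambda>a. \<sigma> a (dirvec a \<bullet> x0))"
proof -
  have c: "continuous_on ({-pi..pi} \<times> {-P..P}) (\<lambda>(a, p). \<sigma> a p)"
    using C1 unfolding One_nat_def by (auto intro: has_derivative_continuous_on)
  have P: "- P \<le> dirvec a \<bullet> x0" "dirvec a \<bullet> x0 \<le> P" for a
    using abs_dirvec_inner_le[of a x0] x0 by linarith+
  have "continuous_on {0..pi} (\<lambda>a. (\<lambda>(a, p). \<sigma> a p) (a, dirvec a \<bullet> x0))"
  proof (rule continuous_on_compose2[OF c])
    show "(\<lambda>a. (a, dirvec a \<bullet> x0)) ` {0..pi} \<subseteq> {-pi..pi} \<times> {-P..P}"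
      using P order_trans[of "- pi" 0] by auto
  qed (intro continuous_intros)
  then have 1: "continuous_on {0..pi} (\<lambda>a. \<sigma> a (dirvec a \<bullet> x0))" by simp
  have "continuous_on {pi..2*pi} (\<lambda>a. (\<lambda>(a, p). \<sigma> a p) (a - pi, - (dirvec a \<bullet> x0)))"
  proof (rule continuous_on_compose2[OF c])
    show "(\<lambda>a. (a - pi, - (dirvec a \<bullet> x0))) ` {pi..2*pi} \<subseteq> {-pi..pi} \<times> {-P..P}"
      using P pi_ge_zero by (auto simp: minus_le_iff)
  qed (intro continuous_intros)
  then have "continuous_on {pi..2*pi} (\<lambda>a. \<sigma> (a - pi) (- (dirvec a \<bullet> x0)))" by simp
  moreover have "\<sigma> (a - pi) (- (dirvec a \<bullet> x0)) = \<sigma> a (dirvec a \<bullet> x0)" for a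
    using even[of "- (dirvec a \<bullet> x0)" "a - pi"] P[of a] by simp
  ultimately have 2: "continuous_on {pi..2*pi} (\<lambda>a. \<sigma> a (dirvec a \<bullet> x0))" by simp
  have "{0..2*pi} = {0..pi} \<union> {pi..2*pi}" by auto
  then show ?thesis
    using continuous_on_closed_Un[OF _ _ 1 2] by simp
qed

text \<open>\<open>\<eta>\<close> is the amplitude along the projections of \<open>x0\<close>, the
  only way in which \<open>\<sigma>\<close> and \<open>x0\<close> enter the covariance; the lemmas
  below are phrased in terms of it. Continuity comes from dominated convergence, with a bound on the
  compactly supported autocorrelation.\<close>

lemma noise_cov_continuous:
  assumes \<eta>: "\<And>a. \<sigma> a (dirvec a \<bullet> x0) = \<eta> a" and h: "continuous_on {0..2*pi} \<eta>"
    and cont: "continuous_on UNIV (deriv \<phi>)" and T: "\<And>t. \<bar>t\<bar> \<ge> T \<Longrightarrow> deriv \<phi> t = 0"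
  shows "continuous_on UNIV (noise_cov \<kappa> \<sigma> \<phi> x0)"
proof -
  define h2 where "h2 a = indicator {0..2*pi} a *\<^sub>R (\<eta> a)\<^sup>2" for a
  define cc where "cc = crosscorr (deriv \<phi>) (deriv \<phi>)"
  have cc: "continuous_on UNIV cc"
    unfolding cc_def by (rule crosscorr_continuous[OF cont T])
  have cc0: "cc t = 0" if "\<bar>t\<bar> \<ge> 2 * T" for t
  proof -
    have "deriv \<phi> (t + s) * deriv \<phi> s = 0" for s
      using T[of s] T[of "t + s"] that by (cases "\<bar>s\<bar> \<ge> T") auto
    then show ?thesis by (simp only: cc_def crosscorr_def) simp
  qed
  obtain B where B: "B > 0" "\<And>t. \<bar>cc t\<bar> \<le> B"
    using compact_support_bounded[OF cc cc0] by blast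
  have h2: "integrable lborel h2"
    unfolding h2_def by (rule borel_integrable_compact) (auto intro!: continuous_intros h)
  then have [measurable]: "h2 \<in> borel_measurable borel" by auto
  have [measurable]: "cc \<in> borel_measurable borel"
    using cc by (rule borel_measurable_continuous_onI)
  have eq: "noise_cov \<kappa> \<sigma> \<phi> x0 x = (\<kappa> / (4 * pi))\<^sup>2 * (\<integral>a. h2 a * cc (dirvec a \<bullet> x) \<partial>lborel)" for x
    by (simp add: noise_cov_def \<eta> set_lebesgue_integral_def h2_def cc_def mult.assoc)
  have "(\<lambda>i. \<integral>a. h2 a * cc (dirvec a \<bullet> x i) \<partial>lborel) \<longlonglongrightarrow> (\<integral>a. h2 a * cc (dirvec a \<bullet> y) \<partial>lborel)"
    if x: "x \<longlonglongrightarrow> y" for x y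
  proof (rule integral_dominated_convergence[where w="\<lambda>a. B * \<bar>h2 a\<bar>"])
    show "integrable lborel (\<lambda>a. B * \<bar>h2 a\<bar>)"
      using h2 by simp
    have "(\<lambda>i. cc (dirvec a \<bullet> x i)) \<longlonglongrightarrow> cc (dirvec a \<bullet> y)" for a
      using cc x by (intro isCont_tendsto_compose[of _ cc] tendsto_intros)
        (auto simp: continuous_on_eq_continuous_at)
    then show "AE a in lborel. (\<lambda>i. h2 a * cc (dirvec a \<bullet> x i)) \<longlonglongrightarrow> h2 a * cc (dirvec a \<bullet> y)"
      by (intro AE_I2 tendsto_mult_left)
    show "AE a in lborel. norm (h2 a * cc (dirvec a \<bullet> x i)) \<le> B * \<bar>h2 a\<bar>" for i
      using B by (auto simp: abs_mult mult.commute[of B] intro!: mult_left_mono)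
  qed simp_all
  then show ?thesis
    unfolding continuous_on_sequentially comp_def eq by (auto intro!: tendsto_mult_left)
qed

text \<open>A square root of the noise covariance as an integral operator, in the direction \<open>fst q\<close>
  and the offset \<open>snd q\<close>.\<close>

definition noise_kernel :: "(real \<Rightarrow> real) \<Rightarrow> (real \<Rightarrow> real) \<Rightarrow> real^2 \<Rightarrow> real \<times> real \<Rightarrow> real" where
  "noise_kernel \<eta> \<phi> x q = indicator {0..2*pi} (fst q) *\<^sub>R \<eta> (fst q) *
     deriv \<phi> (dirvec (fst q) \<bullet> x + snd q)"

lemma noise_kernel_measurable:
  assumes h: "continuous_on {0..2*pi} \<eta>" and cont: "continuous_on UNIV (deriv \<phi>)"
  shows "(\<lambda>(x, q). noise_kernel \<eta> \<phi> x q) \<in> borel_measurable (borel \<Otimes>\<^sub>M borel)"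
proof -
  have [measurable]: "(\<lambda>a. indicator {0..2*pi} a *\<^sub>R \<eta> a) \<in> borel_measurable borel"
    using h by (intro borel_measurable_continuous_on_indicator) auto
  have [measurable]: "deriv \<phi> \<in> borel_measurable borel"
    using cont by (rule borel_measurable_continuous_onI)
  have [measurable]: "fst \<in> (borel :: (real \<times> real) measure) \<rightarrow>\<^sub>M borel" "snd \<in> (borel :: (real \<times> real) measure) \<rightarrow>\<^sub>M borel"
    unfolding borel_prod[symmetric] by measurable
  show ?thesis
    unfolding noise_kernel_def by measurable
qed

lemma noise_kernel_bounded:
  assumes h: "continuous_on {0..2*pi} \<eta>"
    and cont: "continuous_on UNIV (deriv \<phi>)" and T: "\<And>t. \<bar>t\<bar> \<ge> T \<Longrightarrow> deriv \<phi> t = 0"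
  obtains B where "\<And>x q. \<bar>noise_kernel \<eta> \<phi> x q\<bar> \<le> B"
proof -
  obtain B1 where B1: "B1 > 0" "\<And>t. \<bar>deriv \<phi> t\<bar> \<le> B1"
    using compact_support_bounded[OF cont T] by blast
  have "bounded (\<eta> ` {0..2*pi})"
    by (intro compact_imp_bounded compact_continuous_image h) auto
  then obtain B2 where B2: "B2 > 0" "\<And>a. a \<in> {0..2*pi} \<Longrightarrow> \<bar>\<eta> a\<bar> \<le> B2"
    unfolding bounded_pos by auto
  have "\<bar>noise_kernel \<eta> \<phi> x q\<bar> \<le> B2 * B1" for x q
    unfolding noise_kernel_def abs_mult using B1 B2 by (intro mult_mono) (auto split: split_indicator)
  then show ?thesis by (rule that)
qed

text \<open>Translating the variable of the correlation by \<open>dirvec a \<bullet> y\<close>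
  separates the difference \<open>x - y\<close> into one factor for \<open>x\<close> and one for
  \<open>y\<close>. For points of the disk the offsets outside [- S, S] contribute nothing, because
  \<open>S \<ge> T + \<rho>\<close>; a finite measure in \<open>q\<close> suffices.\<close>

lemma noise_cov_gram:
  assumes h: "continuous_on {0..2*pi} \<eta>"
    and cont: "continuous_on UNIV (deriv \<phi>)" and T: "\<And>t. \<bar>t\<bar> \<ge> T \<Longrightarrow> deriv \<phi> t = 0"
    and \<eta>: "\<And>a. \<sigma> a (dirvec a \<bullet> x0) = \<eta> a" and xy: "norm x \<le> \<rho>" "norm y \<le> \<rho>" and S: "S \<ge> T + \<rho>"
  shows "noise_cov \<kappa> \<sigma> \<phi> x0 (x - y) = (\<kappa> / (4 * pi))\<^sup>2 *
    (\<integral>q. noise_kernel \<eta> \<phi> x q * noise_kernel \<eta> \<phi> y q \<partial>lborel_on ({0..2*pi} \<times> {-S..S}))"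
proof -
  let ?k = "noise_kernel \<eta> \<phi>"
  let ?Q = "{0..2*pi} \<times> {-S..S}"
  have comp: "compact ?Q"
    by (intro compact_Times) auto
  have Qm [measurable]: "?Q \<in> sets borel"
    using comp by (rule borel_compact)
  note [measurable] = noise_kernel_measurable[OF h cont]
  obtain B where B: "\<And>x q. \<bar>?k x q\<bar> \<le> B"
    using noise_kernel_bounded[OF h cont T] by blast
  have kb: "\<bar>?k x q * ?k y q\<bar> \<le> B * B" for q
    using B[of x q] B[of y q] unfolding abs_mult by (intro mult_mono) auto
  have km [measurable]: "(\<lambda>q. ?k x q * ?k y q) \<in> borel_measurable borel"
    by measurable
  have "integrable (lborel_on ?Q) (\<lambda>q. ?k x q * ?k y q)"
    using kb by (intro integrable_lborel_on[OF comp km]) auto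
  then have int: "integrable lborel (\<lambda>q. indicator ?Q q *\<^sub>R (?k x q * ?k y q))"
    unfolding lborel_on_def by (subst (asm) integrable_density) simp_all
  have dphi: "deriv \<phi> (dirvec a \<bullet> x + s) * deriv \<phi> (dirvec a \<bullet> y + s) = 0" if "s \<notin> {-S..S}" for a s
  proof -
    have "\<bar>dirvec a \<bullet> x\<bar> \<le> \<rho>"
      using abs_dirvec_inner_le[of a x] xy by linarith
    then have "\<bar>dirvec a \<bullet> x + s\<bar> \<ge> T"
      using that S by auto
    then show ?thesis by (simp add: T)
  qed
  have inner: "(\<integral>s. indicator ?Q (a, s) *\<^sub>R (?k x (a, s) * ?k y (a, s)) \<partial>lborel)
     = indicator {0..2*pi} a *\<^sub>R ((\<eta> a)\<^sup>2 * crosscorr (deriv \<phi>) (deriv \<phi>) (dirvec a \<bullet> (x - y)))" for a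
  proof -
    have "crosscorr (deriv \<phi>) (deriv \<phi>) (dirvec a \<bullet> (x - y))
       = (\<integral>s. deriv \<phi> (dirvec a \<bullet> x + s) * deriv \<phi> (dirvec a \<bullet> y + s) \<partial>lborel)"
      unfolding crosscorr_def
      by (subst lborel_integral_real_affine[where c=1 and t="dirvec a \<bullet> y"]) (simp_all add: inner_diff_right)
    moreover have "indicator ?Q (a, s) *\<^sub>R (?k x (a, s) * ?k y (a, s)) = indicator {0..2*pi} a * (\<eta> a)\<^sup>2 *
        (deriv \<phi> (dirvec a \<bullet> x + s) * deriv \<phi> (dirvec a \<bullet> y + s))" for s
      using dphi[of s a] by (cases "s \<in> {-S..S}") (auto simp: noise_kernel_def indicator_def power2_eq_square)
    ultimately show ?thesis by simp
  qed
  have "(\<integral>q. ?k x q * ?k y q \<partial>lborel_on ?Q) = (\<integral>q. indicator ?Q q *\<^sub>R (?k x q * ?k y q) \<partial>lborel)"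
    by (subst integral_lborel_on[OF km Qm]) (simp add: set_lebesgue_integral_def)
  also have "\<dots> = (\<integral>q. indicator ?Q q *\<^sub>R (?k x q * ?k y q) \<partial>(lborel \<Otimes>\<^sub>M lborel))"
    by (simp add: lborel_prod)
  also have "\<dots> = (\<integral>a. (\<integral>s. indicator ?Q (a, s) *\<^sub>R (?k x (a, s) * ?k y (a, s)) \<partial>lborel) \<partial>lborel)"
    by (rule lborel_pair.integral_fst'[symmetric]) (use int in \<open>simp add: lborel_prod\<close>)
  finally show ?thesis
    unfolding noise_cov_def \<eta> set_lebesgue_integral_def inner by simp
qed

section \<open>Strict positivity of the covariance matrix\<close>

lemma perp_eq_matrix: "perp = (*v) (vector [vector [0, - 1], vector [1, 0]])"
  by (simp add: fun_eq_iff perp_def vec_eq_iff forall_2 matrix_vector_mult_def sum_2)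

lemma borel_measurable_perp [measurable]: "perp \<in> borel_measurable borel"
  unfolding perp_eq_matrix by (rule borel_measurable_matrix_vector_mult)

lemma lborel_distr_perp: "distr lborel borel perp = lborel"
proof (rule measure_eqI)
  define R :: "real^2^2" where "R = vector [vector [0, - 1], vector [1, 0]]"
  have R: "perp x = R *v x" for x
    by (simp add: perp_eq_matrix R_def)
  have RR: "transpose R ** R = mat 1"
    by (simp add: R_def vec_eq_iff forall_2 matrix_matrix_mult_def transpose_def sum_2 mat_def)
  have det: "det R = 1"
    by (simp add: R_def det_2)
  fix X :: "(real^2) set" assume "X \<in> sets (distr lborel borel perp)"
  then have [measurable]: "X \<in> sets borel" by simp
  have "emeasure lborel X = (\<integral>\<^sup>+x. indicator X x \<partial>lborel)"
    by simp
  also have "\<dots> = (\<integral>\<^sup>+x. indicator X (perp x) \<partial>lborel)"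
    by (subst nn_integral_lborel_linear[OF _ RR]) (simp_all add: det R)
  also have "\<dots> = emeasure (distr lborel borel perp) X"
    by (subst nn_integral_distr[of perp lborel borel, symmetric]) simp_all
  finally show "emeasure (distr lborel borel perp) X = emeasure lborel X" ..
qed simp

text \<open>Invariance under the quarter turn is the only symmetry of the disk that the moment
  identities use.\<close>

lemma integral_cball_perp:
  fixes f :: "real^2 \<Rightarrow> real"
  assumes [measurable]: "f \<in> borel_measurable borel"
  shows "(\<integral>x. f (perp x) \<partial>lborel_on (cball 0 \<rho>)) = (\<integral>x. f x \<partial>lborel_on (cball 0 \<rho>))"
proof -
  have [measurable]: "cball (0::real^2) \<rho> \<in> sets borel" by simp
  have "norm (perp x) = norm x" for x
    by (simp add: norm_eq_sqrt_inner vec2_inner perp_def)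
  then have ind: "indicator (cball 0 \<rho>) (perp x) = (indicator (cball 0 \<rho>) x :: real)" for x
    by (simp add: indicator_def)
  have "(\<integral>x. f x \<partial>lborel_on (cball 0 \<rho>)) = (\<integral>x. indicator (cball 0 \<rho>) x *\<^sub>R f x \<partial>distr lborel borel perp)"
    by (simp add: integral_lborel_on set_lebesgue_integral_def lborel_distr_perp)
  also have "\<dots> = (\<integral>x. indicator (cball 0 \<rho>) (perp x) *\<^sub>R f (perp x) \<partial>lborel)"
    by (rule integral_distr) measurable
  also have "\<dots> = (\<integral>x. f (perp x) \<partial>lborel_on (cball 0 \<rho>))"
    unfolding ind by (simp add: integral_lborel_on set_lebesgue_integral_def)
  finally show ?thesis ..
qed

lemma integrable_cball_continuous:
  fixes f :: "'a::euclidean_space \<Rightarrow> 'b::{banach, second_countable_topology}"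
  assumes f: "continuous_on UNIV f"
  shows "integrable (lborel_on (cball 0 \<rho>)) f"
proof -
  have "bounded (f ` cball 0 \<rho>)"
    by (intro compact_imp_bounded compact_continuous_image continuous_on_subset[OF f]) auto
  then obtain B where "\<forall>y\<in>f ` cball 0 \<rho>. norm y \<le> B"
    unfolding bounded_iff by blast
  then show ?thesis
    using f by (intro integrable_lborel_on[of _ _ B]) (simp_all add: borel_measurable_continuous_onI)
qed

text \<open>The quarter turn sends the coordinates (x1, x2) to (- x2, x1). It gives two relations
  between the first moments that force both to be zero, kills the mixed second moment, and equates
  the pure ones, so the second moment matrix is a multiple of the identity.\<close>

lemma cball_moments:
  fixes v w :: "real^2"
  shows "(\<integral>x. v \<bullet> x \<partial>lborel_on (cball 0 \<rho>)) = 0"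
    "(\<integral>x. (v \<bullet> x) * (w \<bullet> x) \<partial>lborel_on (cball 0 \<rho>)) = (v \<bullet> w) * (\<integral>x. (x $ 1)\<^sup>2 \<partial>lborel_on (cball (0::real^2) \<rho>))"
proof -
  let ?L = "lborel_on (cball 0 \<rho>) :: (real^2) measure"
  have [simp]: "integrable ?L (\<lambda>x. x $ i)" "integrable ?L (\<lambda>x. x $ i * x $ j)" for i j
    by (intro integrable_cball_continuous continuous_intros)+
  have 1: "(\<integral>x. x $ 1 \<partial>?L) = - (\<integral>x. x $ 2 \<partial>?L)" "(\<integral>x. x $ 2 \<partial>?L) = (\<integral>x. x $ 1 \<partial>?L)"
    using integral_cball_perp[of "\<lambda>x. x $ 1" \<rho>] integral_cball_perp[of "\<lambda>x. x $ 2" \<rho>]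
    by (simp_all add: perp_def)
  have 2: "(\<integral>x. x $ 1 * x $ 2 \<partial>?L) = 0" "(\<integral>x. x $ 2 * x $ 2 \<partial>?L) = (\<integral>x. x $ 1 * x $ 1 \<partial>?L)"
    using integral_cball_perp[of "\<lambda>x. x $ 1 * x $ 2" \<rho>] integral_cball_perp[of "\<lambda>x. x $ 1 * x $ 1" \<rho>]
    by (simp_all add: perp_def mult.commute)
  show "(\<integral>x. v \<bullet> x \<partial>?L) = 0"
    using 1 by (simp add: vec2_inner)
  have "(v \<bullet> x) * (w \<bullet> x) = (v $ 1 * w $ 1) * (x $ 1 * x $ 1) + (v $ 1 * w $ 2 + v $ 2 * w $ 1) * (x $ 1 * x $ 2)
      + (v $ 2 * w $ 2) * (x $ 2 * x $ 2)" for x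
    by (simp add: vec2_inner algebra_simps)
  moreover have "(\<integral>x. a * (x $ 1 * x $ 1) + b * (x $ 1 * x $ 2) + c * (x $ 2 * x $ 2) \<partial>?L)
      = a * (\<integral>x. x $ 1 * x $ 1 \<partial>?L) + b * (\<integral>x. x $ 1 * x $ 2 \<partial>?L) + c * (\<integral>x. x $ 2 * x $ 2 \<partial>?L)" for a b c
    by simp
  ultimately show "(\<integral>x. (v \<bullet> x) * (w \<bullet> x) \<partial>?L) = (v \<bullet> w) * (\<integral>x. (x $ 1)\<^sup>2 \<partial>?L)"
    using 2 by (simp only: vec2_inner[of v w] power2_eq_square) (simp add: algebra_simps)
qed

lemma AE_lborel_on_iff:
  assumes [measurable]: "A \<in> sets borel"
  shows "(AE x in lborel_on A. P x) \<longleftrightarrow> (AE x in lborel. x \<in> A \<longrightarrow> P x)"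
proof -
  have "(AE x in lborel_on A. P x) \<longleftrightarrow> (AE x in lborel. 0 < ennreal (indicator A x) \<longrightarrow> P x)"
    unfolding lborel_on_def by (rule AE_density) measurable
  moreover have "0 < ennreal (indicator A x) \<longleftrightarrow> x \<in> A" for x
    by (simp add: indicator_def)
  ultimately show ?thesis by simp
qed

text \<open>By symmetry this is half the integral of \<open>x \<bullet> x\<close>, whose zero set is
  a single point and therefore null.\<close>

lemma cball_second_moment_pos:
  assumes "\<rho> > 0"
  shows "(\<integral>x. (x $ 1)\<^sup>2 \<partial>lborel_on (cball (0::real^2) \<rho>)) > 0"
proof -
  let ?L = "lborel_on (cball 0 \<rho>) :: (real^2) measure"
  have int: "integrable ?L (\<lambda>x. x \<bullet> x)"
    by (intro integrable_cball_continuous continuous_intros)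
  have i: "integrable ?L (\<lambda>x. x $ i * x $ i)" for i
    by (intro integrable_cball_continuous continuous_intros)
  have "(\<integral>x. x $ 2 * x $ 2 \<partial>?L) = (\<integral>x. x $ 1 * x $ 1 \<partial>?L)"
    using integral_cball_perp[of "\<lambda>x. x $ 1 * x $ 1" \<rho>] by (simp add: perp_def)
  then have eq: "(\<integral>x. x \<bullet> x \<partial>?L) = 2 * (\<integral>x. (x $ 1)\<^sup>2 \<partial>?L)"
    using i by (simp add: vec2_inner power2_eq_square)
  have "(\<integral>x. x \<bullet> x \<partial>?L) \<noteq> 0"
  proof
    assume "(\<integral>x. x \<bullet> x \<partial>?L) = 0"
    then have "AE x in ?L. x \<bullet> x = 0"
      using integral_nonneg_eq_0_iff_AE[OF int] by simp
    then have "AE x in lborel. x \<in> cball (0::real^2) \<rho> \<longrightarrow> x = 0"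
      by (simp add: AE_lborel_on_iff)
    then have "AE x in lborel. x \<notin> cball (0::real^2) \<rho>"
      using AE_lborel_singleton[of "0::real^2"] by eventually_elim auto
    then have "emeasure lborel (cball (0::real^2) \<rho>) = 0"
      by (subst (asm) AE_iff_measurable[of "cball 0 \<rho>"]) auto
    then show False
      using assms by (simp add: emeasure_cball unit_ball_vol_2)
  qed
  moreover have "(\<integral>x. x \<bullet> x \<partial>?L) \<ge> 0"
    by simp
  ultimately show ?thesis
    using eq by linarith
qed

text \<open>The value and the derivative of \<open>v \<bullet> dirvec b\<close> at \<open>a\<close>
  are the coordinates of \<open>v\<close> in a rotated orthonormal frame, and both vanish.\<close>

lemma dirvec_inner_zeros:
  assumes "open U" "a \<in> U" "\<And>b. b \<in> U \<Longrightarrow> v \<bullet> dirvec b = 0"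
  shows "v = 0"
proof -
  have e: "v \<bullet> dirvec b = v $ 1 * cos b + v $ 2 * sin b" for b
    by (simp add: vec2_inner dirvec_def)
  have "((\<lambda>b. v \<bullet> dirvec b) has_real_derivative - v $ 1 * sin a + v $ 2 * cos a) (at a)"
    unfolding e by (auto intro!: derivative_eq_intros)
  moreover have "((\<lambda>b. v \<bullet> dirvec b) has_real_derivative 0) (at a)"
  proof (rule has_field_derivative_transform_within_open[OF _ assms(1,2)])
    show "((\<lambda>_. 0) has_real_derivative 0) (at a)" by simp
  qed (simp add: assms(3))
  ultimately have 1: "- v $ 1 * sin a + v $ 2 * cos a = 0"
    by (rule DERIV_unique)
  have 2: "v $ 1 * cos a + v $ 2 * sin a = 0"
    using assms(2,3) e by simp
  have "(p * c + q * t)\<^sup>2 + (- p * t + q * c)\<^sup>2 = (p\<^sup>2 + q\<^sup>2) * (t\<^sup>2 + c\<^sup>2)" for p q c t :: real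
    by (simp add: power2_eq_square algebra_simps)
  from this[of "v $ 1" "cos a" "v $ 2" "sin a"] have "(v $ 1)\<^sup>2 + (v $ 2)\<^sup>2 = 0"
    unfolding 1 2 by simp
  then show ?thesis
    by (simp add: vec_eq_iff forall_2 sum_power2_eq_zero_iff)
qed

text \<open>Integration by parts, with boundary terms that vanish because \<open>w + S\<close> and
  \<open>w - S\<close> lie off the support, gives -2 times the integral of s
  \<open>\<phi> (w + s)\<close>. Substituting t = w + s and using that \<open>\<phi>\<close> has
  integral 1 isolates the term 2 w; the first moment of \<open>\<phi>\<close> only adds a constant
  in w.\<close>

lemma kernel_deriv_second_moment:
  assumes ker: "interpolation_kernel M \<phi>" "M \<ge> 2"
    and T: "\<And>t. \<bar>t\<bar> \<ge> T \<Longrightarrow> \<phi> t = 0" and w: "\<bar>w\<bar> \<le> \<rho>" and S: "S \<ge> T + \<rho>" "S \<ge> 0"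
  shows "(\<integral>s. s\<^sup>2 * deriv \<phi> (w + s) \<partial>lborel_on {-S..S}) = 2 * w - 2 * (\<integral>t. t * \<phi> t \<partial>lborel)"
proof -
  note d = interpolation_kernel_deriv[OF ker]
  have c: "continuous_on UNIV \<phi>"
    using d(1) by (meson DERIV_continuous_on has_field_derivative_at_within)
  have [measurable]: "\<phi> \<in> borel_measurable borel" "deriv \<phi> \<in> borel_measurable borel"
    using c d(2) by (auto intro: borel_measurable_continuous_onI)
  have c': "continuous_on A (\<lambda>s. \<phi> (w + s))" "continuous_on A (\<lambda>s. deriv \<phi> (w + s))" for A
    using continuous_on_compose2[OF c, of A "\<lambda>s. w + s"] continuous_on_compose2[OF d(2), of A "\<lambda>s. w + s"]
    by (simp_all add: continuous_intros)
  have z: "\<phi> (w + s) = 0" if "s \<notin> {-S<..<S}" for s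
    using that w S(1) by (intro T) auto
  have i1: "integrable lborel (\<lambda>s. indicator {-S..S} s *\<^sub>R (s\<^sup>2 * deriv \<phi> (w + s)))"
    by (rule borel_integrable_compact) (auto intro!: continuous_intros c')
  have i2: "integrable lborel (\<lambda>s. indicator {-S..S} s *\<^sub>R (2 * s * \<phi> (w + s)))"
    by (rule borel_integrable_compact) (auto intro!: continuous_intros c')
  have "(\<integral>s. indicator {-S..S} s *\<^sub>R (2 * s * \<phi> (w + s) + s\<^sup>2 * deriv \<phi> (w + s)) \<partial>lborel)
      = S\<^sup>2 * \<phi> (w + S) - (-S)\<^sup>2 * \<phi> (w + (- S))"
  proof (rule integral_FTC_Icc)
    show "((\<lambda>s. s\<^sup>2 * \<phi> (w + s)) has_vector_derivative 2 * s * \<phi> (w + s) + s\<^sup>2 * deriv \<phi> (w + s))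
        (at s within {-S..S})" for s
    proof -
      have "((\<lambda>s. \<phi> (w + s)) has_real_derivative deriv \<phi> (w + s) * 1) (at s)"
        by (rule DERIV_chain2[OF d(1)]) (auto intro!: derivative_eq_intros)
      then have "((\<lambda>s. s\<^sup>2 * \<phi> (w + s)) has_real_derivative 2 * s * \<phi> (w + s) + s\<^sup>2 * deriv \<phi> (w + s)) (at s)"
        by (auto intro!: derivative_eq_intros)
      then show ?thesis
        by (simp add: has_real_derivative_iff_has_vector_derivative has_vector_derivative_at_within)
    qed
    show "continuous_on {-S..S} (\<lambda>s. 2 * s * \<phi> (w + s) + s\<^sup>2 * deriv \<phi> (w + s))"
      by (intro continuous_intros c')
  qed (use S in auto)
  then have 1: "(\<integral>s. indicator {-S..S} s *\<^sub>R (s\<^sup>2 * deriv \<phi> (w + s)) \<partial>lborel)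
      = - (\<integral>s. indicator {-S..S} s *\<^sub>R (2 * s * \<phi> (w + s)) \<partial>lborel)"
    unfolding scaleR_add_right Bochner_Integration.integral_add[OF i2 i1] using z[of S] z[of "- S"] by simp
  have "indicator {-S..S} s *\<^sub>R (2 * s * \<phi> (w + s)) = 2 * s * \<phi> (w + s)" for s
    using z[of s] by (cases "s \<in> {-S<..<S}") (auto simp: indicator_def)
  then have "(\<integral>s. indicator {-S..S} s *\<^sub>R (2 * s * \<phi> (w + s)) \<partial>lborel) = (\<integral>s. 2 * s * \<phi> (w + s) \<partial>lborel)"
    by (simp only:)
  also have "\<dots> = (\<integral>t. 2 * (t - w) * \<phi> t \<partial>lborel)"
    by (subst lborel_integral_real_affine[where c=1 and t="- w"]) (simp_all add: algebra_simps)
  also have "\<dots> = (\<integral>t. 2 * (t * \<phi> t) - 2 * w * \<phi> t \<partial>lborel)"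
    by (simp add: algebra_simps)
  also have "\<dots> = 2 * (\<integral>t. t * \<phi> t \<partial>lborel) - 2 * w"
  proof -
    have "integrable lborel (\<lambda>t. t * \<phi> t)"
      using T by (intro compact_support_integrable[of _ T] continuous_intros c) auto
    then show ?thesis
      using interpolation_kernel_integral[OF ker(1) c] by simp
  qed
  finally show ?thesis
    by (subst integral_lborel_on) (simp_all add: set_lebesgue_integral_def 1[unfolded real_scaleR_def])
qed

lemma noise_kernel_section_measurable:
  assumes h: "continuous_on {0..2*pi} \<eta>" and cont: "continuous_on UNIV (deriv \<phi>)"
    and u [measurable]: "u \<in> borel_measurable borel"
    and A: "compact A"
  shows "(\<lambda>q. \<integral>x. u x * noise_kernel \<eta> \<phi> x q \<partial>lborel_on A) \<in> borel_measurable borel"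
    "(\<lambda>x. noise_kernel \<eta> \<phi> x q) \<in> borel_measurable borel"
proof -
  note [measurable] = noise_kernel_measurable[OF h cont]
  interpret finite_measure "lborel_on A"
    using A by (rule finite_measure_lborel_on)
  show "(\<lambda>q. \<integral>x. u x * noise_kernel \<eta> \<phi> x q \<partial>lborel_on A) \<in> borel_measurable borel"
    by measurable
  show "(\<lambda>x. noise_kernel \<eta> \<phi> x q) \<in> borel_measurable borel"
    by measurable
qed

text \<open>If the quadratic form vanished at \<open>v\<close>, the transform \<open>s \<mapsto> \<integral> (v \<bullet> x) \<phi>'(dirvec a \<bullet> x + s) dx\<close> would
  vanish for some direction \<open>a\<close> with \<open>\<eta> a \<noteq> 0\<close> and \<open>v \<bullet> dirvec a \<noteq> 0\<close>.  Its second moment in \<open>s\<close> is a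
  nonzero multiple of \<open>v \<bullet> dirvec a\<close>, because \<open>\<phi>\<close> has integral \<open>1\<close>.\<close>

lemma noise_gram_pos:
  assumes ker: "interpolation_kernel M \<phi>" "M \<ge> 2"
    and T: "T > 0" "\<And>t. \<bar>t\<bar> \<ge> T \<Longrightarrow> \<phi> t = 0" "\<And>t. \<bar>t\<bar> \<ge> T \<Longrightarrow> deriv \<phi> t = 0"
    and \<rho>: "\<rho> > 0" and S: "S \<ge> T + \<rho>"
    and h: "continuous_on {0..2*pi} \<eta>"
    and \<Omega>: "open \<Omega>" "\<Omega> \<noteq> {}" "\<Omega> \<subseteq> {0..2*pi}" "\<And>a. a \<in> \<Omega> \<Longrightarrow> \<eta> a \<noteq> 0"
    and v: "v \<noteq> 0"
  shows "(\<integral>q. (\<integral>x. (v \<bullet> x) * noise_kernel \<eta> \<phi> x q \<partial>lborel_on (cball 0 \<rho>))\<^sup>2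
    \<partial>lborel_on ({0..2*pi} \<times> {-S..S})) > 0"
proof -
  let ?L = "lborel_on (cball 0 \<rho>) :: (real^2) measure"
  let ?Q = "{0..2*pi} \<times> {-S..S}"
  have comp: "compact ?Q"
    by (intro compact_Times) auto
  have Qm: "?Q \<in> sets borel"
    using comp by (rule borel_compact)
  have L: "finite_measure ?L" and I: "finite_measure (lborel_on {-S..S})"
    by (rule finite_measure_lborel_on; simp)+
  note d = interpolation_kernel_deriv[OF ker]
  have [measurable]: "deriv \<phi> \<in> borel_measurable borel"
    using d(2) by (rule borel_measurable_continuous_onI)
  have um [measurable]: "(\<lambda>x. v \<bullet> x) \<in> borel_measurable borel" by simp
  have ui: "integrable ?L (\<lambda>x. v \<bullet> x)"
    by (intro integrable_cball_continuous continuous_intros)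
  define J where "J q = (\<integral>x. (v \<bullet> x) * noise_kernel \<eta> \<phi> x q \<partial>?L)" for q
  have [measurable]: "J \<in> borel_measurable borel"
    unfolding J_def by (rule noise_kernel_section_measurable(1)[OF h d(2) um compact_cball])
  obtain B where B: "\<And>x q. \<bar>noise_kernel \<eta> \<phi> x q\<bar> \<le> B"
    using noise_kernel_bounded[OF h d(2) T(3)] by blast
  define D where "D = B * (\<integral>x. \<bar>v \<bullet> x\<bar> \<partial>?L)"
  have JD: "\<bar>J q\<bar> \<le> D" for q
    unfolding J_def D_def
    by (rule kernel_integral_bounded[OF ui B])
      (use noise_kernel_section_measurable(2)[OF h d(2) um compact_cball] in simp)
  have J2: "integrable (lborel_on ?Q) (\<lambda>q. (J q)\<^sup>2)"
    using power_mono[OF JD abs_ge_zero, of _ 2] by (intro integrable_lborel_on[OF comp, of _ "D\<^sup>2"]) auto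
  have "(\<integral>q. (J q)\<^sup>2 \<partial>lborel_on ?Q) \<noteq> 0"
  proof
    assume "(\<integral>q. (J q)\<^sup>2 \<partial>lborel_on ?Q) = 0"
    then have "AE q in lborel_on ?Q. J q = 0"
      using integral_nonneg_eq_0_iff_AE[OF J2] by simp
    then have "AE q in lborel. q \<in> ?Q \<longrightarrow> J q = 0"
      unfolding AE_lborel_on_iff[OF Qm] .
    then have "AE q in lborel \<Otimes>\<^sub>M lborel. q \<in> ?Q \<longrightarrow> J q = 0"
      by (simp only: lborel_prod)
    from lborel_pair.AE_pair[OF this]
    have ae: "AE a in lborel. AE s in lborel. (a, s) \<in> ?Q \<longrightarrow> J (a, s) = 0" .
    \<comment> \<open>The null set of exceptional directions cannot cover a nonempty open set. This
      yields one direction in which the transform vanishes for almost every s, while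
      \<open>\<eta> a\<close> and \<open>v \<bullet> dirvec a\<close> are both nonzero.\<close>
    define U where "U = {a \<in> \<Omega>. v \<bullet> dirvec a \<noteq> 0}"
    have "open {a. v \<bullet> dirvec a \<noteq> 0}"
      unfolding inner_commute[of v] by (intro open_Collect_neq continuous_intros)
    then have "open U"
      using \<Omega>(1) unfolding U_def Collect_conj_eq by auto
    moreover have "U \<noteq> {}"
      using dirvec_inner_zeros[OF \<Omega>(1), of _ v] \<Omega>(2) v by (auto simp: U_def)
    ultimately have "\<not> negligible U"
      by (rule open_not_negligible)
    then have "U \<notin> null_sets lborel"
      using null_sets_completionI[of U lborel] by (auto simp: negligible_iff_null_sets)
    then have "\<not> (AE a in lborel. a \<notin> U)"
      using \<open>open U\<close> AE_iff_null_sets[of U lborel] by simp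
    then obtain a where a: "a \<in> U" "AE s in lborel. (a, s) \<in> ?Q \<longrightarrow> J (a, s) = 0"
      using ae by (metis (mono_tags, lifting) eventually_mono)
    then have a01: "a \<in> {0..2*pi}" and \<eta>a: "\<eta> a \<noteq> 0" and va: "v \<bullet> dirvec a \<noteq> 0"
      using \<Omega> by (auto simp: U_def)
    have km: "(\<lambda>(x, s). deriv \<phi> (dirvec a \<bullet> x + s)) \<in> borel_measurable (?L \<Otimes>\<^sub>M lborel_on {-S..S})"
      by measurable
    obtain B' where B': "\<And>t. \<bar>deriv \<phi> t\<bar> \<le> B'"
      using compact_support_bounded[OF d(2) T(3)] by blast
    have "J (a, s) = \<eta> a * (\<integral>x. (v \<bullet> x) * deriv \<phi> (dirvec a \<bullet> x + s) \<partial>?L)" for s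
      unfolding J_def noise_kernel_def using a01 by (simp add: mult.left_commute[of _ "\<eta> a"])
    then have z: "AE s in lborel_on {-S..S}. (\<integral>x. (v \<bullet> x) * deriv \<phi> (dirvec a \<bullet> x + s) \<partial>?L) = 0"
      using a(2) a01 \<eta>a by (simp add: AE_lborel_on_iff)
    have "(\<integral>s. s\<^sup>2 * (\<integral>x. (v \<bullet> x) * deriv \<phi> (dirvec a \<bullet> x + s) \<partial>?L) \<partial>lborel_on {-S..S})
        = (\<integral>s. 0 \<partial>lborel_on {-S..S})"
    proof (rule integral_cong_AE)
      interpret finite_measure ?L by (rule L)
      show "(\<lambda>s. s\<^sup>2 * (\<integral>x. (v \<bullet> x) * deriv \<phi> (dirvec a \<bullet> x + s) \<partial>?L)) \<in> borel_measurable (lborel_on {-S..S})"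
        by measurable
    qed (use z in auto)
    moreover have "(\<integral>s. s\<^sup>2 * (\<integral>x. (v \<bullet> x) * deriv \<phi> (dirvec a \<bullet> x + s) \<partial>?L) \<partial>lborel_on {-S..S})
        = (\<integral>x. (v \<bullet> x) * (\<integral>s. s\<^sup>2 * deriv \<phi> (dirvec a \<bullet> x + s) \<partial>lborel_on {-S..S}) \<partial>?L)"
    proof (rule Fubini_weighted_kernel[OF L I ui _ km B'])
      have "\<bar>s\<^sup>2\<bar> \<le> S\<^sup>2" if "s \<in> {-S..S}" for s
        using that by (simp add: abs_le_square_iff[symmetric] abs_le_iff)
      then show "integrable (lborel_on {-S..S}) (\<lambda>s. s\<^sup>2)"
        by (intro integrable_lborel_on[OF compact_Icc, of _ _ _ "S\<^sup>2"]) simp_all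
    qed
    moreover define m where "m = (\<integral>t. t * \<phi> t \<partial>lborel)"
    have "(\<integral>x. (v \<bullet> x) * (\<integral>s. s\<^sup>2 * deriv \<phi> (dirvec a \<bullet> x + s) \<partial>lborel_on {-S..S}) \<partial>?L)
        = (\<integral>x. 2 * ((v \<bullet> x) * (dirvec a \<bullet> x)) - 2 * m * (v \<bullet> x) \<partial>?L)"
    proof (rule integral_cong_AE)
      interpret finite_measure "lborel_on {-S..S}" by (rule I)
      show "(\<lambda>x. (v \<bullet> x) * (\<integral>s. s\<^sup>2 * deriv \<phi> (dirvec a \<bullet> x + s) \<partial>lborel_on {-S..S})) \<in> borel_measurable ?L"
        by measurable
      have "(v \<bullet> x) * (\<integral>s. s\<^sup>2 * deriv \<phi> (dirvec a \<bullet> x + s) \<partial>lborel_on {-S..S})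
          = 2 * ((v \<bullet> x) * (dirvec a \<bullet> x)) - 2 * m * (v \<bullet> x)" if "x \<in> cball 0 \<rho>" for x
      proof -
        have "\<bar>dirvec a \<bullet> x\<bar> \<le> \<rho>"
          using abs_dirvec_inner_le[of a x] that by simp
        then have "(\<integral>s. s\<^sup>2 * deriv \<phi> (dirvec a \<bullet> x + s) \<partial>lborel_on {-S..S}) = 2 * (dirvec a \<bullet> x) - 2 * m"
          unfolding m_def by (rule kernel_deriv_second_moment[OF ker, of T, rotated]) (use T S \<rho> in auto)
        then show ?thesis
          by (simp add: right_diff_distrib mult_ac)
      qed
      then show "AE x in ?L. (v \<bullet> x) * (\<integral>s. s\<^sup>2 * deriv \<phi> (dirvec a \<bullet> x + s) \<partial>lborel_on {-S..S})
          = 2 * ((v \<bullet> x) * (dirvec a \<bullet> x)) - 2 * m * (v \<bullet> x)"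
        by (simp add: AE_lborel_on_iff)
    qed measurable
    moreover have "(\<integral>x. 2 * ((v \<bullet> x) * (dirvec a \<bullet> x)) - 2 * m * (v \<bullet> x) \<partial>?L)
        = 2 * ((v \<bullet> dirvec a) * (\<integral>x. (x $ 1)\<^sup>2 \<partial>?L))"
    proof -
      have "integrable ?L (\<lambda>x. (v \<bullet> x) * (dirvec a \<bullet> x))"
        by (intro integrable_cball_continuous continuous_intros)
      then show ?thesis
        using ui by (simp add: cball_moments)
    qed
    ultimately have "(v \<bullet> dirvec a) * (\<integral>x. (x $ 1)\<^sup>2 \<partial>?L) = 0"
      by simp
    then show False
      using va cball_second_moment_pos[OF \<rho>] by simp
  qed
  moreover have "(\<integral>q. (J q)\<^sup>2 \<partial>lborel_on ?Q) \<ge> 0"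
    by simp
  ultimately show ?thesis
    unfolding J_def by linarith
qed

text \<open>The Gram form of the covariance is valid only for arguments in the disk. It is therefore
  inserted under the integrals, almost everywhere for \<open>lborel_on\<close>, before the general
  Gram identity is applied.\<close>

lemma noise_cov_double_integral:
  fixes u u' :: "real^2 \<Rightarrow> real"
  assumes h: "continuous_on {0..2*pi} \<eta>" and \<eta>: "\<And>a. \<sigma> a (dirvec a \<bullet> x0) = \<eta> a"
    and cont: "continuous_on UNIV (deriv \<phi>)" and T: "\<And>t. \<bar>t\<bar> \<ge> T \<Longrightarrow> deriv \<phi> t = 0"
    and S: "S \<ge> T + \<rho>" and u: "continuous_on UNIV u" and u': "continuous_on UNIV u'"
  shows "(\<integral>x. u x * (\<integral>y. u' y * noise_cov \<kappa> \<sigma> \<phi> x0 (x - y) \<partial>lborel_on (cball 0 \<rho>)) \<partial>lborel_on (cball 0 \<rho>)) =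
    (\<kappa> / (4 * pi))\<^sup>2 * (\<integral>q. (\<integral>x. u x * noise_kernel \<eta> \<phi> x q \<partial>lborel_on (cball 0 \<rho>)) *
      (\<integral>x. u' x * noise_kernel \<eta> \<phi> x q \<partial>lborel_on (cball 0 \<rho>)) \<partial>lborel_on ({0..2*pi} \<times> {-S..S}))"
proof -
  let ?L = "lborel_on (cball 0 \<rho>) :: (real^2) measure"
  let ?Q = "lborel_on ({0..2*pi} \<times> {-S..S})"
  let ?k = "noise_kernel \<eta> \<phi>"
  let ?C = "noise_cov \<kappa> \<sigma> \<phi> x0"
  define K where "K = (\<kappa> / (4 * pi))\<^sup>2"
  have L: "finite_measure ?L" and Q: "finite_measure ?Q"
    by (intro finite_measure_lborel_on compact_Times compact_cball compact_Icc)+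
  interpret L: finite_measure ?L by (rule L)
  interpret Q: finite_measure ?Q by (rule Q)
  have "continuous_on UNIV ?C"
    by (rule noise_cov_continuous[OF _ h cont T]) (rule \<eta>)
  then have [measurable]: "u \<in> borel_measurable borel" "u' \<in> borel_measurable borel" "?C \<in> borel_measurable borel"
    using u u' by (auto intro: borel_measurable_continuous_onI)
  note km [measurable] = noise_kernel_measurable[OF h cont]
  obtain B where B: "\<And>x q. \<bar>?k x q\<bar> \<le> B"
    using noise_kernel_bounded[OF h cont T] by blast
  have cov: "?C (x - y) = K * (\<integral>q. ?k x q * ?k y q \<partial>?Q)" if "x \<in> cball 0 \<rho>" "y \<in> cball 0 \<rho>" for x y
    unfolding K_def by (rule noise_cov_gram[OF h cont T _ _ _ S]) (use that \<eta> in auto)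
  have "(\<integral>y. u' y * ?C (x - y) \<partial>?L) = (\<integral>y. K * (u' y * (\<integral>q. ?k x q * ?k y q \<partial>?Q)) \<partial>?L)"
    if x: "x \<in> cball 0 \<rho>" for x
  proof (rule integral_cong_AE)
    show "AE y in ?L. u' y * ?C (x - y) = K * (u' y * (\<integral>q. ?k x q * ?k y q \<partial>?Q))"
      using cov[OF x] by (simp add: AE_lborel_on_iff)
  qed measurable
  then have "(\<integral>x. u x * (\<integral>y. u' y * ?C (x - y) \<partial>?L) \<partial>?L)
      = (\<integral>x. K * (u x * (\<integral>y. u' y * (\<integral>q. ?k x q * ?k y q \<partial>?Q) \<partial>?L)) \<partial>?L)"
    by (intro integral_cong_AE) (simp_all add: AE_lborel_on_iff)
  also have "\<dots> = K * (\<integral>x. u x * (\<integral>y. u' y * (\<integral>q. ?k x q * ?k y q \<partial>?Q) \<partial>?L) \<partial>?L)"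
    by simp
  also have "(\<integral>x. u x * (\<integral>y. u' y * (\<integral>q. ?k x q * ?k y q \<partial>?Q) \<partial>?L) \<partial>?L)
      = (\<integral>q. (\<integral>x. u x * ?k x q \<partial>?L) * (\<integral>x. u' x * ?k x q \<partial>?L) \<partial>?Q)"
    by (rule gram_integral[OF L Q integrable_cball_continuous[OF u] integrable_cball_continuous[OF u'] _ B]) measurable
  finally show ?thesis
    by (simp add: K_def)
qed

text \<open>The Gram identity on coordinate functions makes the matrix entries inner products of
  transforms, and linearity of the transform then gives the form at \<open>v\<close>. Symmetry is
  for whitening, the squared norm for positivity, and the double integral is the variance that the
  characteristic function of the field produces.\<close>

lemma moment_cov_quadratic_form:
  fixes v :: "real^2"
  assumes h: "continuous_on {0..2*pi} \<eta>" and \<eta>: "\<And>a. \<sigma> a (dirvec a \<bullet> x0) = \<eta> a"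
    and cont: "continuous_on UNIV (deriv \<phi>)" and T: "\<And>t. \<bar>t\<bar> \<ge> T \<Longrightarrow> deriv \<phi> t = 0"
    and S: "S \<ge> T + \<rho>" and C: "C = noise_cov \<kappa> \<sigma> \<phi> x0"
  shows "transpose (moment_cov C \<rho>) = moment_cov C \<rho>"
    "v \<bullet> (moment_cov C \<rho> *v v) = (\<kappa> / (4 * pi))\<^sup>2 *
      (\<integral>q. (\<integral>x. (v \<bullet> x) * noise_kernel \<eta> \<phi> x q \<partial>lborel_on (cball 0 \<rho>))\<^sup>2 \<partial>lborel_on ({0..2*pi} \<times> {-S..S}))"
    "v \<bullet> (moment_cov C \<rho> *v v) =
      (\<integral>x. (v \<bullet> x) * (\<integral>y. (v \<bullet> y) * C (x - y) \<partial>lborel_on (cball 0 \<rho>)) \<partial>lborel_on (cball 0 \<rho>))"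
proof -
  let ?L = "lborel_on (cball 0 \<rho>) :: (real^2) measure"
  let ?Q = "lborel_on ({0..2*pi} \<times> {-S..S})"
  let ?k = "noise_kernel \<eta> \<phi>"
  define K where "K = (\<kappa> / (4 * pi))\<^sup>2"
  interpret L: finite_measure ?L by (intro finite_measure_lborel_on compact_cball)
  interpret Q: finite_measure ?Q by (intro finite_measure_lborel_on compact_Times compact_Icc)
  have Cc: "continuous_on UNIV C"
    unfolding C by (rule noise_cov_continuous[OF _ h cont T]) (rule \<eta>)
  then have [measurable]: "C \<in> borel_measurable borel"
    by (rule borel_measurable_continuous_onI)
  obtain B where B: "\<And>x q. \<bar>?k x q\<bar> \<le> B"
    using noise_kernel_bounded[OF h cont T] by blast
  define J where "J u q = (\<integral>x. u x * ?k x q \<partial>?L)" for u :: "real^2 \<Rightarrow> real" and q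
  have gram: "(\<integral>x. u x * (\<integral>y. u' y * C (x - y) \<partial>?L) \<partial>?L) = K * (\<integral>q. J u q * J u' q \<partial>?Q)"
    if "continuous_on UNIV u" "continuous_on UNIV u'" for u u' :: "real^2 \<Rightarrow> real"
    unfolding C K_def J_def by (rule noise_cov_double_integral[OF h _ cont T S that]) (rule \<eta>)
  have c [continuous_intros]: "continuous_on UNIV (\<lambda>x::real^2. x $ i)" for i
    by (intro continuous_intros)
  have entry: "moment_cov C \<rho> $ i $ j = K * (\<integral>q. J (\<lambda>x. x $ i) q * J (\<lambda>x. x $ j) q \<partial>?Q)" for i j
  proof -
    have "(LINT y:cball 0 \<rho>|lborel. x $ i * y $ j * C (x - y)) = x $ i * (\<integral>y. y $ j * C (x - y) \<partial>?L)" for x :: "real^2"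
      by (subst integral_lborel_on[symmetric]) (simp_all add: mult.assoc)
    then have "moment_cov C \<rho> $ i $ j = (\<integral>x. x $ i * (\<integral>y. y $ j * C (x - y) \<partial>?L) \<partial>?L)"
      unfolding moment_cov_def by (subst integral_lborel_on) simp_all
    then show ?thesis
      using gram[OF c c] by simp
  qed
  show "transpose (moment_cov C \<rho>) = moment_cov C \<rho>"
    by (simp add: vec_eq_iff transpose_def entry mult.commute)
  have int: "integrable ?L (\<lambda>x. u x * ?k x q)" if u: "continuous_on UNIV u" for u q
  proof (rule Bochner_Integration.integrable_bound)
    have um [measurable]: "u \<in> borel_measurable borel"
      using u by (rule borel_measurable_continuous_onI)
    show "integrable ?L (\<lambda>x. u x * B)"
      using integrable_cball_continuous[OF u] by simp
    have [measurable]: "(\<lambda>x. ?k x q) \<in> borel_measurable borel"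
      by (rule noise_kernel_section_measurable(2)[OF h cont um compact_cball])
    show "(\<lambda>x. u x * ?k x q) \<in> borel_measurable ?L"
      by measurable
    have "\<bar>u x * ?k x q\<bar> \<le> \<bar>u x * B\<bar>" for x
      using B[of x q] unfolding abs_mult by (intro mult_left_mono) auto
    then show "AE x in ?L. norm (u x * ?k x q) \<le> norm (u x * B)"
      by simp
  qed
  have lin: "J (\<lambda>x. v \<bullet> x) q = v $ 1 * J (\<lambda>x. x $ 1) q + v $ 2 * J (\<lambda>x. x $ 2) q" for q
    unfolding J_def vec2_inner using int[OF c[of 1], of q] int[OF c[of 2], of q]
    by (simp add: distrib_right mult.assoc)
  have JJ: "integrable ?Q (\<lambda>q. J (\<lambda>x. x $ i) q * J (\<lambda>x. x $ j) q)" for i j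
  proof -
    have cm: "(\<lambda>x::real^2. x $ i) \<in> borel_measurable borel" for i
      by (rule borel_measurable_vec_nth)
    have [measurable]: "J (\<lambda>x. x $ i) \<in> borel_measurable borel" for i
      unfolding J_def by (rule noise_kernel_section_measurable(1)[OF h cont cm compact_cball])
    have b: "\<bar>J (\<lambda>x. x $ i) q\<bar> \<le> B * (\<integral>x. \<bar>x $ i\<bar> \<partial>?L)" for i q
      unfolding J_def by (rule kernel_integral_bounded[OF integrable_cball_continuous[OF c] B])
        (use noise_kernel_section_measurable(2)[OF h cont cm compact_cball] in simp)
    show ?thesis
    proof (rule integrable_lborel_on)
      show "compact ({0..2*pi} \<times> {-S..S})"
        by (intro compact_Times compact_Icc)
      show "norm (J (\<lambda>x. x $ i) q * J (\<lambda>x. x $ j) q) \<le> (B * (\<integral>x. \<bar>x $ i\<bar> \<partial>?L)) * (B * (\<integral>x. \<bar>x $ j\<bar> \<partial>?L))" for q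
        unfolding real_norm_def abs_mult by (intro mult_mono b order_trans[OF abs_ge_zero b]) auto
    qed measurable
  qed
  define G where "G i j = (\<integral>q. J (\<lambda>x. x $ i) q * J (\<lambda>x. x $ j) q \<partial>?Q)" for i j
  have sq: "(J (\<lambda>x. v \<bullet> x) q)\<^sup>2 = v $ 1 * v $ 1 * (J (\<lambda>x. x $ 1) q * J (\<lambda>x. x $ 1) q) +
      2 * (v $ 1 * v $ 2) * (J (\<lambda>x. x $ 1) q * J (\<lambda>x. x $ 2) q) + v $ 2 * v $ 2 * (J (\<lambda>x. x $ 2) q * J (\<lambda>x. x $ 2) q)" for q
    unfolding lin by (simp add: power2_eq_square algebra_simps)
  have "(\<integral>q. (J (\<lambda>x. v \<bullet> x) q)\<^sup>2 \<partial>?Q) = v $ 1 * v $ 1 * G 1 1 + 2 * (v $ 1 * v $ 2) * G 1 2 + v $ 2 * v $ 2 * G 2 2"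
    unfolding sq G_def using JJ by simp
  moreover have "G 2 1 = G 1 2"
    unfolding G_def by (simp only: mult.commute)
  moreover have "moment_cov C \<rho> $ i $ j = K * G i j" for i j
    unfolding G_def by (rule entry)
  ultimately have quad: "v \<bullet> (moment_cov C \<rho> *v v) = K * (\<integral>q. (J (\<lambda>x. v \<bullet> x) q)\<^sup>2 \<partial>?Q)"
    by (simp add: vec2_inner matrix_vector_mult_def sum_2 algebra_simps)
  then show "v \<bullet> (moment_cov C \<rho> *v v) = (\<kappa> / (4 * pi))\<^sup>2 *
      (\<integral>q. (\<integral>x. (v \<bullet> x) * ?k x q \<partial>?L)\<^sup>2 \<partial>?Q)"
    by (simp add: K_def J_def)
  show "v \<bullet> (moment_cov C \<rho> *v v) = (\<integral>x. (v \<bullet> x) * (\<integral>y. (v \<bullet> y) * C (x - y) \<partial>?L) \<partial>?L)"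
    unfolding quad by (subst gram) (auto intro!: continuous_intros simp: power2_eq_square)
qed

section \<open>Law of the test statistic\<close>

lemma edge_response_measurable:
  assumes [measurable]: "\<phi> \<in> borel_measurable borel"
  shows "edge_response \<phi> \<in> borel_measurable borel"
proof -
  \<comment> \<open>Written this way the integrand is jointly measurable in s and t, so the
    parameter integral is measurable.\<close>
  have eq: "edge_response \<phi> = (\<lambda>t. (\<integral>s. (if s \<le> t then \<phi> s else 0) \<partial>lborel) - 1 / 2)"
    by (auto simp: edge_response_def set_lebesgue_integral_def fun_eq_iff intro!: Bochner_Integration.integral_cong)
  show ?thesis
    unfolding eq by measurable
qed

lemma edge_response_bounded:
  assumes \<phi>: "integrable lborel \<phi>"
  shows "\<bar>edge_response \<phi> t\<bar> \<le> (\<integral>s. \<bar>\<phi> s\<bar> \<partial>lborel) + 1 / 2"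
proof -
  have "\<bar>\<integral>s. indicator {..t} s *\<^sub>R \<phi> s \<partial>lborel\<bar> \<le> (\<integral>s. \<bar>indicator {..t} s *\<^sub>R \<phi> s\<bar> \<partial>lborel)"
    using integral_norm_bound[of lborel "\<lambda>s. indicator {..t} s *\<^sub>R \<phi> s"] by simp
  also have "\<dots> \<le> (\<integral>s. \<bar>\<phi> s\<bar> \<partial>lborel)"
  proof (rule integral_mono)
    show "integrable lborel (\<lambda>s. \<bar>indicator {..t} s *\<^sub>R \<phi> s\<bar>)"
      using \<phi> by (intro integrable_abs integrable_mult_indicator) simp_all
  qed (use \<phi> in \<open>auto simp: indicator_def\<close>)
  finally show ?thesis
    unfolding edge_response_def set_lebesgue_integral_def by linarith
qed

text \<open>The constant drops out because the disk is centered at the origin. The lemma is applied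
  path by path, with \<open>n\<close> the path and \<open>e\<close> the edge response or zero;
  boundedness of \<open>e\<close> is enough for integrability.\<close>

lemma first_moment_decomposition:
  fixes e n :: "real^2 \<Rightarrow> real"
  assumes e [measurable]: "e \<in> borel_measurable borel" and eb: "\<And>y. \<bar>e y\<bar> \<le> B"
    and n: "continuous_on UNIV n"
  shows "v \<bullet> (first_moment \<rho> (\<lambda>y. c + e y + n y) - first_moment \<rho> e)
    = (\<integral>y. (v \<bullet> y) * n y \<partial>lborel_on (cball 0 \<rho>))"
proof -
  let ?L = "lborel_on (cball 0 \<rho>) :: (real^2) measure"
  have [measurable]: "n \<in> borel_measurable borel"
    using n by (rule borel_measurable_continuous_onI)
  have fm: "first_moment \<rho> u = (\<integral>y. u y *\<^sub>R y \<partial>?L)" if [measurable]: "u \<in> borel_measurable borel" for u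
    unfolding first_moment_def by (subst integral_lborel_on) simp_all
  have i1: "integrable ?L (\<lambda>y. c *\<^sub>R y)" and i3: "integrable ?L (\<lambda>y. n y *\<^sub>R y)" and i0: "integrable ?L (\<lambda>y. y)"
    by (intro integrable_cball_continuous continuous_intros n)+
  have i2: "integrable ?L (\<lambda>y. e y *\<^sub>R y)"
  proof (rule integrable_lborel_on[OF compact_cball])
    show "norm (e y *\<^sub>R y) \<le> B * \<rho>" if "y \<in> cball 0 \<rho>" for y
      using that eb[of y] by (simp, intro mult_mono) auto
  qed measurable
  have "v \<bullet> (\<integral>y. c *\<^sub>R y \<partial>?L) = c * (\<integral>y. v \<bullet> y \<partial>?L)"
    using i0 by (simp add: integral_inner_right)
  then have "v \<bullet> (\<integral>y. c *\<^sub>R y \<partial>?L) = 0"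
    by (simp add: cball_moments)
  moreover have "first_moment \<rho> (\<lambda>y. c + e y + n y) = (\<integral>y. c *\<^sub>R y \<partial>?L) + (\<integral>y. e y *\<^sub>R y \<partial>?L) + (\<integral>y. n y *\<^sub>R y \<partial>?L)"
    using i1 i2 i3 by (subst fm) (simp_all only: scaleR_add_left Bochner_Integration.integral_add
      Bochner_Integration.integrable_add, measurable)
  moreover have "v \<bullet> (\<integral>y. n y *\<^sub>R y \<partial>?L) = (\<integral>y. (v \<bullet> y) * n y \<partial>?L)"
    using i3 by (subst integral_inner_right[symmetric]) (simp_all add: mult.commute)
  ultimately show ?thesis
    using fm[OF e] by (simp add: inner_add_right)
qed

text \<open>Whitening puts the mean at distance sqrt \<open>quad_stat C h\<close> along the first
  axis, which is the mean in the definition of the non-central law.\<close>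

lemma measure_noncentral_chi2_tail:
  fixes h :: "real^2" and A C :: "real^2^2"
  assumes A: "A ** C ** transpose A = mat 1" and sym: "transpose C = C"
    and Ah: "A *v h = vector [sqrt (quad_stat C h), 0]"
  shows "measure (mvn h C) {v. quad_stat C v > t} = 1 - cdf (noncentral_chi2 2 (quad_stat C h)) t"
proof -
  define \<mu> where "\<mu> = quad_stat C h"
  have \<mu>: "\<mu> \<ge> 0"
    by (simp add: \<mu>_def whitening_inverse(3)[OF A])
  define m :: "real^2" where "m = vector [sqrt \<mu>, 0]"
  interpret P: prob_space "mvn m (mat 1)"
    by (rule prob_space_mvn_mat_1)
  have "cdf (noncentral_chi2 2 \<mu>) t = measure (mvn m (mat 1)) {v. v \<bullet> v \<le> t}"
    unfolding cdf_def noncentral_chi2_2[OF \<mu>] m_def by (subst measure_distr) (simp_all add: vimage_def)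
  also have "{v :: real^2. v \<bullet> v \<le> t} = space (mvn m (mat 1)) - {v. v \<bullet> v > t}"
    by auto
  also have "measure (mvn m (mat 1)) \<dots> = 1 - measure (mvn m (mat 1)) {v. v \<bullet> v > t}"
    by (rule P.prob_compl) simp
  finally show ?thesis
    unfolding measure_mvn_quad_stat[OF A sym] Ah \<mu>_def[symmetric] m_def[symmetric] by simp
qed

text \<open>Invertibility belongs to the conclusion because \<open>matrix_inv\<close> is a choice
  operator and would otherwise leave \<open>quad_stat\<close> and the densities uninterpreted. The
  equivalence for all \<open>R\<close> states existence and uniqueness of the test. The normal laws
  of \<open>F\<close> are derived from the noise model, not assumed.\<close>

theorem theorem4p1:
  fixes \<kappa> P \<rho> \<nu> \<alpha> c :: real
    and M K :: nat
    and \<sigma> :: "real \<Rightarrow> real \<Rightarrow> real"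
    and \<phi> :: "real \<Rightarrow> real"
    and f :: "real^2 \<Rightarrow> real"
    and g :: "nat \<Rightarrow> real^2 \<Rightarrow> real"
    and D :: "nat \<Rightarrow> (real^2) set"
    and S :: "(real^2) set"
    and x0 \<Theta>0 H :: "real^2"
    and C :: "real^2 \<Rightarrow> real"
    and Chat :: "real^2^2"
    and W :: "'w measure"
    and N frec :: "'w \<Rightarrow> real^2 \<Rightarrow> real"
    and F :: "'w \<Rightarrow> real^2"
  assumes kappa: "\<kappa> > 0" and P: "P > 0" and rho: "\<rho> > 0"
    and alpha: "0 < \<alpha>" "\<alpha> < 1"
    and sigma_C1: "Ck_on 1 ({-pi..pi} \<times> {-P..P}) (\<lambda>(a, p). \<sigma> a p)"
    and sigma_even: "\<And>a p. p \<in> {-P..P} \<Longrightarrow> \<sigma> a p = \<sigma> (a + pi) (- p)"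
    and kernel: "interpolation_kernel M \<phi>"
    and M: "M \<ge> 3" "real M > max (\<nu> + 1) 3"
    and f_supp: "closure {x. f x \<noteq> 0} \<subseteq> {x. norm x < P}"
    and f_form: "\<And>x. f x = (\<Sum>k=1..K. g k x * indicator (D k) x)"
    and g_smooth: "\<And>k. k \<in> {1..K} \<Longrightarrow> smooth_on UNIV (g k)"
    and D_open: "\<And>k. k \<in> {1..K} \<Longrightarrow> open (D k)"
    and D_bdry: "\<And>k. k \<in> {1..K} \<Longrightarrow> piecewise_smooth_boundary (D k)"
    and S: "S = singsupp f"
    \<comment> \<open>assumptions on the point \<open>x0\<close>\<close>
    and x0_type: "irrational_of_type (\<kappa> * norm x0) \<nu>"
    and x0_sigma: "\<exists>\<Omega>. open \<Omega> \<and> \<Omega> \<noteq> {} \<and> \<Omega> \<subseteq> {0..2*pi} \<and>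
                     (\<forall>a\<in>\<Omega>. (\<sigma> a (dirvec a \<bullet> x0))\<^sup>2 \<noteq> 0)"
    and x0_P: "norm x0 < P"
    and normal: "x0 \<in> S \<Longrightarrow> unit_normal S x0 \<Theta>0"
    and jump: "x0 \<in> S \<Longrightarrow>
                 ((\<lambda>t. f (x0 + t *\<^sub>R \<Theta>0) - f (x0 - t *\<^sub>R \<Theta>0)) \<longlongrightarrow> 1) (at_right 0)"
    and curv: "x0 \<in> S \<Longrightarrow> \<exists>k. has_curvature S x0 k \<and> k \<noteq> 0"
    and irrat: "x0 \<in> S \<Longrightarrow> \<kappa> * (x0 \<bullet> perp \<Theta>0) \<notin> \<rat>"
    and tangency: "\<And>x. x0 \<in> S \<Longrightarrow> x \<in> S \<Longrightarrow> has_curvature S x 0 \<Longrightarrow>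
                     \<not> ((x - x0) \<bullet> \<Theta>0 = 0 \<and> tangent_to S x (perp \<Theta>0))"
    \<comment> \<open>noise and reconstruction\<close>
    and C: "C = noise_cov \<kappa> \<sigma> \<phi> x0"
    and W: "prob_space W"
    and N_gauss: "gaussian_field W N"
    and N_mean: "\<And>x. (LINT \<omega>|W. N \<omega> x) = 0"
    and N_cov: "\<And>x y. (LINT \<omega>|W. N \<omega> x * N \<omega> y) = C (x - y)"
    and N_cont: "AE \<omega> in W. continuous_on UNIV (N \<omega>)"
    and frec: "\<And>\<omega> y. frec \<omega> y =
                 c + (if x0 \<in> S then edge_response \<phi> (\<Theta>0 \<bullet> y) else 0) + N \<omega> y"
    and F_rv: "F \<in> borel_measurable W"
    and F: "AE \<omega> in W. F \<omega> = first_moment \<rho> (frec \<omega>)"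
    and Chat: "Chat = moment_cov C \<rho>"
    and H: "H = first_moment \<rho> (\<lambda>y. edge_response \<phi> (\<Theta>0 \<bullet> y))"
  shows "invertible Chat \<and>
     (\<forall>R. lrt_rejection_region Chat \<alpha> R \<longleftrightarrow> R = {v. quad_stat Chat v > - 2 * ln \<alpha>}) \<and>
     (x0 \<notin> S \<longrightarrow>
        distributed W lborel F (mvn_density 0 Chat) \<and>
        measure W {\<omega> \<in> space W. quad_stat Chat (F \<omega>) > - 2 * ln \<alpha>} = \<alpha>) \<and>
     (x0 \<in> S \<and> H \<noteq> 0 \<longrightarrow>
        distributed W lborel F (mvn_density H Chat) \<and>
        measure W {\<omega> \<in> space W. quad_stat Chat (F \<omega>) > - 2 * ln \<alpha>} =
          1 - cdf (noncentral_chi2 2 (quad_stat Chat H)) (- 2 * ln \<alpha>))"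
proof -
  define \<eta> where "\<eta> a = \<sigma> a (dirvec a \<bullet> x0)" for a
  have \<eta>: "\<sigma> a (dirvec a \<bullet> x0) = \<eta> a" for a
    by (simp add: \<eta>_def)
  have h: "continuous_on {0..2*pi} \<eta>"
    unfolding \<eta>_def by (rule noise_amplitude_continuous[OF sigma_C1 sigma_even x0_P])
  have M2: "M \<ge> 2"
    using M(1) by simp
  note d = interpolation_kernel_deriv[OF kernel M2]
  have \<phi>c: "continuous_on UNIV \<phi>"
    using d(1) by (meson DERIV_continuous_on has_field_derivative_at_within)
  have \<phi>i: "integrable lborel \<phi>"
    by (rule interpolation_kernel_integral(1)[OF kernel \<phi>c])
  obtain T where T: "T > 0" "\<And>t. \<bar>t\<bar> \<ge> T \<Longrightarrow> \<phi> t = 0" "\<And>t. \<bar>t\<bar> \<ge> T \<Longrightarrow> deriv \<phi> t = 0"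
    using interpolation_kernel_support[OF kernel] by blast
  obtain \<Omega> where \<Omega>: "open \<Omega>" "\<Omega> \<noteq> {}" "\<Omega> \<subseteq> {0..2*pi}" "\<And>a. a \<in> \<Omega> \<Longrightarrow> \<eta> a \<noteq> 0"
    using x0_sigma by (auto simp: \<eta>_def)
  have Cc: "continuous_on UNIV C"
    unfolding C by (rule noise_cov_continuous[OF _ h d(2) T(3)]) (rule \<eta>)
  \<comment> \<open>\<open>order_refl\<close> sets the cut-off for the offsets to the smallest
    admissible value, \<open>T + \<rho>\<close>.\<close>
  note quad_form = moment_cov_quadratic_form[OF h _ d(2) T(3) order_refl C, where \<rho>=\<rho>]
  have sym: "transpose Chat = Chat"
    unfolding Chat by (rule quad_form(1)) (rule \<eta>)
  have quad: "v \<bullet> (Chat *v v) = (\<kappa> / (4 * pi))\<^sup>2 * (\<integral>q. (\<integral>x. (v \<bullet> x) * noise_kernel \<eta> \<phi> x q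
        \<partial>lborel_on (cball 0 \<rho>))\<^sup>2 \<partial>lborel_on ({0..2*pi} \<times> {-(T + \<rho>)..T + \<rho>}))" for v
    unfolding Chat by (rule quad_form(2)) (rule \<eta>)
  have quad': "v \<bullet> (Chat *v v) = (\<integral>x. (v \<bullet> x) * (\<integral>y. (v \<bullet> y) * C (x - y)
        \<partial>lborel_on (cball 0 \<rho>)) \<partial>lborel_on (cball 0 \<rho>))" for v
    unfolding Chat by (rule quad_form(3)) (rule \<eta>)
  have pos: "v \<bullet> (Chat *v v) > 0" if "v \<noteq> 0" for v
    unfolding quad using kappa
    by (intro mult_pos_pos noise_gram_pos[OF kernel M2 T rho order_refl h \<Omega> that]) auto
  \<comment> \<open>Both hypotheses are treated at once: the moment \<open>h0\<close> of the
    deterministic part turns out to be 0 or \<open>H\<close>.\<close>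
  define e where "e y = (if x0 \<in> S then edge_response \<phi> (\<Theta>0 \<bullet> y) else 0)" for y
  define h0 where "h0 = first_moment \<rho> e"
  have [measurable]: "\<phi> \<in> borel_measurable borel"
    using \<phi>c by (rule borel_measurable_continuous_onI)
  note [measurable] = edge_response_measurable[of \<phi>]
  have em: "e \<in> borel_measurable borel"
    unfolding e_def by measurable
  have eb: "\<bar>e y\<bar> \<le> (\<integral>s. \<bar>\<phi> s\<bar> \<partial>lborel) + 1 / 2" for y
    using edge_response_bounded[OF \<phi>i, of "\<Theta>0 \<bullet> y"] by (simp add: e_def)
  have Fm [measurable]: "F \<in> borel_measurable W" by (rule F_rv)
  have law: "distr W borel F = mvn h0 Chat"
  proof (rule prob_space.law_eq_mvn[OF W F_rv sym pos])
    fix v :: "real^2"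
    \<comment> \<open>Subtracting \<open>h0\<close> removes the edge, centering of the disk removes
      \<open>c\<close>, and the integral of the noise path against \<open>v \<bullet> x\<close> is
      left.\<close>
    have G: "AE \<omega> in W. v \<bullet> (F \<omega> - h0) = (\<integral>x. (v \<bullet> x) * N \<omega> x \<partial>lborel_on (cball 0 \<rho>))"
      using N_cont F
    proof eventually_elim
      case (elim \<omega>)
      have "frec \<omega> = (\<lambda>y. c + e y + N \<omega> y)"
        by (simp add: frec e_def fun_eq_iff)
      then show ?case
        using first_moment_decomposition[OF em eb elim(1)] elim(2) by (simp add: h0_def)
    qed
    have "\<bar>v \<bullet> x\<bar> \<le> norm v * \<rho>" if "x \<in> cball 0 \<rho>" for x
      using that Cauchy_Schwarz_ineq2[of v x] mult_left_mono[of "norm x" \<rho> "norm v"] by simp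
    from gaussian_field_integral_char[OF W N_gauss N_mean N_cov N_cont compact_cball Cc _ _ this G]
    show "(CLINT \<omega>|W. iexp (v \<bullet> (F \<omega> - h0))) = of_real (exp (- (v \<bullet> (Chat *v v)) / 2))"
      unfolding quad' by simp
  qed auto
  have dist: "distributed W lborel F (mvn_density h0 Chat)"
  proof -
    have "distr W lborel F = distr W borel F"
      by (rule distr_cong) simp_all
    then show ?thesis
      unfolding distributed_def law by (simp add: mvn_def)
  qed
  have tail: "measure W {\<omega> \<in> space W. quad_stat Chat (F \<omega>) > t} = measure (mvn h0 Chat) {v. quad_stat Chat v > t}" for t
  proof -
    have [measurable]: "quad_stat Chat \<in> borel_measurable borel"
      unfolding quad_stat_def by measurable
    show ?thesis
      unfolding law[symmetric] by (subst measure_distr) (auto intro!: arg_cong[where f="measure W"])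
  qed
  \<comment> \<open>One whitening serves both cases: the null tail allows any, and the non-central
    tail needs the one adapted to \<open>h0\<close>.\<close>
  obtain A :: "real^2^2" where A: "A ** Chat ** transpose A = mat 1" "A *v h0 = vector [sqrt (quad_stat Chat h0), 0]"
    by (rule whitening_exists[OF sym pos, of h0])
  \<comment> \<open>A nonnegative threshold selects the exponential branch of the tail, whose value
    there is exp (ln \<alpha>).\<close>
  have "- 2 * ln \<alpha> \<ge> 0"
    using alpha by simp
  then have null: "measure (mvn 0 Chat) {v. quad_stat Chat v > - 2 * ln \<alpha>} = \<alpha>"
    using alpha by (simp add: measure_mvn_0_quad_stat[OF A(1) sym])
  have "h0 = 0" if "x0 \<notin> S"
    using that by (simp add: h0_def e_def first_moment_def set_lebesgue_integral_def)
  moreover have "h0 = H" if "x0 \<in> S"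
    using that by (simp add: h0_def H e_def[abs_def])
  ultimately show ?thesis
    using posdef_invertible[OF pos] lrt_rejection_region_iff[OF A(1) sym alpha] dist tail null
      measure_noncentral_chi2_tail[OF A(1) sym A(2)] by auto
qed

end
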